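(* Let $(M,\mathcal{X})$ and $(M,\mathcal{Y})$ be countable models of $\mathrm{WKL}^*_0$ (with the same first-order universe $M$) such that $(M,\mathcal{X}\cap\mathcal{Y})\models\neg\mathrm{I}\Sigma^0_1$. Let $\overline{c}$ be a (finite) tuple of elements of $M$ and let $\overline{C}$ be a (finite) tuple of elements of $\mathcal{X}\cap\mathcal{Y}$. Then there exists an isomorphism $h$ between $(M,\mathcal{X})$ and $(M,\mathcal{Y})$ such that $h(\overline{c})=\overline{c}$ and $h(\overline{C})=\overline{C}$.
   Context: Structures for the language of second-order arithmetic are pairs $(M,\mathcal{X})$, where $M$ is a first-order structure for the language of ordered rings (the first-order universe) and $\mathcal{X}\subseteq\mathcal{P}(M)$ is the second-order universe. $\Sigma^0_n$ formulas may contain second-order free variables/parameters. $\mathrm{RCA}^*_0$ consists of the basic axioms of arithmetic, $\Delta^0_1$-comprehension, $\Delta^0_1$-induction, and the axiom $\exp$ (totality of exponentiation). $\mathrm{WKL}$ says that every infinite 0--1 tree has an infinite path; $\mathrm{WKL}^*_0=\mathrm{RCA}^*_0+\mathrm{WKL}$. $\mathrm{I}\Sigma^0_1$ is the induction scheme for $\Sigma^0_1$ formulas; thus $(M,\mathcal{X}\cap\mathcal{Y})\models\neg\mathrm{I}\Sigma^0_1$ means that induction fails for some $\Sigma^0_1$ formula with number parameters from $M$ and set parameters from $\mathcal{X}\cap\mathcal{Y}$. An isomorphism between $(M,\mathcal{X})$ and $(M,\mathcal{Y})$ is an automorphism of $M$ whose induced action on subsets of $M$ maps $\mathcal{X}$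 onto $\mathcal{Y}$. *)

theory Defs
  imports "HOL-Library.Countable_Set"
begin

section \<open>First-order structures and the axioms of \<open>PA\<^sup>-\<close>\<close>

text \<open>
  A structure for the language \<open>0, 1, +, \<cdot>, <\<close> of ordered rings. Its universe is the whole
  type \<open>'m\<close>.
\<close>

record 'm arith =
  zer :: 'm  (\<open>\<zero>\<index>\<close>)
  unit :: 'm  (\<open>\<one>\<index>\<close>)
  add :: "'m \<Rightarrow> 'm \<Rightarrow> 'm"  (infixl \<open>\<oplus>\<index>\<close> 65)
  mul :: "'m \<Rightarrow> 'm \<Rightarrow> 'm"  (infixl \<open>\<otimes>\<index>\<close> 70)
  lt :: "'m \<Rightarrow> 'm \<Rightarrow> bool"  (infix \<open>\<prec>\<index>\<close> 50)

definition le :: "('m, 'z) arith_scheme \<Rightarrow> 'm \<Rightarrow> 'm \<Rightarrow> bool"  (infix \<open>\<preceq>\<index>\<close> 50) where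
  "x \<preceq>\<^bsub>M\<^esub> y \<longleftrightarrow> x \<prec>\<^bsub>M\<^esub> y \<or> x = y"

text \<open>
  The basic axioms of arithmetic are taken to be \<open>PA\<^sup>-\<close>, the theory of non-negative parts of
  discretely ordered rings.
\<close>

locale pa_minus =
  fixes M :: "'m arith" (structure)
  assumes add_assoc: "(x \<oplus> y) \<oplus> z = x \<oplus> (y \<oplus> z)"
    and add_comm: "x \<oplus> y = y \<oplus> x"
    and mul_assoc: "(x \<otimes> y) \<otimes> z = x \<otimes> (y \<otimes> z)"
    and mul_comm: "x \<otimes> y = y \<otimes> x"
    and distrib: "x \<otimes> (y \<oplus> z) = (x \<otimes> y) \<oplus> (x \<otimes> z)"
    and add_zero: "x \<oplus> \<zero> = x"
    and mul_zero: "x \<otimes> \<zero> = \<zero>"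
    and mul_one: "x \<otimes> \<one> = x"
    and lt_irrefl: "\<not> x \<prec> x"
    and lt_trans: "x \<prec> y \<Longrightarrow> y \<prec> z \<Longrightarrow> x \<prec> z"
    and lt_linear: "x \<prec> y \<or> x = y \<or> y \<prec> x"
    and add_mono: "x \<prec> y \<Longrightarrow> x \<oplus> z \<prec> y \<oplus> z"
    and mul_mono: "\<zero> \<prec> z \<Longrightarrow> x \<prec> y \<Longrightarrow> x \<otimes> z \<prec> y \<otimes> z"
    and lt_diff: "x \<prec> y \<Longrightarrow> \<exists>z. x \<oplus> z = y"
    and zero_lt_one: "\<zero> \<prec> \<one>"
    and discrete: "\<zero> \<prec> x \<Longrightarrow> \<one> \<preceq> x"
    and nonneg: "\<zero> \<preceq> x"


section \<open>Arithmetical formulas\<close>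

text \<open>
  Formulas of the language of second-order arithmetic without set quantifiers. Number variables
  and set variables are named by two separate copies of the natural numbers.
\<close>

datatype tm = Var nat | Zero | One | Plus tm tm | Times tm tm

datatype fm =
    Eq tm tm | Less tm tm | Mem tm nat
  | Neg fm | And fm fm | Or fm fm | Imp fm fm
  | Ex nat fm | All nat fm

primrec tm_vars :: "tm \<Rightarrow> nat set" where
  "tm_vars (Var x) = {x}"
| "tm_vars Zero = {}"
| "tm_vars One = {}"
| "tm_vars (Plus s t) = tm_vars s \<union> tm_vars t"
| "tm_vars (Times s t) = tm_vars s \<union> tm_vars t"

primrec tm_val :: "'m arith \<Rightarrow> (nat \<Rightarrow> 'm) \<Rightarrow> tm \<Rightarrow> 'm" where
  "tm_val M e (Var x) = e x"
| "tm_val M e Zero = \<zero>\<^bsub>M\<^esub>"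
| "tm_val M e One = \<one>\<^bsub>M\<^esub>"
| "tm_val M e (Plus s t) = tm_val M e s \<oplus>\<^bsub>M\<^esub> tm_val M e t"
| "tm_val M e (Times s t) = tm_val M e s \<otimes>\<^bsub>M\<^esub> tm_val M e t"

text \<open>
  The assignments \<open>e\<close> and \<open>E\<close> supply the number and set parameters. As there are no set
  quantifiers, the second-order universe enters only as the source of the values of \<open>E\<close>.
\<close>

primrec sat :: "'m arith \<Rightarrow> (nat \<Rightarrow> 'm) \<Rightarrow> (nat \<Rightarrow> 'm set) \<Rightarrow> fm \<Rightarrow> bool" where
  "sat M e E (Eq s t) \<longleftrightarrow> tm_val M e s = tm_val M e t"
| "sat M e E (Less s t) \<longleftrightarrow> tm_val M e s \<prec>\<^bsub>M\<^esub> tm_val M e t"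
| "sat M e E (Mem t X) \<longleftrightarrow> tm_val M e t \<in> E X"
| "sat M e E (Neg \<phi>) \<longleftrightarrow> \<not> sat M e E \<phi>"
| "sat M e E (And \<phi> \<psi>) \<longleftrightarrow> sat M e E \<phi> \<and> sat M e E \<psi>"
| "sat M e E (Or \<phi> \<psi>) \<longleftrightarrow> sat M e E \<phi> \<or> sat M e E \<psi>"
| "sat M e E (Imp \<phi> \<psi>) \<longleftrightarrow> (sat M e E \<phi> \<longrightarrow> sat M e E \<psi>)"
| "sat M e E (Ex x \<phi>) \<longleftrightarrow> (\<exists>a. sat M (e(x := a)) E \<phi>)"
| "sat M e E (All x \<phi>) \<longleftrightarrow> (\<forall>a. sat M (e(x := a)) E \<phi>)"

text \<open>\<open>\<Delta>\<^sup>0\<^sub>0\<close>: every quantifier is bounded by a term not containing the quantified variable.\<close>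

inductive delta00 :: "fm \<Rightarrow> bool" where
  "delta00 (Eq s t)"
| "delta00 (Less s t)"
| "delta00 (Mem t X)"
| "delta00 \<phi> \<Longrightarrow> delta00 (Neg \<phi>)"
| "delta00 \<phi> \<Longrightarrow> delta00 \<psi> \<Longrightarrow> delta00 (And \<phi> \<psi>)"
| "delta00 \<phi> \<Longrightarrow> delta00 \<psi> \<Longrightarrow> delta00 (Or \<phi> \<psi>)"
| "delta00 \<phi> \<Longrightarrow> delta00 \<psi> \<Longrightarrow> delta00 (Imp \<phi> \<psi>)"
| "delta00 \<phi> \<Longrightarrow> x \<notin> tm_vars t \<Longrightarrow> delta00 (Ex x (And (Less (Var x) t) \<phi>))"
| "delta00 \<phi> \<Longrightarrow> x \<notin> tm_vars t \<Longrightarrow> delta00 (All x (Imp (Less (Var x) t) \<phi>))"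

inductive sigma01 :: "fm \<Rightarrow> bool" where
  "delta00 \<phi> \<Longrightarrow> sigma01 \<phi>"
| "sigma01 \<phi> \<Longrightarrow> sigma01 (Ex x \<phi>)"

inductive pi01 :: "fm \<Rightarrow> bool" where
  "delta00 \<phi> \<Longrightarrow> pi01 \<phi>"
| "pi01 \<phi> \<Longrightarrow> pi01 (All x \<phi>)"


section \<open>Comprehension and induction schemes in \<open>(M, \<X>)\<close>\<close>

definition induction_holds :: "'m arith \<Rightarrow> ('m \<Rightarrow> bool) \<Rightarrow> bool" where
  "induction_holds M P \<longleftrightarrow>
    (P \<zero>\<^bsub>M\<^esub> \<and> (\<forall>a. P a \<longrightarrow> P (a \<oplus>\<^bsub>M\<^esub> \<one>\<^bsub>M\<^esub>)) \<longrightarrow> (\<forall>a. P a))"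

definition delta01_comprehension :: "'m arith \<Rightarrow> 'm set set \<Rightarrow> bool" where
  "delta01_comprehension M \<X> \<longleftrightarrow>
    (\<forall>\<phi> \<psi> x e E. sigma01 \<phi> \<longrightarrow> pi01 \<psi> \<longrightarrow> range E \<subseteq> \<X> \<longrightarrow>
      (\<forall>a. sat M (e(x := a)) E \<phi> \<longleftrightarrow> sat M (e(x := a)) E \<psi>) \<longrightarrow>
      (\<exists>A\<in>\<X>. \<forall>a. a \<in> A \<longleftrightarrow> sat M (e(x := a)) E \<phi>))"

definition delta01_induction :: "'m arith \<Rightarrow> 'm set set \<Rightarrow> bool" where
  "delta01_induction M \<X> \<longleftrightarrow>
    (\<forall>\<phi> \<psi> x e E. sigma01 \<phi> \<longrightarrow> pi01 \<psi> \<longrightarrow> range E \<subseteq> \<X> \<longrightarrow>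
      (\<forall>a. sat M (e(x := a)) E \<phi> \<longleftrightarrow> sat M (e(x := a)) E \<psi>) \<longrightarrow>
      induction_holds M (\<lambda>a. sat M (e(x := a)) E \<phi>))"

definition sigma01_induction :: "'m arith \<Rightarrow> 'm set set \<Rightarrow> bool" where
  "sigma01_induction M \<X> \<longleftrightarrow>
    (\<forall>\<phi> x e E. sigma01 \<phi> \<longrightarrow> range E \<subseteq> \<X> \<longrightarrow>
      induction_holds M (\<lambda>a. sat M (e(x := a)) E \<phi>))"


section \<open>Exponentiation\<close>

text \<open>
  Goedel's \<open>\<beta>\<close> function: \<open>beta M a b i r\<close> says that \<open>r\<close> is the remainder of \<open>a\<close> modulo
  \<open>1 + (i + 1) b\<close>. A pair \<open>(a, b)\<close> thus codes finite sequences of elements of \<open>M\<close>, and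
  \<open>x\<^sup>y = z\<close> means that some coded sequence starts with \<open>1\<close>, is multiplied by \<open>x\<close> at each of
  the first \<open>y\<close> steps, and has \<open>z\<close> at place \<open>y\<close>.
\<close>

definition beta :: "'m arith \<Rightarrow> 'm \<Rightarrow> 'm \<Rightarrow> 'm \<Rightarrow> 'm \<Rightarrow> bool" where
  "beta M a b i r \<longleftrightarrow>
    (let m = \<one>\<^bsub>M\<^esub> \<oplus>\<^bsub>M\<^esub> (i \<oplus>\<^bsub>M\<^esub> \<one>\<^bsub>M\<^esub>) \<otimes>\<^bsub>M\<^esub> b
     in r \<prec>\<^bsub>M\<^esub> m \<and> (\<exists>q. a = q \<otimes>\<^bsub>M\<^esub> m \<oplus>\<^bsub>M\<^esub> r))"

definition is_pow :: "'m arith \<Rightarrow> 'm \<Rightarrow> 'm \<Rightarrow> 'm \<Rightarrow> bool" where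
  "is_pow M x y z \<longleftrightarrow>
    (\<exists>a b. beta M a b \<zero>\<^bsub>M\<^esub> \<one>\<^bsub>M\<^esub> \<and>
      (\<forall>i. i \<prec>\<^bsub>M\<^esub> y \<longrightarrow>
        (\<exists>r. beta M a b i r \<and> beta M a b (i \<oplus>\<^bsub>M\<^esub> \<one>\<^bsub>M\<^esub>) (r \<otimes>\<^bsub>M\<^esub> x))) \<and>
      beta M a b y z)"

definition exp_total :: "'m arith \<Rightarrow> bool" where
  "exp_total M \<longleftrightarrow> (\<forall>x y. \<exists>z. is_pow M x y z)"


section \<open>Weak Koenig's lemma\<close>

text \<open>
  A finite 0--1 string is coded by the number whose binary expansion is the digit \<open>1\<close> followed by
  the string. So the empty string is \<open>1\<close>, the nonzero elements of \<open>M\<close> are exactly the codes of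
  strings, a string \<open>s\<close> has length \<open>n\<close> iff \<open>2\<^sup>n \<le> s < 2\<^sup>n\<^sup>+\<^sup>1\<close>, and the initial segments of \<open>s\<close>
  are the nonzero quotients of \<open>s\<close> by powers of \<open>2\<close>.
\<close>

definition is_pow2 :: "'m arith \<Rightarrow> 'm \<Rightarrow> 'm \<Rightarrow> bool" where
  "is_pow2 M n p \<longleftrightarrow> is_pow M (\<one>\<^bsub>M\<^esub> \<oplus>\<^bsub>M\<^esub> \<one>\<^bsub>M\<^esub>) n p"

definition string_length :: "'m arith \<Rightarrow> 'm \<Rightarrow> 'm \<Rightarrow> bool" where
  "string_length M s n \<longleftrightarrow> (\<exists>p. is_pow2 M n p \<and> p \<preceq>\<^bsub>M\<^esub> s \<and> s \<prec>\<^bsub>M\<^esub> p \<oplus>\<^bsub>M\<^esub> p)"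

definition initial_segment :: "'m arith \<Rightarrow> 'm \<Rightarrow> 'm \<Rightarrow> bool" where
  "initial_segment M t s \<longleftrightarrow>
    \<zero>\<^bsub>M\<^esub> \<prec>\<^bsub>M\<^esub> t \<and>
    (\<exists>k p. is_pow2 M k p \<and> t \<otimes>\<^bsub>M\<^esub> p \<preceq>\<^bsub>M\<^esub> s \<and> s \<prec>\<^bsub>M\<^esub> (t \<oplus>\<^bsub>M\<^esub> \<one>\<^bsub>M\<^esub>) \<otimes>\<^bsub>M\<^esub> p)"

definition last_bit_one :: "'m arith \<Rightarrow> 'm \<Rightarrow> bool" where
  "last_bit_one M t \<longleftrightarrow> (\<exists>u. t = u \<oplus>\<^bsub>M\<^esub> u \<oplus>\<^bsub>M\<^esub> \<one>\<^bsub>M\<^esub>)"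

text \<open>
  \<open>string_bit M s i\<close>: the entry of \<open>s\<close> at place \<open>i\<close> (counted from \<open>0\<close>) is \<open>1\<close>; it is the last
  entry of the initial segment of \<open>s\<close> of length \<open>i + 1\<close>.
\<close>

definition string_bit :: "'m arith \<Rightarrow> 'm \<Rightarrow> 'm \<Rightarrow> bool" where
  "string_bit M s i \<longleftrightarrow>
    (\<exists>t. initial_segment M t s \<and> string_length M t (i \<oplus>\<^bsub>M\<^esub> \<one>\<^bsub>M\<^esub>) \<and> last_bit_one M t)"

definition tree01 :: "'m arith \<Rightarrow> 'm set \<Rightarrow> bool" where
  "tree01 M T \<longleftrightarrow>
    (\<forall>s\<in>T. \<zero>\<^bsub>M\<^esub> \<prec>\<^bsub>M\<^esub> s) \<and> (\<forall>s\<in>T. \<forall>t. initial_segment M t s \<longrightarrow> t \<in> T)"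

text \<open>As usual in arithmetic, a set is infinite if it is unbounded in \<open>M\<close>.\<close>

definition unbounded :: "'m arith \<Rightarrow> 'm set \<Rightarrow> bool" where
  "unbounded M A \<longleftrightarrow> (\<forall>b. \<exists>a\<in>A. b \<prec>\<^bsub>M\<^esub> a)"

text \<open>
  An infinite 0--1 sequence is identified with the set \<open>P\<close> of places where it takes the value \<open>1\<close>.
  It is a path through \<open>T\<close> if each of its finite initial segments belongs to \<open>T\<close>.
\<close>

definition infinite_path :: "'m arith \<Rightarrow> 'm set \<Rightarrow> 'm set \<Rightarrow> bool" where
  "infinite_path M T P \<longleftrightarrow>
    (\<forall>n. \<exists>s\<in>T. string_length M s n \<and> (\<forall>i. i \<prec>\<^bsub>M\<^esub> n \<longrightarrow> (string_bit M s i \<longleftrightarrow> i \<in> P)))"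

definition WKL :: "'m arith \<Rightarrow> 'm set set \<Rightarrow> bool" where
  "WKL M \<X> \<longleftrightarrow> (\<forall>T\<in>\<X>. tree01 M T \<and> unbounded M T \<longrightarrow> (\<exists>P\<in>\<X>. infinite_path M T P))"


section \<open>Models of \<open>WKL\<^sup>*\<^sub>0\<close> and their isomorphisms\<close>

text \<open>
  The second-order universe is nonempty, as is every sort of a structure. Without this clause the
  comprehension scheme would hold vacuously in the empty universe.
\<close>

definition model_RCA0_star :: "'m arith \<Rightarrow> 'm set set \<Rightarrow> bool" where
  "model_RCA0_star M \<X> \<longleftrightarrow>
    \<X> \<noteq> {} \<and> pa_minus M \<and> delta01_comprehension M \<X> \<and> delta01_induction M \<X> \<and> exp_total M"

definition model_WKL0_star :: "'m arith \<Rightarrow> 'm set set \<Rightarrow> bool" where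
  "model_WKL0_star M \<X> \<longleftrightarrow> model_RCA0_star M \<X> \<and> WKL M \<X>"

definition countable_structure :: "'m arith \<Rightarrow> 'm set set \<Rightarrow> bool" where
  "countable_structure M \<X> \<longleftrightarrow> countable (UNIV :: 'm set) \<and> countable \<X>"

definition automorphism :: "'m arith \<Rightarrow> ('m \<Rightarrow> 'm) \<Rightarrow> bool" where
  "automorphism M h \<longleftrightarrow>
    bij h \<and> h \<zero>\<^bsub>M\<^esub> = \<zero>\<^bsub>M\<^esub> \<and> h \<one>\<^bsub>M\<^esub> = \<one>\<^bsub>M\<^esub> \<and>
    (\<forall>x y. h (x \<oplus>\<^bsub>M\<^esub> y) = h x \<oplus>\<^bsub>M\<^esub> h y) \<and>
    (\<forall>x y. h (x \<otimes>\<^bsub>M\<^esub> y) = h x \<otimes>\<^bsub>M\<^esub> h y) \<and>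
    (\<forall>x y. h x \<prec>\<^bsub>M\<^esub> h y \<longleftrightarrow> x \<prec>\<^bsub>M\<^esub> y)"

definition isomorphism :: "'m arith \<Rightarrow> 'm set set \<Rightarrow> 'm set set \<Rightarrow> ('m \<Rightarrow> 'm) \<Rightarrow> bool" where
  "isomorphism M \<X> \<Y> h \<longleftrightarrow> automorphism M h \<and> (\<lambda>A. h ` A) ` \<X> = \<Y>"

end

theory Submission
  imports Defs
begin

text \<open>
  The isomorphism comes from a back-and-forth argument on sets alone: a bijection \<open>\<X> \<rightarrow> \<Y>\<close> that preserves
  inclusion maps singletons to singletons and so induces a permutation of \<open>M\<close>. The failure of
  \<open>I\<Sigma>\<^sup>0\<^sub>1\<close> provides a cofinal sequence of levels in \<open>M\<close> indexed by a proper cut which is contained in an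
  exponentially closed proper cut \<open>I\<close>. The sets \<open>Z \<in> \<X>\<close> and \<open>W \<in> \<Y>\<close> chosen so far satisfy the same
  (possibly nonstandard) formulas with codes below some \<open>b \<notin> I\<close> in the finite structures below each level.
  When \<open>Z\<close> is extended, the truth values of the formulas below a smaller \<open>c \<notin> I\<close> at all levels are coded
  by a single \<open>s \<in> M\<close>, because the index cut is bounded. That \<open>s\<close> can be realised below a given level is a
  formula with code below \<open>b\<close>, hence true of \<open>W\<close> as well, and weak Koenig's lemma in \<open>(M, \<Y>)\<close> glues the
  realisations at the various levels into one set.
\<close>

section \<open>Models of \<open>PA\<^sup>-\<close> as ordered semirings\<close>

text \<open>A set of \<open>X\<close> outside the intersection is invisible in
  \<open>(M, Y)\<close>, so a type can be moved across only as an element \<open>s\<close> of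
  \<open>M\<close>. The statement that \<open>s\<close> is realised is then a formula whose code is
  at least \<open>s\<close>, which is why agreement must include nonstandard formulas. Formulas
  below \<open>c\<close> at fewer than \<open>c\<close> levels give a table of
  \<open>c \<otimes> c\<close> bits, so \<open>s\<close> is bounded by a power of two with exponent
  about \<open>c \<otimes> c\<close>, and an extension costs one application of
  \<open>growth\<close>: agreement below \<open>b\<close> yields agreement below some
  \<open>c\<close> with \<open>growth c\<close> less than \<open>b\<close>. As \<open>I\<close> is
  closed under \<open>growth\<close>, this \<open>c\<close> can again be kept outside
  \<open>I\<close>, and the process can be repeated. Truth is evaluated in bounded structures
  because there it is decided by a code in \<open>M\<close> and stays
  \<open>\<Delta>\<^sup>0\<^sub>1\<close>, the only induction at hand. Nothing is lost, since
  non-inclusion, sums and products are existential relations and the levels are cofinal.\<close>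

context pa_minus
begin

text \<open>Truncated subtraction serves as the minus operation required by
  \<open>linordered_semidom\<close>, through which the library facts on ordered semirings become
  available.\<close>

definition monus :: "'m \<Rightarrow> 'm \<Rightarrow> 'm" where
  "monus x y = (if y \<preceq> x then (THE z. y \<oplus> z = x) else \<zero>)"

lemma add_cancel: "x \<oplus> z = y \<oplus> z \<Longrightarrow> x = y"
  using add_mono[of x y z] add_mono[of y x z] lt_linear[of x y] lt_irrefl by metis

lemma add_monus: "x \<oplus> y = z \<Longrightarrow> monus z x = y"
proof -
  assume a: "x \<oplus> y = z"
  have "x \<preceq> z"
    using a nonneg[of y] add_mono[of \<zero> y x] add_zero add_comm unfolding le_def by metis
  moreover have "(THE w. x \<oplus> w = z) = y"
    using a add_cancel add_comm by (intro the_equality) metis+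
  ultimately show ?thesis by (simp add: monus_def)
qed

sublocale ord: linordered_semidom
  where minus = monus and one = "\<one>" and times = "(\<otimes>)" and plus = "(\<oplus>)" and zero = "\<zero>"
    and less_eq = "(\<preceq>)" and less = "(\<prec>)"
proof
  show "a \<otimes> b \<otimes> c = a \<otimes> (b \<otimes> c)" for a b c by (rule mul_assoc)
  show "a \<otimes> b = b \<otimes> a" for a b by (rule mul_comm)
  show "a \<oplus> b \<oplus> c = a \<oplus> (b \<oplus> c)" for a b c by (rule add_assoc)
  show "a \<oplus> b = b \<oplus> a" for a b by (rule add_comm)
  show "\<zero> \<oplus> a = a" for a using add_zero add_comm by metis
  show "\<one> \<otimes> a = a" for a using mul_one mul_comm by metis
  show "(a \<oplus> b) \<otimes> c = a \<otimes> c \<oplus> b \<otimes> c" for a b c using distrib mul_comm by metis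
  show "a \<otimes> (b \<oplus> c) = a \<otimes> b \<oplus> a \<otimes> c" for a b c by (rule distrib)
  show "a \<otimes> monus b c = monus (a \<otimes> b) (a \<otimes> c)" for a b c
  proof (cases "c \<preceq> b")
    case True
    then obtain d where d: "c \<oplus> d = b" using lt_diff add_zero unfolding le_def by metis
    then have "a \<otimes> c \<oplus> a \<otimes> d = a \<otimes> b" using distrib by metis
    then show ?thesis using add_monus d by metis
  next
    case False
    then have "b \<prec> c" using lt_linear unfolding le_def by metis
    then have "monus b c = \<zero>" using False by (simp add: monus_def)
    moreover have "monus (a \<otimes> b) (a \<otimes> c) = \<zero>"
    proof (cases "a = \<zero>")
      case True
      then show ?thesis using add_monus[of \<zero> \<zero> \<zero>] add_zero mul_zero mul_comm by metis
    next
      case False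
      then have "\<zero> \<prec> a" using nonneg unfolding le_def by metis
      then have "a \<otimes> b \<prec> a \<otimes> c" using \<open>b \<prec> c\<close> mul_mono mul_comm by metis
      then have "\<not> a \<otimes> c \<preceq> a \<otimes> b" using lt_trans lt_irrefl unfolding le_def by metis
      then show ?thesis by (simp add: monus_def)
    qed
    ultimately show ?thesis using mul_zero by simp
  qed
  show "\<zero> \<noteq> \<one>" using zero_lt_one lt_irrefl by metis
  show "\<zero> \<otimes> a = \<zero>" for a using mul_zero mul_comm by metis
  show "a \<otimes> \<zero> = \<zero>" for a by (rule mul_zero)
  show "monus (a \<oplus> b) a = b" for a b by (rule add_monus) simp
  show "monus (monus a b) c = monus a (b \<oplus> c)" for a b c
  proof (cases "b \<oplus> c \<preceq> a")
    case True
    then obtain d where d: "b \<oplus> c \<oplus> d = a" using lt_diff add_zero unfolding le_def by metis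
    then have "monus a b = c \<oplus> d" by (intro add_monus) (simp add: add_assoc)
    then show ?thesis using add_monus[OF d] add_monus[of c d "c \<oplus> d"] by simp
  next
    case False
    then have 1: "monus a (b \<oplus> c) = \<zero>" by (simp add: monus_def)
    show ?thesis
    proof (cases "b \<preceq> a")
      case True
      then obtain d where d: "b \<oplus> d = a" using lt_diff add_zero unfolding le_def by metis
      have "\<not> c \<preceq> d" using False d add_mono[of c d b] add_comm unfolding le_def by metis
      then show ?thesis using 1 add_monus[OF d] by (simp add: monus_def)
    next
      case False
      then have "monus a b = \<zero>" by (simp add: monus_def)
      moreover have "monus \<zero> c = \<zero>"
        using add_monus[of \<zero> \<zero> \<zero>] add_zero nonneg[of c] lt_trans lt_irrefl
        unfolding monus_def le_def by metis
      ultimately show ?thesis using 1 by simp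
    qed
  qed
  show "a \<prec> b \<longleftrightarrow> a \<preceq> b \<and> \<not> b \<preceq> a" for a b
    using lt_trans lt_irrefl unfolding le_def by metis
  show "a \<preceq> a" for a by (simp add: le_def)
  show "a \<preceq> b \<Longrightarrow> b \<preceq> c \<Longrightarrow> a \<preceq> c" for a b c using lt_trans unfolding le_def by metis
  show "a \<preceq> b \<Longrightarrow> b \<preceq> a \<Longrightarrow> a = b" for a b using lt_trans lt_irrefl unfolding le_def by metis
  show "a \<preceq> b \<or> b \<preceq> a" for a b using lt_linear unfolding le_def by metis
  show "a \<preceq> b \<Longrightarrow> c \<oplus> a \<preceq> c \<oplus> b" for a b c using add_mono add_comm unfolding le_def by metis
  show "a \<prec> b \<Longrightarrow> \<zero> \<prec> c \<Longrightarrow> c \<otimes> a \<prec> c \<otimes> b" for a b c using mul_mono mul_comm by metis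
  show "\<zero> \<prec> \<one>" by (rule zero_lt_one)
  show "b \<preceq> a \<Longrightarrow> monus a b \<oplus> b = a" for a b
    using lt_diff add_monus add_comm add_zero unfolding le_def by metis
  show "a \<noteq> \<zero> \<Longrightarrow> b \<noteq> \<zero> \<Longrightarrow> a \<otimes> b \<noteq> \<zero>" for a b
    using nonneg mul_mono mul_zero mul_comm lt_irrefl unfolding le_def by metis
qed


section \<open>Discreteness of the order and a polynomial pairing function\<close>

lemma zero_le [simp]: "\<zero> \<preceq> x"
  by (rule nonneg)

lemma lt_suc: "x \<prec> y \<oplus> \<one> \<longleftrightarrow> x \<preceq> y"
proof
  assume a: "x \<prec> y \<oplus> \<one>"
  show "x \<preceq> y"
  proof (rule ccontr)
    assume "\<not> x \<preceq> y"
    then have yx: "y \<prec> x" by order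
    then obtain z where z: "y \<oplus> z = x" using lt_diff by blast
    then have "z \<noteq> \<zero>" using yx add_zero by auto
    then have "\<one> \<preceq> z" using discrete nonneg unfolding le_def by metis
    then have "y \<oplus> \<one> \<preceq> x" using z ord.add_left_mono[of \<one> z y] by simp
    then show False using a by order
  qed
next
  assume "x \<preceq> y"
  then show "x \<prec> y \<oplus> \<one>" by (meson ord.less_add_one ord.le_less_trans)
qed

lemma suc_le: "x \<oplus> \<one> \<preceq> y \<longleftrightarrow> x \<prec> y"
  using lt_suc[of y x] by (metis ord.not_le)

lemma not_lt_zero: "\<not> x \<prec> \<zero>"
  using nonneg[of x] by order

lemma pos_iff: "\<zero> \<prec> x \<longleftrightarrow> x \<noteq> \<zero>"
  using nonneg[of x] lt_irrefl unfolding le_def by auto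

lemma le_add1: "x \<preceq> x \<oplus> y"
  using ord.add_left_mono[OF nonneg[of y], of x] by (simp add: add_zero)

lemma le_add2: "y \<preceq> x \<oplus> y"
  using le_add1 add_comm by metis

lemma le_mul: "\<zero> \<prec> y \<Longrightarrow> x \<preceq> x \<otimes> y"
  using ord.mult_left_mono[of \<one> y x] discrete nonneg mul_one by metis

lemma le_iff_add: "x \<preceq> y \<longleftrightarrow> (\<exists>z. y = x \<oplus> z)"
  using lt_diff add_zero le_add1 unfolding le_def by metis

lemma nonzero_suc: "x \<noteq> \<zero> \<Longrightarrow> \<exists>y. x = y \<oplus> \<one>"
  using discrete pos_iff le_iff_add add_comm by metis

text \<open>A polynomial, hence a term of the language, so that formulas can mention a pair without
  a quantifier or a division by two. The price is that not every element is a pair.\<close>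

definition pair :: "'m \<Rightarrow> 'm \<Rightarrow> 'm" where
  "pair x y = (x \<oplus> y) \<otimes> (x \<oplus> y) \<oplus> x"

lemma le_square: "x \<preceq> x \<otimes> x"
  using le_mul pos_iff mul_zero nonneg by metis

lemma pair_ge1: "x \<preceq> pair x y"
  by (simp add: pair_def le_add2)

lemma pair_ge2: "y \<preceq> pair x y"
  using le_square[of "x \<oplus> y"] le_add2[of y x] le_add1[of "(x \<oplus> y) \<otimes> (x \<oplus> y)" x]
  unfolding pair_def by order

text \<open>A pair with sum \<open>s\<close> lies from the square of \<open>s\<close> up to below
  the square of \<open>s \<oplus> \<one>\<close>, so the sum of the components can be recovered
  first; injectivity follows.\<close>

lemma pair_less: "x \<oplus> y \<prec> x' \<oplus> y' \<Longrightarrow> pair x y \<prec> pair x' y'"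
proof -
  assume a: "x \<oplus> y \<prec> x' \<oplus> y'"
  let ?s = "x \<oplus> y"
  have "pair x y \<preceq> ?s \<otimes> ?s \<oplus> ?s"
    by (simp add: pair_def le_add1 ord.add_left_mono)
  also have "\<dots> \<prec> (?s \<oplus> \<one>) \<otimes> (?s \<oplus> \<one>)"
  proof -
    have "(?s \<oplus> \<one>) \<otimes> (?s \<oplus> \<one>) = (?s \<otimes> ?s \<oplus> ?s) \<oplus> ?s \<oplus> \<one>" 
      by (simp add: algebra_simps)
    then show ?thesis using lt_suc[of "?s \<otimes> ?s \<oplus> ?s"] le_add1 by metis
  qed
  also have "\<dots> \<preceq> (x' \<oplus> y') \<otimes> (x' \<oplus> y')"
    using a suc_le nonneg by (meson ord.mult_mono)
  also have "\<dots> \<preceq> pair x' y'" by (simp add: pair_def le_add1)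
  finally show ?thesis .
qed

lemma pair_eq [simp]: "pair x y = pair x' y' \<longleftrightarrow> x = x' \<and> y = y'"
proof
  assume a: "pair x y = pair x' y'"
  then have s: "x \<oplus> y = x' \<oplus> y'"
    using pair_less[of x y x' y'] pair_less[of x' y' x y] lt_linear lt_irrefl by metis
  then have "x = x'" using a add_cancel add_comm unfolding pair_def by metis
  then show "x = x' \<and> y = y'" using s add_cancel add_comm by metis
qed auto

lemma pair_mono: "x \<preceq> x' \<Longrightarrow> y \<preceq> y' \<Longrightarrow> pair x y \<preceq> pair x' y'"
  unfolding pair_def by (intro ord.add_mono ord.mult_mono) (auto intro: zero_le)

text \<open>The default \<open>\<zero>\<close> for non-pairs makes the projections total and keeps
  them below their argument, on which the recursion over formula codes relies.\<close>

definition proj1 :: "'m \<Rightarrow> 'm" where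
  "proj1 z = (if \<exists>x y. z = pair x y then (THE x. \<exists>y. z = pair x y) else \<zero>)"

definition proj2 :: "'m \<Rightarrow> 'm" where
  "proj2 z = (if \<exists>x y. z = pair x y then (THE y. \<exists>x. z = pair x y) else \<zero>)"

lemma proj1_pair [simp]: "proj1 (pair x y) = x" and proj2_pair [simp]: "proj2 (pair x y) = y"
  unfolding proj1_def proj2_def by auto

lemma proj1_junk: "\<nexists>x y. z = pair x y \<Longrightarrow> proj1 z = \<zero>" and proj2_junk: "\<nexists>x y. z = pair x y \<Longrightarrow> proj2 z = \<zero>"
  unfolding proj1_def proj2_def by auto

end

section \<open>Closure properties of the second-order universe\<close>

locale rca = pa_minus M for M :: "'m arith" (structure) +
  fixes X :: "'m set set"
  assumes X_ne: "X \<noteq> {}"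
    and comp: "delta01_comprehension M X"
    and ind: "delta01_induction M X"
    and exp: "exp_total M"
begin

text \<open>Relations between several elements are treated as properties of their iterated pair, so that each
  closure property needs only one concrete formula.\<close>

definition Def :: "('m \<Rightarrow> bool) \<Rightarrow> bool" where
  "Def P \<longleftrightarrow> Collect P \<in> X"

definition Fun :: "('m \<Rightarrow> 'm) \<Rightarrow> bool" where
  "Fun f \<longleftrightarrow> Def (\<lambda>z. \<exists>x. z = pair x (f x))"

abbreviation pair_tm :: "tm \<Rightarrow> tm \<Rightarrow> tm" where
  "pair_tm s t \<equiv> Plus (Times (Plus s t) (Plus s t)) s"

lemma pair_tm: "tm_val M e (pair_tm s t) = pair (tm_val M e s) (tm_val M e t)"
  by (simp add: pair_def)

abbreviation bex :: "nat \<Rightarrow> tm \<Rightarrow> fm \<Rightarrow> fm" where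
  "bex x t \<phi> \<equiv> Ex x (And (Less (Var x) t) \<phi>)"

lemma Def_delta1:
  assumes "sigma01 \<phi>" "pi01 \<psi>" "range E \<subseteq> X"
    and "\<And>a. sat M (e(0 := a)) E \<phi> \<longleftrightarrow> P a" "\<And>a. sat M (e(0 := a)) E \<psi> \<longleftrightarrow> P a"
  shows "Def P"
proof -
  have "\<exists>A\<in>X. \<forall>a. a \<in> A \<longleftrightarrow> sat M (e(0 := a)) E \<phi>"
    by (rule comp[unfolded delta01_comprehension_def, rule_format, OF assms(1-3)])
      (simp add: assms(4,5))
  then obtain A where "A \<in> X" "\<forall>a. a \<in> A \<longleftrightarrow> P a" using assms(4) by blast
  then have "Collect P = A" by auto
  then show ?thesis using \<open>A \<in> X\<close> by (simp add: Def_def)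
qed

lemma Def_delta0:
  assumes "delta00 \<phi>" "range E \<subseteq> X" "\<And>a. sat M (e(0 := a)) E \<phi> \<longleftrightarrow> P a"
  shows "Def P"
  using Def_delta1[OF sigma01.intros(1) pi01.intros(1)] assms by blast

named_theorems Def_intros

text \<open>An assignment must send every set variable into \<open>X\<close>, so all variables other
  than \<open>0\<close> share the second set. Two set parameters are enough for every concrete
  formula below.\<close>

definition two_sets :: "('m \<Rightarrow> bool) \<Rightarrow> ('m \<Rightarrow> bool) \<Rightarrow> nat \<Rightarrow> 'm set" where
  "two_sets P Q n = (if n = 0 then Collect P else Collect Q)"

lemma two_sets: "Def P \<Longrightarrow> Def Q \<Longrightarrow> range (two_sets P Q) \<subseteq> X"
  by (auto simp: two_sets_def Def_def)

lemma two_sets_mem: "x \<in> two_sets P Q 0 \<longleftrightarrow> P x" "x \<in> two_sets P Q (Suc n) \<longleftrightarrow> Q x"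
  by (auto simp: two_sets_def)

lemma Def_set [Def_intros]: "A \<in> X \<Longrightarrow> Def (\<lambda>x. x \<in> A)"
  by (simp add: Def_def)

lemma delta00_simps [simp]:
  "delta00 (Eq s t)" "delta00 (Less s t)" "delta00 (Mem t n)"
  "delta00 \<phi> \<Longrightarrow> delta00 (Neg \<phi>)"
  "delta00 \<phi> \<Longrightarrow> delta00 \<psi> \<Longrightarrow> delta00 (And \<phi> \<psi>)"
  "delta00 \<phi> \<Longrightarrow> delta00 \<psi> \<Longrightarrow> delta00 (Or \<phi> \<psi>)"
  "delta00 \<phi> \<Longrightarrow> delta00 \<psi> \<Longrightarrow> delta00 (Imp \<phi> \<psi>)"
  "delta00 \<phi> \<Longrightarrow> x \<notin> tm_vars t \<Longrightarrow> delta00 (bex x t \<phi>)"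
  by (auto intro: delta00.intros)

section \<open>Closure under Boolean operations and substitution of definable functions\<close>

lemma Def_not [Def_intros]: "Def P \<Longrightarrow> Def (\<lambda>x. \<not> P x)"
  by (rule Def_delta0[where \<phi> = "Neg (Mem (Var 0) 0)" and E = "two_sets P P", OF _ two_sets])
    (simp_all add: two_sets_mem)

lemma Def_and [Def_intros]: "Def P \<Longrightarrow> Def Q \<Longrightarrow> Def (\<lambda>x. P x \<and> Q x)"
  by (rule Def_delta0[where \<phi> = "And (Mem (Var 0) 0) (Mem (Var 0) (Suc 0))" and E = "two_sets P Q", OF _ two_sets])
    (simp_all add: two_sets_mem)

lemma Def_or [Def_intros]: "Def P \<Longrightarrow> Def Q \<Longrightarrow> Def (\<lambda>x. P x \<or> Q x)"
  by (rule Def_delta0[where \<phi> = "Or (Mem (Var 0) 0) (Mem (Var 0) (Suc 0))" and E = "two_sets P Q", OF _ two_sets])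
    (simp_all add: two_sets_mem)

lemma Def_cong: "Def P \<Longrightarrow> (\<And>x. P x \<longleftrightarrow> Q x) \<Longrightarrow> Def Q"
  using Collect_cong[of P Q] by (simp add: Def_def)

lemma Def_imp [Def_intros]: "Def P \<Longrightarrow> Def Q \<Longrightarrow> Def (\<lambda>x. P x \<longrightarrow> Q x)"
  by (rule Def_cong[OF Def_or[OF Def_not[of P], of Q]]) auto

lemma Def_iff [Def_intros]: "Def P \<Longrightarrow> Def Q \<Longrightarrow> Def (\<lambda>x. P x \<longleftrightarrow> Q x)"
  by (rule Def_cong[OF Def_and[OF Def_imp[of P Q] Def_imp[of Q P]]]) auto

lemma Def_const [Def_intros]: "Def (\<lambda>x. c)"
proof -
  \<comment> \<open>The two constants arise as a set joined with its complement and met with its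
    complement, which takes one member of \<open>X\<close> to start from.\<close>
  obtain A where "A \<in> X" using X_ne by blast
  then have "Def (\<lambda>x. x \<in> A \<or> x \<notin> A)" "Def (\<lambda>x. x \<in> A \<and> x \<notin> A)" by (intro Def_intros; simp)+
  then show ?thesis by (cases c) auto
qed

text \<open>The value \<open>f x\<close> has no bound in terms of \<open>x\<close>, but because the
  graph is total and single-valued it can be quantified existentially or universally, which makes
  the property \<open>\<Delta>\<^sup>0\<^sub>1\<close>.\<close>

lemma Def_subst: "Def P \<Longrightarrow> Fun f \<Longrightarrow> Def (\<lambda>x. P (f x))"
  unfolding Fun_def
  by (rule Def_delta1[where \<phi> = "Ex 1 (And (Mem (pair_tm (Var 0) (Var 1)) 0) (Mem (Var 1) (Suc 0)))" and
        \<psi> = "All 1 (Imp (Mem (pair_tm (Var 0) (Var 1)) 0) (Mem (Var 1) (Suc 0)))" and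
        E = "two_sets (\<lambda>z. \<exists>x. z = pair x (f x)) P", OF _ _ two_sets])
    (simp_all add: two_sets_mem sigma01.intros pi01.intros flip: pair_def)

lemma Def_pair: "Def (\<lambda>z. \<exists>x y. z = pair x y)"
proof -
  have *: "(\<exists>x y. z = pair x y) \<longleftrightarrow> (\<exists>x. x \<prec> z \<oplus> \<one> \<and> (\<exists>y. y \<prec> z \<oplus> \<one> \<and> z = pair x y))" for z
    using pair_ge1 pair_ge2 lt_suc by metis
  show ?thesis unfolding *
  by (rule Def_delta0[where \<phi> = "bex 1 (Plus (Var 0) One) (bex 2 (Plus (Var 0) One) (Eq (Var 0) (pair_tm (Var 1) (Var 2))))",
       OF _ two_sets[OF Def_const Def_const]]) (simp_all flip: pair_def)
qed

lemma Fun_pair: 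
  assumes "Fun f" "Fun g" shows "Fun (\<lambda>x. pair (f x) (g x))"
proof -
  have *: "(\<exists>x. z = pair x (pair (f x) (g x))) \<longleftrightarrow> 
     (\<exists>x. x \<prec> z \<oplus> \<one> \<and> (\<exists>u. u \<prec> z \<oplus> \<one> \<and> (\<exists>v. v \<prec> z \<oplus> \<one> \<and> z = pair x (pair u v) \<and>
       (\<exists>x'. pair x u = pair x' (f x')) \<and> (\<exists>x'. pair x v = pair x' (g x')))))" for z
  proof -
    have "x \<preceq> pair x (pair u v)" "u \<preceq> pair x (pair u v)" "v \<preceq> pair x (pair u v)" for x u v
      using pair_ge1 pair_ge2 ord.order_trans by metis+
    then show ?thesis by (auto simp: lt_suc)
  qed
  show ?thesis unfolding Fun_def *
  by (rule Def_delta0[where \<phi> = "bex 1 (Plus (Var 0) One) (bex 2 (Plus (Var 0) One) (bex 3 (Plus (Var 0) One)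
      (And (Eq (Var 0) (pair_tm (Var 1) (pair_tm (Var 2) (Var 3)))) (And (Mem (pair_tm (Var 1) (Var 2)) 0) (Mem (pair_tm (Var 1) (Var 3)) (Suc 0))))))",
       OF _ two_sets[OF assms[unfolded Fun_def]]]) (simp_all add: two_sets_mem flip: pair_def)
qed

text \<open>Codes that are not pairs may satisfy \<open>B\<close> arbitrarily; intersecting with the
  set of pairs leaves exactly the graph.\<close>

lemma Fun_graph: "Def B \<Longrightarrow> (\<And>x y. B (pair x y) \<longleftrightarrow> y = f x) \<Longrightarrow> Fun f"
  unfolding Fun_def by (rule Def_cong[OF Def_and[OF _ Def_pair], of B]) auto

lemma Fun_const: "Fun (\<lambda>x. c)"
proof (rule Fun_graph)
  show "Def (\<lambda>z. \<exists>x. x \<prec> z \<oplus> \<one> \<and> z = pair x c)"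
    by (rule Def_delta0[where e = "\<lambda>n. c" and \<phi> = "bex 1 (Plus (Var 0) One) (Eq (Var 0) (pair_tm (Var 1) (Var 2)))",
       OF _ two_sets[OF Def_const Def_const]]) (simp_all flip: pair_def)
qed (auto simp: lt_suc pair_ge1)

lemma Fun_id: "Fun (\<lambda>x. x)"
proof (rule Fun_graph)
  show "Def (\<lambda>z. \<exists>x. x \<prec> z \<oplus> \<one> \<and> z = pair x x)"
    by (rule Def_delta0[where \<phi> = "bex 1 (Plus (Var 0) One) (Eq (Var 0) (pair_tm (Var 1) (Var 1)))",
       OF _ two_sets[OF Def_const Def_const]]) (simp_all flip: pair_def)
qed (auto simp: lt_suc pair_ge1)

lemma Fun_comp: assumes "Fun g" "Fun f" shows "Fun (\<lambda>x. g (f x))"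
proof -
  let ?G = "\<lambda>f z. \<exists>x. z = pair x (f x)"
  \<comment> \<open>The intermediate value \<open>f x\<close> is variable \<open>3\<close>. It is
    not bounded by the pair in question, so its quantifier is put in front, once existentially and
    once universally.\<close>
  have p: "sigma01 (bex 1 (Plus (Var 0) One) (bex 2 (Plus (Var 0) One) (And (Eq (Var 0) (pair_tm (Var 1) (Var 2)))
      (And (Mem (pair_tm (Var 1) (Var 3)) 0) (Mem (pair_tm (Var 3) (Var 2)) 1)))))"
     "pi01 (bex 1 (Plus (Var 0) One) (bex 2 (Plus (Var 0) One) (And (Eq (Var 0) (pair_tm (Var 1) (Var 2)))
      (Imp (Mem (pair_tm (Var 1) (Var 3)) 0) (Mem (pair_tm (Var 3) (Var 2)) 1)))))"
    by (simp_all add: sigma01.intros pi01.intros)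
  have *: "(\<forall>u. \<exists>x y. a = pair x y \<and> (u = f x \<longrightarrow> y = g (f x))) \<longleftrightarrow> (\<exists>x. a = pair x (g (f x)))" for a
    by (metis pair_eq)
  have **: "(\<exists>x. x \<preceq> a \<and> (\<exists>y. y \<preceq> a \<and> a = pair x y \<and> P x y)) \<longleftrightarrow> (\<exists>x y. a = pair x y \<and> P x y)" for a P
    using pair_ge1 pair_ge2 by metis
  show ?thesis unfolding Fun_def
    by (rule Def_delta1[OF sigma01.intros(2)[OF p(1), of 3] pi01.intros(2)[OF p(2), of 3] two_sets[OF assms(2,1)[unfolded Fun_def]]])
      ((simp add: two_sets_mem lt_suc ** * flip: pair_def; fail) | (auto simp: two_sets_mem lt_suc pair_ge1 pair_ge2 simp flip: pair_def; fail))+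
qed

lemma Fun_proj1': "Fun proj1" and Fun_proj2': "Fun proj2"
proof -
  let ?B = "\<lambda>w a b. \<exists>z. z \<prec> w \<oplus> \<one> \<and> (\<exists>x. x \<prec> w \<oplus> \<one> \<and> w = pair z x \<and>
      ((\<exists>y. y \<prec> w \<oplus> \<one> \<and> z = (if a then pair x y else pair y x)) \<or> 
         x = \<zero> \<and> \<not> (\<exists>u. u \<prec> w \<oplus> \<one> \<and> (\<exists>v. v \<prec> w \<oplus> \<one> \<and> z = pair u v))))"
  have "Def (\<lambda>w. ?B w True b)" for b
    by (rule Def_delta0[where \<phi> = "bex 1 (Plus (Var 0) One) (bex 2 (Plus (Var 0) One) (And (Eq (Var 0) (pair_tm (Var 1) (Var 2)))
       (Or (bex 3 (Plus (Var 0) One) (Eq (Var 1) (pair_tm (Var 2) (Var 3)))) (And (Eq (Var 2) Zero) 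
        (Neg (bex 3 (Plus (Var 0) One) (bex 4 (Plus (Var 0) One) (Eq (Var 1) (pair_tm (Var 3) (Var 4))))))))))",
       OF _ two_sets[OF Def_const Def_const]]) (simp_all flip: pair_def)
  then show "Fun proj1"
  proof (rule Fun_graph)
    fix z x
    have *: "u \<preceq> pair (pair u v) x" "v \<preceq> pair (pair u v) x" for u v x
      using pair_ge1 pair_ge2 ord.order_trans by metis+
    show "?B (pair z x) True b \<longleftrightarrow> x = proj1 z" for b
    proof (cases "\<exists>u v. z = pair u v")
      case True
      then show ?thesis by (auto simp: lt_suc pair_ge1 pair_ge2 *) (use * in blast)
    next
      case False
      then show ?thesis by (auto simp: lt_suc pair_ge1 pair_ge2 proj1_junk)
    qed
  qed
  have "Def (\<lambda>w. ?B w False b)" for b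
    by (rule Def_delta0[where \<phi> = "bex 1 (Plus (Var 0) One) (bex 2 (Plus (Var 0) One) (And (Eq (Var 0) (pair_tm (Var 1) (Var 2)))
       (Or (bex 3 (Plus (Var 0) One) (Eq (Var 1) (pair_tm (Var 3) (Var 2)))) (And (Eq (Var 2) Zero) 
        (Neg (bex 3 (Plus (Var 0) One) (bex 4 (Plus (Var 0) One) (Eq (Var 1) (pair_tm (Var 3) (Var 4))))))))))",
       OF _ two_sets[OF Def_const Def_const]]) (simp_all flip: pair_def)
  then show "Fun proj2"
  proof (rule Fun_graph)
    fix z x
    have *: "u \<preceq> pair (pair u v) x" "v \<preceq> pair (pair u v) x" for u v x
      using pair_ge1 pair_ge2 ord.order_trans by metis+
    show "?B (pair z x) False b \<longleftrightarrow> x = proj2 z" for b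
    proof (cases "\<exists>u v. z = pair u v")
      case True
      then show ?thesis by (auto simp: lt_suc pair_ge1 pair_ge2 *) (use * in blast)
    next
      case False
      then show ?thesis by (auto simp: lt_suc pair_ge1 pair_ge2 proj2_junk)
    qed
  qed
qed

lemmas Fun_proj1 = Fun_comp[OF Fun_proj1'] and Fun_proj2 = Fun_comp[OF Fun_proj2']

lemma Def_rel: 
  assumes "Def (\<lambda>z. R (proj1 z) (proj2 z))" "Fun f" "Fun g"
  shows "Def (\<lambda>x. R (f x) (g x))"
  using Def_subst[OF assms(1) Fun_pair[OF assms(2,3)]] by simp

lemma Fun_op: 
  assumes "Fun (\<lambda>z. h (proj1 z) (proj2 z))" "Fun f" "Fun g"
  shows "Fun (\<lambda>x. h (f x) (g x))"
  using Fun_comp[OF assms(1) Fun_pair[OF assms(2,3)]] by simp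

section \<open>Binary relations and operations, bounded quantifiers, induction\<close>

lemma Def_lt' : "Def (\<lambda>z. proj1 z \<prec> proj2 z)" and Def_eq': "Def (\<lambda>z. proj1 z = proj2 z)"
proof -
  have "Def (\<lambda>z. \<exists>x. x \<prec> z \<oplus> \<one> \<and> (\<exists>y. y \<prec> z \<oplus> \<one> \<and> z = pair x y \<and> x \<prec> y))"
    by (rule Def_delta0[where \<phi> = "bex 1 (Plus (Var 0) One) (bex 2 (Plus (Var 0) One) (And (Eq (Var 0) (pair_tm (Var 1) (Var 2))) (Less (Var 1) (Var 2))))",
       OF _ two_sets[OF Def_const Def_const]]) (simp_all flip: pair_def)
  then show "Def (\<lambda>z. proj1 z \<prec> proj2 z)"
  proof (rule Def_cong)
    show "(\<exists>x. x \<prec> z \<oplus> \<one> \<and> (\<exists>y. y \<prec> z \<oplus> \<one> \<and> z = pair x y \<and> x \<prec> y)) = (proj1 z \<prec> proj2 z)" for z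
      by (cases "\<exists>x y. z = pair x y") (auto simp: lt_suc pair_ge1 pair_ge2 proj1_junk proj2_junk)
  qed
  have "Def (\<lambda>z. (\<exists>x. x \<prec> z \<oplus> \<one> \<and> (\<exists>y. y \<prec> z \<oplus> \<one> \<and> z = pair x y \<and> x = y)))"
    by (rule Def_delta0[where \<phi> = "bex 1 (Plus (Var 0) One) (bex 2 (Plus (Var 0) One) (And (Eq (Var 0) (pair_tm (Var 1) (Var 2))) (Eq (Var 1) (Var 2))))",
       OF _ two_sets[OF Def_const Def_const]]) (simp_all flip: pair_def)
  from Def_or[OF this Def_not[OF Def_pair]] show "Def (\<lambda>z. proj1 z = proj2 z)"
  proof (rule Def_cong)
    show "(\<exists>x. x \<prec> z \<oplus> \<one> \<and> (\<exists>y. y \<prec> z \<oplus> \<one> \<and> z = pair x y \<and> x = y)) \<or> \<not> (\<exists>x y. z = pair x y) \<longleftrightarrow> (proj1 z = proj2 z)" for z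
      by (cases "\<exists>x y. z = pair x y") (auto simp: lt_suc pair_ge1 pair_ge2 proj1_junk proj2_junk)
  qed
qed

lemmas Def_lt [Def_intros] = Def_rel[of "(\<prec>)", OF Def_lt'] and Def_eq [Def_intros] = Def_rel[of "(=)", OF Def_eq']

lemma Def_le [Def_intros]: "Fun f \<Longrightarrow> Fun g \<Longrightarrow> Def (\<lambda>x. f x \<preceq> g x)"
  unfolding le_def by (intro Def_intros)

text \<open>On a non-pair both projections are \<open>\<zero>\<close>, so the operation returns
  \<open>h \<zero> \<zero>\<close>; demanding that this be \<open>\<zero>\<close> lets the graph on
  such arguments be described by \<open>proj2 z = \<zero>\<close>.\<close>

lemma Fun_arith:
  assumes "Def (\<lambda>z. \<exists>x. x \<prec> z \<oplus> \<one> \<and> (\<exists>y. y \<prec> z \<oplus> \<one> \<and> (\<exists>u. u \<prec> z \<oplus> \<one> \<and> z = pair (pair x y) u \<and> u = h x y)))"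
    and [simp]: "h \<zero> \<zero> = \<zero>"
  shows "Fun (\<lambda>z. h (proj1 z) (proj2 z))"
proof (rule Fun_graph)
  show "Def (\<lambda>z. (\<exists>x. x \<prec> z \<oplus> \<one> \<and> (\<exists>y. y \<prec> z \<oplus> \<one> \<and> (\<exists>u. u \<prec> z \<oplus> \<one> \<and> z = pair (pair x y) u \<and> u = h x y)))
      \<or> (\<not> (\<exists>x y. proj1 z = pair x y) \<and> proj2 z = \<zero>))"
    using Def_subst[OF Def_pair Fun_proj1'] by (intro Def_or assms Def_and Def_not Def_eq Fun_proj2' Fun_const)
  have *: "u \<preceq> pair (pair u v) x" "v \<preceq> pair (pair u v) x" for u v x
      using pair_ge1 pair_ge2 ord.order_trans by metis+
  fix z u
  show "(\<exists>x. x \<prec> pair z u \<oplus> \<one> \<and> (\<exists>y. y \<prec> pair z u \<oplus> \<one> \<and> (\<exists>u'. u' \<prec> pair z u \<oplus> \<one> \<and> pair z u = pair (pair x y) u' \<and> u' = h x y)))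
      \<or> (\<not> (\<exists>x y. proj1 (pair z u) = pair x y) \<and> proj2 (pair z u) = \<zero>) \<longleftrightarrow> u = h (proj1 z) (proj2 z)"
   by (cases "\<exists>u v. z = pair u v") (auto simp: lt_suc pair_ge1 pair_ge2 proj1_junk proj2_junk *)
qed

lemma Fun_add' : "Fun (\<lambda>z. proj1 z \<oplus> proj2 z)" and Fun_mul': "Fun (\<lambda>z. proj1 z \<otimes> proj2 z)"
proof -
  have "Def (\<lambda>z. \<exists>x. x \<prec> z \<oplus> \<one> \<and> (\<exists>y. y \<prec> z \<oplus> \<one> \<and> (\<exists>u. u \<prec> z \<oplus> \<one> \<and> z = pair (pair x y) u \<and> u = x \<oplus> y)))"
    by (rule Def_delta0[where \<phi> = "bex 1 (Plus (Var 0) One) (bex 2 (Plus (Var 0) One) (bex 3 (Plus (Var 0) One)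
       (And (Eq (Var 0) (pair_tm (pair_tm (Var 1) (Var 2)) (Var 3))) (Eq (Var 3) (Plus (Var 1) (Var 2))))))",
       OF _ two_sets[OF Def_const Def_const]]) (simp_all flip: pair_def)
  from Fun_arith[OF this] show "Fun (\<lambda>z. proj1 z \<oplus> proj2 z)" by simp
  have "Def (\<lambda>z. \<exists>x. x \<prec> z \<oplus> \<one> \<and> (\<exists>y. y \<prec> z \<oplus> \<one> \<and> (\<exists>u. u \<prec> z \<oplus> \<one> \<and> z = pair (pair x y) u \<and> u = x \<otimes> y)))"
    by (rule Def_delta0[where \<phi> = "bex 1 (Plus (Var 0) One) (bex 2 (Plus (Var 0) One) (bex 3 (Plus (Var 0) One)
       (And (Eq (Var 0) (pair_tm (pair_tm (Var 1) (Var 2)) (Var 3))) (Eq (Var 3) (Times (Var 1) (Var 2))))))",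
       OF _ two_sets[OF Def_const Def_const]]) (simp_all flip: pair_def)
  from Fun_arith[OF this] show "Fun (\<lambda>z. proj1 z \<otimes> proj2 z)" by simp
qed

lemmas Fun_add = Fun_op[of "(\<oplus>)", OF Fun_add'] and Fun_mul = Fun_op[of "(\<otimes>)", OF Fun_mul']

declare Fun_const [Def_intros] Fun_id [Def_intros] Fun_proj1 [Def_intros] Fun_proj2 [Def_intros] Fun_pair [Def_intros] 
  Fun_add [Def_intros] Fun_mul [Def_intros]

text \<open>The bound \<open>f x\<close> need not be a term; it is read off the graph of
  \<open>f\<close>, again with either quantifier.\<close>

lemma Def_bex [Def_intros]:
  assumes "Def (\<lambda>z. P (proj1 z) (proj2 z))" "Fun f"
  shows "Def (\<lambda>x. \<exists>y. y \<prec> f x \<and> P x y)"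
proof -
  have p: "sigma01 (And (Mem (pair_tm (Var 0) (Var 1)) 0) (bex 2 (Var 1) (Mem (pair_tm (Var 0) (Var 2)) 1)))"
     "pi01 (Imp (Mem (pair_tm (Var 0) (Var 1)) 0) (bex 2 (Var 1) (Mem (pair_tm (Var 0) (Var 2)) 1)))"
    by (simp_all add: sigma01.intros pi01.intros)
  show ?thesis 
    by (rule Def_delta1[OF sigma01.intros(2)[OF p(1), of 1] pi01.intros(2)[OF p(2), of 1] two_sets[OF assms(2)[unfolded Fun_def] assms(1)]])
      (auto simp: two_sets_mem simp flip: pair_def)
qed

lemma Def_ball [Def_intros]:
  assumes "Def (\<lambda>z. P (proj1 z) (proj2 z))" "Fun f"
  shows "Def (\<lambda>x. \<forall>y. y \<prec> f x \<longrightarrow> P x y)"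
  using Def_not[OF Def_bex[OF Def_not[OF assms(1)] assms(2)]] by simp

lemma Def_bexle [Def_intros]:
  assumes "Def (\<lambda>z. P (proj1 z) (proj2 z))" "Fun f"
  shows "Def (\<lambda>x. \<exists>y. y \<preceq> f x \<and> P x y)"
  using Def_bex[of P "\<lambda>x. f x \<oplus> \<one>", OF assms(1) Fun_add[OF assms(2) Fun_const]] by (simp add: lt_suc)

lemma Def_ballle [Def_intros]:
  assumes "Def (\<lambda>z. P (proj1 z) (proj2 z))" "Fun f"
  shows "Def (\<lambda>x. \<forall>y. y \<preceq> f x \<longrightarrow> P x y)"
  using Def_not[OF Def_bexle[OF Def_not[OF assms(1)] assms(2)]] by simp

lemma Def_ex_delta1:
  assumes "Def (\<lambda>z. P (proj1 z) (proj2 z))" "Def (\<lambda>z. Q (proj1 z) (proj2 z))" "\<And>x. (\<exists>y. P x y) \<longleftrightarrow> (\<forall>y. Q x y)"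
  shows "Def (\<lambda>x. \<exists>y. P x y)"
proof -
  have p: "sigma01 (Mem (pair_tm (Var 0) (Var 1)) 0)" "pi01 (Mem (pair_tm (Var 0) (Var 1)) 1)"
    by (simp_all add: sigma01.intros pi01.intros)
  show ?thesis 
    by (rule Def_delta1[OF sigma01.intros(2)[OF p(1), of 1] pi01.intros(2)[OF p(2), of 1] two_sets[OF assms(1,2)]])
      (simp_all add: two_sets_mem assms(3) flip: pair_def)
qed

lemma Def_induct:
  assumes "Def P" "P \<zero>" "\<And>a. P a \<Longrightarrow> P (a \<oplus> \<one>)"
  shows "P a"
proof -
  have "induction_holds M (\<lambda>a. sat M (e(0 := a)) (two_sets P P) (Mem (Var 0) 0))" for e
    by (rule ind[unfolded delta01_induction_def, rule_format, OF _ _ two_sets[OF assms(1,1)], of _ "Mem (Var 0) 0"])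
      (simp_all add: sigma01.intros pi01.intros)
  then show ?thesis using assms(2,3) by (auto simp: induction_holds_def two_sets_mem)
qed

lemma Def_less_induct:
  assumes "Def P" "\<And>a. (\<And>b. b \<prec> a \<Longrightarrow> P b) \<Longrightarrow> P a"
  shows "P a"
proof -
  have "Def (\<lambda>x. \<forall>y. y \<prec> x \<longrightarrow> P y)" using assms(1) by (intro Def_ball Fun_id Def_subst[OF _ Fun_proj2']) 
  then have "\<forall>y. y \<prec> a \<longrightarrow> P y"
    by (rule Def_induct) (use assms(2) not_lt_zero lt_suc le_def in metis)+
  then show ?thesis using assms(2) by blast
qed

lemma Def_least:
  assumes "Def P" "P a" shows "\<exists>b. P b \<and> (\<forall>c. c \<prec> b \<longrightarrow> \<not> P c)"
  using Def_less_induct[OF Def_not[OF assms(1)], of a] assms(2) by blast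

text \<open>A total function with a \<open>\<Sigma>\<^sup>0\<^sub>1\<close> graph has a
  \<open>\<Delta>\<^sup>0\<^sub>1\<close> graph: \<open>y\<close> is the value iff every witnessed
  value equals \<open>y\<close>. This serves functions such as \<open>two_pow\<close>, whose graph
  is given by an unbounded search for a code.\<close>

lemma Fun_sigma:
  assumes "Def (\<lambda>w. R (proj1 w) (proj1 (proj2 w)) (proj2 (proj2 w)))" "\<And>x y. (\<exists>u. R x y u) \<longleftrightarrow> y = f x"
  shows "Fun f"
proof (rule Fun_graph)
  have r: "Fun a \<Longrightarrow> Fun b \<Longrightarrow> Fun c \<Longrightarrow> Def (\<lambda>v. R (a v) (b v) (c v))" for a b c
    using Def_subst[OF assms(1), of "\<lambda>v. pair (a v) (pair (b v) (c v))"] by (simp add: Fun_pair)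
  show "Def (\<lambda>v. \<exists>u. R (proj1 v) (proj2 v) u)"
  proof (rule Def_ex_delta1)
    show "Def (\<lambda>z. R (proj1 (proj1 z)) (proj2 (proj1 z)) (proj2 z))" by (intro r Def_intros)
    show "Def (\<lambda>z. R (proj1 (proj1 z)) (proj1 (proj2 z)) (proj2 (proj2 z)) \<longrightarrow> proj1 (proj2 z) = proj2 (proj1 z))" by (intro r Def_intros)
    show "(\<exists>u. R (proj1 v) (proj2 v) u) \<longleftrightarrow> (\<forall>u. R (proj1 v) (proj1 u) (proj2 u) \<longrightarrow> proj1 u = proj2 v)" for v
      using assms(2) by (metis proj1_pair proj2_pair)
  qed
qed (simp add: assms(2))

end

section \<open>Binary strings as codes of finite sets\<close>

context pa_minus
begin

declare ord.one_add_one [simp del]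

section \<open>Powers of two through the beta function\<close>

lemma remainder_unique:
  assumes "q \<otimes> m \<oplus> r = q' \<otimes> m \<oplus> r'" "r \<prec> m" "r' \<prec> m"
  shows "q = q' \<and> r = r'"
proof -
  have *: False if "q \<otimes> m \<oplus> r = q' \<otimes> m \<oplus> r'" "r \<prec> m" "q \<prec> q'" for q q' r r'
  proof -
    have "q \<otimes> m \<oplus> r \<prec> q \<otimes> m \<oplus> m" using that(2) by simp
    also have "q \<otimes> m \<oplus> m = (q \<oplus> \<one>) \<otimes> m" by (simp add: algebra_simps)
    also have "\<dots> \<preceq> q' \<otimes> m" using that(3) by (simp add: ord.mult_right_mono suc_le)
    also have "\<dots> \<preceq> q' \<otimes> m \<oplus> r'" by (rule le_add1)
    finally show False using that(1) by simp
  qed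
  have "q = q'" using *[of q r q' r'] *[of q' r' q r] assms lt_linear[of q q'] by metis
  then show ?thesis using assms(1) by simp
qed

lemma beta_unique: "beta M a b i r \<Longrightarrow> beta M a b i r' \<Longrightarrow> r = r'"
  unfolding beta_def Let_def using remainder_unique by metis

lemma beta_le: "beta M a b i r \<Longrightarrow> r \<preceq> a"
  unfolding beta_def Let_def by (auto simp: le_add2)

text \<open>The modulus is positive, so the quotient is at most \<open>a\<close> and its quantifier
  is bounded.\<close>

lemma beta_bounded: "beta M a b i r \<longleftrightarrow>
   r \<prec> \<one> \<oplus> (i \<oplus> \<one>) \<otimes> b \<and> (\<exists>q. q \<preceq> a \<and> a = q \<otimes> (\<one> \<oplus> (i \<oplus> \<one>) \<otimes> b) \<oplus> r)"
proof -
  have "q \<preceq> q \<otimes> (\<one> \<oplus> (i \<oplus> \<one>) \<otimes> b) \<oplus> r" for q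
  proof -
    have "\<zero> \<prec> \<one> \<oplus> (i \<oplus> \<one>) \<otimes> b"
      using le_add1[of \<one> "(i \<oplus> \<one>) \<otimes> b"] zero_lt_one by order
    then have "q \<preceq> q \<otimes> (\<one> \<oplus> (i \<oplus> \<one>) \<otimes> b)" by (rule le_mul)
    then show ?thesis using le_add1 by (rule ord.order_trans)
  qed
  then show ?thesis unfolding beta_def Let_def by metis
qed

definition two_pow :: "'m \<Rightarrow> 'm" where
  "two_pow n = (THE z. is_pow2 M n z)"

text \<open>The body of \<open>is_pow2\<close> with the code exposed and the entry \<open>r\<close>
  bounded by \<open>a\<close>, so that only the search for \<open>a\<close> and \<open>b\<close>
  remains unbounded.\<close>

definition doubling_code :: "'m \<Rightarrow> 'm \<Rightarrow> 'm \<Rightarrow> 'm \<Rightarrow> bool" where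
  "doubling_code a b n z \<longleftrightarrow> beta M a b \<zero> \<one> \<and>
      (\<forall>i. i \<prec> n \<longrightarrow> (\<exists>r. r \<preceq> a \<and> beta M a b i r \<and> beta M a b (i \<oplus> \<one>) (r \<oplus> r))) \<and>
      beta M a b n z"

lemma is_pow2_seq2: "is_pow2 M n z \<longleftrightarrow> (\<exists>a b. doubling_code a b n z)"
proof -
  have "r \<otimes> (\<one> \<oplus> \<one>) = r \<oplus> r" for r by (simp add: algebra_simps)
  moreover have "(\<exists>r. beta M a b i r \<and> Q r) \<longleftrightarrow> (\<exists>r. r \<preceq> a \<and> beta M a b i r \<and> Q r)" for a b i Q
    using beta_le by blast
  ultimately show ?thesis unfolding is_pow2_def is_pow_def doubling_code_def by simp
qed

end

context rca
begin

lemma Def_beta [Def_intros]: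
  assumes "Fun a" "Fun b" "Fun i" "Fun r" shows "Def (\<lambda>x. beta M (a x) (b x) (i x) (r x))"
  unfolding beta_bounded by (intro Def_intros assms[THEN Fun_comp])

lemma Def_doubling_code [Def_intros]:
  assumes "Fun a" "Fun b" "Fun i" "Fun r" shows "Def (\<lambda>x. doubling_code (a x) (b x) (i x) (r x))"
  unfolding doubling_code_def by (intro Def_intros assms[THEN Fun_comp])

lemma is_pow2_unique:
  assumes "is_pow2 M n z" "is_pow2 M n z'" shows "z = z'"
proof -
  obtain a b a' b' where s: "doubling_code a b n z" "doubling_code a' b' n z'"
    using assms unfolding is_pow2_seq2 by blast
  \<comment> \<open>Every entry is at most the first component of its code, so these bounds lose
    nothing and make the predicate definable.\<close>
  let ?P = "\<lambda>i. i \<preceq> n \<longrightarrow> (\<forall>r. r \<preceq> a \<longrightarrow> (\<forall>r'. r' \<preceq> a' \<longrightarrow> beta M a b i r \<longrightarrow> beta M a' b' i r' \<longrightarrow> r = r'))"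
  have "?P n"
  proof (rule Def_induct[where P = ?P])
    show "Def ?P" by (intro Def_intros)
    show "?P \<zero>" using s beta_unique unfolding doubling_code_def by metis
    fix i assume IH: "?P i"
    show "?P (i \<oplus> \<one>)"
    proof (intro impI allI)
      fix r r' assume a: "i \<oplus> \<one> \<preceq> n" "r \<preceq> a" "r' \<preceq> a'" "beta M a b (i \<oplus> \<one>) r" "beta M a' b' (i \<oplus> \<one>) r'"
      have i: "i \<prec> n" using a(1) suc_le by simp
      obtain q where q: "q \<preceq> a" "beta M a b i q" "beta M a b (i \<oplus> \<one>) (q \<oplus> q)"
        using i s(1) unfolding doubling_code_def by blast
      obtain q' where q': "q' \<preceq> a'" "beta M a' b' i q'" "beta M a' b' (i \<oplus> \<one>) (q' \<oplus> q')"
        using i s(2) unfolding doubling_code_def by blast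
      have "q = q'" using IH i q q' unfolding le_def[of M i n] by blast
      then show "r = r'" using beta_unique a q q' by metis
    qed
  qed
  then show ?thesis using s beta_le unfolding doubling_code_def by (metis ord.order_refl)
qed

lemma is_pow2_iff: "is_pow2 M n z \<longleftrightarrow> z = two_pow n"
proof -
  obtain w where w: "is_pow2 M n w" using exp unfolding exp_total_def is_pow2_def by blast
  then have "two_pow n = w" unfolding two_pow_def using is_pow2_unique by blast
  then show ?thesis using w is_pow2_unique by blast
qed

lemma Fun_two_pow' : "Fun two_pow"
proof (rule Fun_sigma)
  show "Def (\<lambda>w. doubling_code (proj1 (proj2 (proj2 w))) (proj2 (proj2 (proj2 w))) (proj1 w) (proj1 (proj2 w)))"
    by (intro Def_intros)
  show "(\<exists>u. doubling_code (proj1 u) (proj2 u) x y) \<longleftrightarrow> y = two_pow x" for x y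
    unfolding is_pow2_iff[symmetric] is_pow2_seq2 by (metis proj1_pair proj2_pair)
qed

lemmas Fun_two_pow [Def_intros] = Fun_comp[OF Fun_two_pow']

lemma two_pow_0 [simp]: "two_pow \<zero> = \<one>"
proof -
  have "is_pow2 M \<zero> (two_pow \<zero>)" by (simp add: is_pow2_iff)
  then show ?thesis unfolding is_pow2_seq2 doubling_code_def using beta_unique by metis
qed

lemma two_pow_suc [simp]: "two_pow (n \<oplus> \<one>) = two_pow n \<oplus> two_pow n"
proof -
  have "is_pow2 M (n \<oplus> \<one>) (two_pow (n \<oplus> \<one>))" by (simp add: is_pow2_iff)
  then obtain a b where s: "doubling_code a b (n \<oplus> \<one>) (two_pow (n \<oplus> \<one>))" unfolding is_pow2_seq2 by blast
  then obtain q where q: "beta M a b n q" "beta M a b (n \<oplus> \<one>) (q \<oplus> q)"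
    using ord.less_add_one[of n] unfolding doubling_code_def by blast
  then have "doubling_code a b n q" using s unfolding doubling_code_def 
    by (meson ord.less_add_one ord.less_trans)
  then have "q = two_pow n" using is_pow2_iff is_pow2_seq2 by blast
  then show ?thesis using q s beta_unique unfolding doubling_code_def by metis
qed

lemma two_pow_one [simp]: "two_pow \<one> = \<one> \<oplus> \<one>"
  using two_pow_suc[of \<zero>] by simp

lemma two_pow_pos [simp]: "\<zero> \<prec> two_pow n"
proof (rule Def_induct[of _ n])
  show "Def (\<lambda>n. \<zero> \<prec> two_pow n)" by (intro Def_intros)
qed (simp_all add: ord.add_pos_pos)

lemma less_two_pow: "n \<prec> two_pow n"
proof (rule Def_induct[of _ n])
  show "Def (\<lambda>n. n \<prec> two_pow n)" by (intro Def_intros)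
  show "n \<oplus> \<one> \<prec> two_pow (n \<oplus> \<one>)" if "n \<prec> two_pow n" for n
    using that ord.add_less_le_mono[of n "two_pow n" \<one> "two_pow n"] discrete[of "two_pow n"] by simp
qed simp

lemma two_pow_add: "two_pow (m \<oplus> n) = two_pow m \<otimes> two_pow n"
proof (rule Def_induct[of _ n])
  show "Def (\<lambda>n. two_pow (m \<oplus> n) = two_pow m \<otimes> two_pow n)" by (intro Def_intros)
qed (simp_all add: ord.distrib_left flip: add_assoc)

lemma two_pow_mono: "m \<preceq> n \<Longrightarrow> two_pow m \<preceq> two_pow n"
  by (auto simp: le_iff_add[of m n] two_pow_add intro!: le_mul)

lemma two_pow_strict: "m \<prec> n \<Longrightarrow> two_pow m \<oplus> two_pow m \<preceq> two_pow n"
  using two_pow_mono[of "m \<oplus> \<one>" n] by (simp add: suc_le)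

section \<open>Lengths, initial segments and digits of strings\<close>

lemma division: 
  assumes "\<zero> \<prec> m" shows "\<exists>q. q \<otimes> m \<preceq> s \<and> s \<prec> (q \<oplus> \<one>) \<otimes> m"
proof -
  let ?P = "\<lambda>q. s \<prec> (q \<oplus> \<one>) \<otimes> m"
  have "?P s" using le_mul[OF assms, of "s \<oplus> \<one>"] ord.less_add_one[of s] by order
  moreover have "Def ?P" by (intro Def_intros)
  ultimately obtain q where q: "?P q" "\<And>c. c \<prec> q \<Longrightarrow> \<not> ?P c" using Def_least by blast
  have "q \<otimes> m \<preceq> s"
  proof (cases "q = \<zero>")
    case False
    then obtain c where "q = c \<oplus> \<one>" using nonzero_suc by blast
    then show ?thesis using q(2)[of c] by (simp add: lt_suc ord.not_less)
  qed simp
  then show ?thesis using q by blast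
qed

abbreviation "len \<equiv> string_length M"
abbreviation "pre \<equiv> initial_segment M"
abbreviation "sbit \<equiv> string_bit M"

lemma len_iff: "len s n \<longleftrightarrow> two_pow n \<preceq> s \<and> s \<prec> two_pow n \<oplus> two_pow n"
  by (simp add: string_length_def is_pow2_iff)

lemma pre_iff: "pre t s \<longleftrightarrow> \<zero> \<prec> t \<and> (\<exists>k. t \<otimes> two_pow k \<preceq> s \<and> s \<prec> (t \<oplus> \<one>) \<otimes> two_pow k)"
  by (simp add: initial_segment_def is_pow2_iff)

lemma len_pos: "len s n \<Longrightarrow> \<zero> \<prec> s"
  using two_pow_pos[of n] unfolding len_iff by (safe; order)

lemma len_less: "len s n \<Longrightarrow> n \<prec> s"
  using less_two_pow[of n] unfolding len_iff by (safe; order)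

lemma len_bound: "len s n \<Longrightarrow> s \<prec> two_pow (n \<oplus> \<one>)"
  by (simp add: len_iff)

lemma len_unique: "len s n \<Longrightarrow> len s m \<Longrightarrow> n = m"
proof -
  have *: False if "n \<prec> m" "len s n" "len s m" for n m
    using two_pow_strict[OF that(1)] that(2,3) unfolding len_iff by (safe; order)
  show "len s n \<Longrightarrow> len s m \<Longrightarrow> n = m" using * lt_linear[of n m] by blast
qed

lemma len_ex: assumes "\<zero> \<prec> s" shows "\<exists>n. len s n"
proof -
  let ?P = "\<lambda>n. s \<prec> two_pow n \<oplus> two_pow n"
  have "?P s" using less_two_pow[of s] le_add1[of "two_pow s" "two_pow s"] by order
  moreover have "Def ?P" by (intro Def_intros)
  ultimately obtain n where n: "?P n" "\<And>c. c \<prec> n \<Longrightarrow> \<not> ?P c" using Def_least by blast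
  have "two_pow n \<preceq> s"
  proof (cases "n = \<zero>")
    case True
    then show ?thesis using discrete[OF assms] by simp
  next
    case False
    then obtain c where "n = c \<oplus> \<one>" using nonzero_suc by blast
    then show ?thesis using n(2)[of c] by (simp add: lt_suc ord.not_less)
  qed
  then show ?thesis using n by (auto simp: len_iff)
qed

lemma pre_pos: "pre t s \<Longrightarrow> \<zero> \<prec> t" "pre t s \<Longrightarrow> \<zero> \<prec> s"
proof -
  show "pre t s \<Longrightarrow> \<zero> \<prec> t" by (simp add: pre_iff)
  show "\<zero> \<prec> s" if p: "pre t s"
  proof -
    obtain k where k: "t \<otimes> two_pow k \<preceq> s" and t: "\<zero> \<prec> t" using p unfolding pre_iff by blast
    have "t \<preceq> t \<otimes> two_pow k" by (simp add: le_mul)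
    then show ?thesis using k t by order
  qed
qed

lemma pre_le: "pre t s \<Longrightarrow> t \<preceq> s"
  unfolding pre_iff using le_mul[OF two_pow_pos] by (meson ord.order_trans)

lemma pre_refl: "\<zero> \<prec> s \<Longrightarrow> pre s s"
  unfolding pre_iff by (auto intro!: exI[of _ \<zero>] simp: mul_one)

lemma pre_trans: assumes "pre r t" "pre t s" shows "pre r s"
proof -
  obtain k where k: "r \<otimes> two_pow k \<preceq> t" "t \<prec> (r \<oplus> \<one>) \<otimes> two_pow k" "\<zero> \<prec> r" using assms(1) by (auto simp: pre_iff)
  obtain l where l: "t \<otimes> two_pow l \<preceq> s" "s \<prec> (t \<oplus> \<one>) \<otimes> two_pow l" using assms(2) by (auto simp: pre_iff)
  have "r \<otimes> two_pow (k \<oplus> l) = r \<otimes> two_pow k \<otimes> two_pow l" by (simp add: two_pow_add mul_assoc)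
  also have "\<dots> \<preceq> t \<otimes> two_pow l" using k by (simp add: ord.mult_right_mono)
  finally have 1: "r \<otimes> two_pow (k \<oplus> l) \<preceq> s" using l by order
  have "(t \<oplus> \<one>) \<otimes> two_pow l \<preceq> (r \<oplus> \<one>) \<otimes> two_pow k \<otimes> two_pow l"
    using k by (simp add: ord.mult_right_mono suc_le)
  also have "\<dots> = (r \<oplus> \<one>) \<otimes> two_pow (k \<oplus> l)" by (simp add: two_pow_add mul_assoc)
  finally have 2: "s \<prec> (r \<oplus> \<one>) \<otimes> two_pow (k \<oplus> l)" using l by order
  show ?thesis using 1 2 k(3) unfolding pre_iff by blast
qed

lemma pre_len:
  assumes "t \<otimes> two_pow k \<preceq> s" "s \<prec> (t \<oplus> \<one>) \<otimes> two_pow k" "len t m"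
  shows "len s (m \<oplus> k)"
proof -
  have "two_pow (m \<oplus> k) = two_pow m \<otimes> two_pow k" by (rule two_pow_add)
  also have "\<dots> \<preceq> t \<otimes> two_pow k" using assms(3) by (simp add: len_iff ord.mult_right_mono)
  finally have 1: "two_pow (m \<oplus> k) \<preceq> s" using assms(1) by order
  have "(t \<oplus> \<one>) \<otimes> two_pow k \<preceq> (two_pow m \<oplus> two_pow m) \<otimes> two_pow k"
    using assms(3) by (simp add: len_iff ord.mult_right_mono suc_le)
  also have "\<dots> = two_pow (m \<oplus> k) \<oplus> two_pow (m \<oplus> k)" by (simp add: two_pow_add ord.distrib_right)
  finally show ?thesis using 1 assms(2) unfolding len_iff by (safe; order)
qed

lemma pre_unique:
  assumes "pre t s" "pre t' s" "len t m" "len t' m" shows "t = t'"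
proof -
  obtain k where k: "t \<otimes> two_pow k \<preceq> s" "s \<prec> (t \<oplus> \<one>) \<otimes> two_pow k" using assms(1) by (auto simp: pre_iff)
  obtain l where l: "t' \<otimes> two_pow l \<preceq> s" "s \<prec> (t' \<oplus> \<one>) \<otimes> two_pow l" using assms(2) by (auto simp: pre_iff)
  have "m \<oplus> k = m \<oplus> l" using pre_len[OF k assms(3)] pre_len[OF l assms(4)] len_unique by blast
  then have kl: "k = l" by simp
  have *: False if "t \<prec> t'" "t' \<otimes> two_pow k \<preceq> s" "s \<prec> (t \<oplus> \<one>) \<otimes> two_pow k" for t t'
  proof -
    have "(t \<oplus> \<one>) \<otimes> two_pow k \<preceq> t' \<otimes> two_pow k" using that by (simp add: suc_le ord.mult_right_mono)
    then show False using that by order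
  qed
  show ?thesis using *[of t t'] *[of t' t] k l kl lt_linear[of t t'] by blast
qed

lemma pre_ex: 
  assumes "len s n" "m \<preceq> n" shows "\<exists>t. pre t s \<and> len t m"
proof -
  obtain k where n: "n = m \<oplus> k" using assms(2) le_iff_add by blast
  obtain t where t: "t \<otimes> two_pow k \<preceq> s" "s \<prec> (t \<oplus> \<one>) \<otimes> two_pow k" using division[OF two_pow_pos] by blast
  have "two_pow m \<otimes> two_pow k \<prec> (t \<oplus> \<one>) \<otimes> two_pow k"
    using assms(1) t(2) unfolding n len_iff two_pow_add by (safe; order)
  then have "two_pow m \<prec> t \<oplus> \<one>" by (rule ord.mult_right_less_imp_less) simp
  then have 1: "two_pow m \<preceq> t" by (simp add: lt_suc)
  have "t \<otimes> two_pow k \<prec> (two_pow m \<oplus> two_pow m) \<otimes> two_pow k"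
    using assms(1) t(1) unfolding n len_iff two_pow_add ord.distrib_right by (safe; order)
  then have "t \<prec> two_pow m \<oplus> two_pow m" by (rule ord.mult_right_less_imp_less) simp
  then have "len t m" using 1 by (simp add: len_iff)
  then show ?thesis using t len_pos unfolding pre_iff by blast
qed

lemma pre_len_le: assumes "pre t s" "len t m" "len s n" shows "m \<preceq> n"
proof -
  obtain k where "t \<otimes> two_pow k \<preceq> s" "s \<prec> (t \<oplus> \<one>) \<otimes> two_pow k" using assms(1) by (auto simp: pre_iff)
  from pre_len[OF this assms(2)] show ?thesis using len_unique assms(3) le_add1 by blast
qed

lemma bit_last: 
  assumes "pre t s" "len t (i \<oplus> \<one>)" shows "sbit s i \<longleftrightarrow> last_bit_one M t"
  unfolding string_bit_def using assms pre_unique by blast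

lemma bit_less: "sbit s i \<Longrightarrow> len s n \<Longrightarrow> i \<prec> n"
  unfolding string_bit_def using pre_len_le suc_le by blast

lemma bit_less_self: "sbit s i \<Longrightarrow> i \<prec> s"
  by (meson bit_less len_ex len_less ord.less_trans pre_pos(2) string_bit_def)

lemma bit_pre: 
  assumes "pre t s" "len t n" "i \<prec> n" shows "sbit t i \<longleftrightarrow> sbit s i"
proof -
  obtain r where "pre r t" "len r (i \<oplus> \<one>)" using pre_ex[OF assms(2)] assms(3) suc_le by blast
  then show ?thesis using bit_last pre_trans assms(1) by blast
qed

lemma pre_comparable:
  assumes "pre r s" "pre t s" "len r m" "len t n" "m \<preceq> n" shows "pre r t"
proof -
  obtain u where "pre u t" "len u m" using pre_ex[OF assms(4,5)] by blast
  then show ?thesis using pre_unique[OF assms(1) _ assms(3), of u] pre_trans assms(2) by blast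
qed

lemma Def_len [Def_intros]: "Fun f \<Longrightarrow> Fun g \<Longrightarrow> Def (\<lambda>x. len (f x) (g x))"
  unfolding len_iff by (intro Def_intros)

lemma Def_pre [Def_intros]: "Fun f \<Longrightarrow> Fun g \<Longrightarrow> Def (\<lambda>x. pre (f x) (g x))"
proof -
  \<comment> \<open>The exponent satisfies \<open>k \<prec> two_pow k \<preceq> t \<otimes> two_pow
    k \<preceq> s\<close>, so it can be bounded.\<close>
  have *: "pre t s \<longleftrightarrow> \<zero> \<prec> t \<and> (\<exists>k. k \<preceq> s \<and> t \<otimes> two_pow k \<preceq> s \<and> s \<prec> (t \<oplus> \<one>) \<otimes> two_pow k)" for t s
  proof -
    have "k \<preceq> s" if "\<zero> \<prec> t" "t \<otimes> two_pow k \<preceq> s" for k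
      using that(2) le_mul[OF that(1), of "two_pow k"] less_two_pow[of k] unfolding mul_comm[of t] by order
    then show ?thesis unfolding pre_iff by blast
  qed
  show "Fun f \<Longrightarrow> Fun g \<Longrightarrow> Def (\<lambda>x. pre (f x) (g x))"
    unfolding * subgoal premises prems by (intro Def_intros prems[THEN Fun_comp]) done
qed

lemma Def_bit [Def_intros]: "Fun f \<Longrightarrow> Fun g \<Longrightarrow> Def (\<lambda>x. sbit (f x) (g x))"
proof -
  have l: "last_bit_one M t \<longleftrightarrow> (\<exists>u. u \<prec> t \<and> t = u \<oplus> u \<oplus> \<one>)" for t
    unfolding last_bit_one_def using lt_suc le_add1 by metis
  have "sbit s i \<longleftrightarrow> (\<exists>t. t \<preceq> s \<and> pre t s \<and> len t (i \<oplus> \<one>) \<and> last_bit_one M t)" for s i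
    unfolding string_bit_def using pre_le by blast
  then have b: "sbit s i \<longleftrightarrow> (\<exists>t. t \<preceq> s \<and> pre t s \<and> len t (i \<oplus> \<one>) \<and> (\<exists>u. u \<prec> t \<and> t = u \<oplus> u \<oplus> \<one>))" for s i
    unfolding l .
  show "Fun f \<Longrightarrow> Fun g \<Longrightarrow> Def (\<lambda>x. sbit (f x) (g x))"
    unfolding b subgoal premises prems by (intro Def_intros prems[THEN Fun_comp]) done
qed

lemma double_inj: "u \<oplus> u \<preceq> v \<oplus> v \<Longrightarrow> u \<preceq> v"
  by (meson ord.add_strict_mono ord.not_le)

lemma double_neq: "u \<oplus> u \<noteq> v \<oplus> v \<oplus> \<one>"
proof
  assume a: "u \<oplus> u = v \<oplus> v \<oplus> \<one>"
  then have "v \<preceq> u" using le_add1 double_inj by metis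
  moreover have "u \<noteq> v" using a lt_suc[of "u \<oplus> u" "u \<oplus> u"] by auto
  ultimately have "v \<prec> u" by order
  then have "v \<oplus> \<one> \<preceq> u" by (simp add: suc_le)
  then have "(v \<oplus> \<one>) \<oplus> (v \<oplus> \<one>) \<preceq> v \<oplus> v \<oplus> \<one>" using ord.add_mono a by metis
  then show False using suc_le[of "v \<oplus> v \<oplus> \<one>" "v \<oplus> v \<oplus> \<one>"] by (simp add: algebra_simps)
qed

lemma append_bit:
  assumes "len s n" "c = \<zero> \<or> c = \<one>"
  shows "len (s \<oplus> s \<oplus> c) (n \<oplus> \<one>)" "pre s (s \<oplus> s \<oplus> c)" "sbit (s \<oplus> s \<oplus> c) n \<longleftrightarrow> c = \<one>"
proof -
  have proj1: "two_pow \<one> = \<one> \<oplus> \<one>" using two_pow_suc[of \<zero>] by simp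
  have c: "c \<prec> \<one> \<oplus> \<one>" using assms(2) by (auto simp: lt_suc)
  have "(s \<oplus> \<one>) \<otimes> two_pow \<one> = s \<oplus> s \<oplus> (\<one> \<oplus> \<one>)" "s \<otimes> two_pow \<one> = s \<oplus> s"
    by (simp_all add: proj1 algebra_simps)
  then have b: "s \<otimes> two_pow \<one> \<preceq> s \<oplus> s \<oplus> c" "s \<oplus> s \<oplus> c \<prec> (s \<oplus> \<one>) \<otimes> two_pow \<one>"
    using c by (simp_all add: le_add1)
  show l: "len (s \<oplus> s \<oplus> c) (n \<oplus> \<one>)" using pre_len[OF b assms(1)] .
  show "pre s (s \<oplus> s \<oplus> c)" using b len_pos[OF assms(1)] unfolding pre_iff by blast
  have "sbit (s \<oplus> s \<oplus> c) n \<longleftrightarrow> last_bit_one M (s \<oplus> s \<oplus> c)"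
    using bit_last[OF pre_refl l] len_pos[OF l] by blast
  then show "sbit (s \<oplus> s \<oplus> c) n \<longleftrightarrow> c = \<one>"
    using assms(2) double_neq unfolding last_bit_one_def by (auto simp: add_zero)
qed

text \<open>Bounded comprehension in coded form, the main source of finite objects below. A string
  of length \<open>n\<close> is below \<open>two_pow (n \<oplus> \<one>)\<close>, which bounds the
  quantifier in the induction predicate.\<close>

lemma code_ex:
  assumes "Def P" shows "\<exists>s. len s n \<and> (\<forall>i. i \<prec> n \<longrightarrow> (sbit s i \<longleftrightarrow> P i))"
proof -
  let ?Q = "\<lambda>n. \<exists>s. s \<prec> two_pow (n \<oplus> \<one>) \<and> len s n \<and> (\<forall>i. i \<prec> n \<longrightarrow> (sbit s i \<longleftrightarrow> P i))"
  have "?Q n"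
  proof (rule Def_induct[where P = ?Q])
    show "Def ?Q" by (intro Def_intros Def_subst[OF assms])
    show "?Q \<zero>" by (rule exI[of _ \<one>]) (auto simp: len_iff not_lt_zero lt_suc)
    fix n assume "?Q n"
    then obtain s where s: "len s n" "\<And>i. i \<prec> n \<Longrightarrow> sbit s i \<longleftrightarrow> P i" by blast
    let ?t = "s \<oplus> s \<oplus> (if P n then \<one> else \<zero>)"
    have t: "len ?t (n \<oplus> \<one>)" "pre s ?t" "sbit ?t n \<longleftrightarrow> P n"
      using append_bit[OF s(1), of "if P n then \<one> else \<zero>"] by auto
    have "sbit ?t i \<longleftrightarrow> P i" if "i \<prec> n \<oplus> \<one>" for i
      using that t(3) bit_pre[OF t(2) s(1)] s(2) unfolding lt_suc le_def by blast
    then show "?Q (n \<oplus> \<one>)" using t(1) len_bound by blast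
  qed
  then show ?thesis by blast
qed

lemma pre_suc:
  assumes "pre r s" "len r m" "pre t s" "len t (m \<oplus> \<one>)"
  shows "t = (if sbit s m then r \<oplus> r \<oplus> \<one> else r \<oplus> r)"
proof -
  have "pre r t" using pre_comparable[OF assms(1,3,2,4)] le_add1 by blast
  then obtain k where k: "r \<otimes> two_pow k \<preceq> t" "t \<prec> (r \<oplus> \<one>) \<otimes> two_pow k" unfolding pre_iff by blast
  have "m \<oplus> k = m \<oplus> \<one>" using pre_len[OF k assms(2)] len_unique assms(4) by blast
  then have "k = \<one>" by simp
  moreover have "two_pow \<one> = \<one> \<oplus> \<one>" using two_pow_suc[of \<zero>] by simp
  ultimately have "r \<oplus> r \<preceq> t" "t \<prec> r \<oplus> r \<oplus> \<one> \<oplus> \<one>" using k by (simp_all add: algebra_simps)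
  then have t: "t = r \<oplus> r \<or> t = r \<oplus> r \<oplus> \<one>" unfolding lt_suc le_def by (metis ord.less_asym)
  moreover have "sbit s m \<longleftrightarrow> last_bit_one M t" using bit_last assms by blast
  moreover have "\<not> last_bit_one M (r \<oplus> r)" "last_bit_one M (r \<oplus> r \<oplus> \<one>)"
    using double_neq unfolding last_bit_one_def by auto
  ultimately show ?thesis by auto
qed

text \<open>The common initial segment grows by one bit at a time: \<open>pre_suc\<close> determines
  the next one from the next bit.\<close>

lemma bit_ext:
  assumes "len s n" "len t n" "\<And>i. i \<prec> n \<Longrightarrow> sbit s i \<longleftrightarrow> sbit t i" shows "s = t"
proof -
  let ?P = "\<lambda>m. m \<preceq> n \<longrightarrow> (\<exists>r. r \<preceq> s \<and> pre r s \<and> pre r t \<and> len r m)"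
  have "?P n"
  proof (rule Def_induct[where P = ?P])
    show "Def ?P" by (intro Def_intros)
    have 1: "r = \<one>" if "len r \<zero>" for r using that unfolding len_iff by (auto simp: lt_suc)
    show "?P \<zero>" using pre_ex[OF assms(1), of \<zero>] pre_ex[OF assms(2), of \<zero>] pre_le 1 by (metis zero_le)
    fix m assume IH: "?P m"
    show "?P (m \<oplus> \<one>)"
    proof
      assume m: "m \<oplus> \<one> \<preceq> n"
      then have m': "m \<prec> n" by (simp add: suc_le)
      then obtain r where r: "pre r s" "pre r t" "len r m" using IH unfolding le_def by blast
      obtain u v where u: "pre u s" "len u (m \<oplus> \<one>)" and v: "pre v t" "len v (m \<oplus> \<one>)"
        using pre_ex[OF assms(1) m] pre_ex[OF assms(2) m] by blast
      have "u = v" using pre_suc[OF r(1,3) u] pre_suc[OF r(2,3) v] assms(3)[OF m'] by simp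
      then show "\<exists>r. r \<preceq> s \<and> pre r s \<and> pre r t \<and> len r (m \<oplus> \<one>)" using u v pre_le by blast
    qed
  qed
  then show ?thesis using pre_unique pre_refl assms len_pos by (metis ord.order_refl)
qed

text \<open>The interval of all strings of length \<open>B\<close> extending \<open>t\<close> shrinks as \<open>t\<close> grows. If no \<open>s\<close>
  lay in all these intervals, lying below some interval would be a \<open>\<Delta>\<^sup>0\<^sub>1\<close> property of \<open>s\<close>
  that is inductive but fails for large \<open>s\<close>.\<close>

lemma chain_bound:
  assumes R: "Def (\<lambda>z. R (proj1 z) (proj2 z))"
    and len: "\<And>t x. R t x \<Longrightarrow> \<exists>n. len t n \<and> n \<preceq> B"
    and chain: "\<And>t t' x x'. R t x \<Longrightarrow> R t' x' \<Longrightarrow> pre t t' \<or> pre t' t"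
  shows "\<exists>s. s \<preceq> two_pow (B \<oplus> \<one>) \<and> (\<forall>t x. R t x \<longrightarrow> pre t s)"
proof (rule ccontr)
  assume no: "\<not> ?thesis"
  \<comment> \<open>\<open>l\<close> is the number of bits that \<open>t\<close> lacks to length
    \<open>B\<close>, so the extensions of \<open>t\<close> fill the interval from
    \<open>t \<otimes> two_pow l\<close> to below
    \<open>(t \<oplus> \<one>) \<otimes> two_pow l\<close>; \<open>low\<close> and
    \<open>high\<close> place \<open>s\<close> before or after it.\<close>
  define k where "k t l \<longleftrightarrow> (\<exists>n. n \<preceq> B \<and> len t n \<and> n \<oplus> l = B)" for t l
  define low where "low s u \<longleftrightarrow> R (proj1 u) (proj2 u) \<and> (\<exists>l. l \<preceq> B \<and> k (proj1 u) l \<and> s \<prec> proj1 u \<otimes> two_pow l)" for s u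
  define high where "high s u \<longleftrightarrow> R (proj1 u) (proj2 u) \<and> (\<exists>l. l \<preceq> B \<and> k (proj1 u) l \<and> (proj1 u \<oplus> \<one>) \<otimes> two_pow l \<preceq> s)" for s u
  have k_ex: "\<exists>l. l \<preceq> B \<and> k t l" if "R t x" for t x
    using len[OF that] unfolding k_def le_iff_add[of _ B] using add_comm by metis
  have nested: "(t' \<oplus> \<one>) \<otimes> two_pow l' \<preceq> (t \<oplus> \<one>) \<otimes> two_pow l \<and> t \<otimes> two_pow l \<preceq> t' \<otimes> two_pow l'"
    if p: "pre t t'" "k t l" "k t' l'" for t t' l l'
  proof -
    obtain n n' where n: "len t n" "n \<oplus> l = B" "len t' n'" "n' \<oplus> l' = B" using p unfolding k_def by blast
    obtain j where j: "t \<otimes> two_pow j \<preceq> t'" "t' \<prec> (t \<oplus> \<one>) \<otimes> two_pow j" using p(1) unfolding pre_iff by blast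
    have "n' = n \<oplus> j" using pre_len[OF j n(1)] n(3) len_unique by blast
    then have "n \<oplus> l = n \<oplus> (j \<oplus> l')" using n add_assoc by metis
    then have l: "two_pow l = two_pow j \<otimes> two_pow l'" by (simp add: two_pow_add)
    show ?thesis
      using ord.mult_right_mono[OF j(1), of "two_pow l'"] j(2) ord.mult_right_mono[of "t' \<oplus> \<one>" "(t \<oplus> \<one>) \<otimes> two_pow j" "two_pow l'"]
      unfolding l mul_assoc[symmetric] by (simp add: suc_le)
  qed
  \<comment> \<open>Two intervals of the chain are nested and nonempty, so neither can end before
    the other begins.\<close>
  have disj: "proj1 u \<otimes> two_pow l \<prec> (proj1 v \<oplus> \<one>) \<otimes> two_pow l'"
    if "R (proj1 u) (proj2 u)" "R (proj1 v) (proj2 v)" "k (proj1 u) l" "k (proj1 v) l'" for u v l l'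
  proof -
    have "x \<otimes> two_pow j \<prec> (x \<oplus> \<one>) \<otimes> two_pow j" for x j by (simp add: ord.mult_strict_right_mono)
    note this[of "proj1 u" l] this[of "proj1 v" l']
    then show ?thesis
      using chain[OF that(1,2)] nested[OF _ that(3,4)] nested[OF _ that(4,3)] by (auto; order)
  qed
  have tot: "\<exists>u. low s u \<or> high s u" if s: "s \<preceq> two_pow (B \<oplus> \<one>)" for s
  proof -
    obtain t x where t: "R t x" "\<not> pre t s" using no s by blast
    obtain l where l: "l \<preceq> B" "k t l" using k_ex[OF t(1)] by blast
    have "\<zero> \<prec> t" using len[OF t(1)] len_pos by blast
    then have "\<not> (t \<otimes> two_pow l \<preceq> s \<and> s \<prec> (t \<oplus> \<one>) \<otimes> two_pow l)" using t(2) unfolding pre_iff by blast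
    then have "low s (pair t x) \<or> high s (pair t x)" using l t(1) unfolding low_def high_def proj1_pair proj2_pair
      by (metis ord.not_le)
    then show ?thesis by blast
  qed
  \<comment> \<open>The case \<open>s' = s\<close> makes \<open>low\<close> and \<open>high\<close>
    complementary, hence definable; the case \<open>s' = s \<oplus> \<one>\<close> is the induction
    step.\<close>
  have excl: "\<not> (low s u \<and> high s' v)" if "s' \<preceq> s \<oplus> \<one>" for s s' u v
  proof
    assume "low s u \<and> high s' v"
    then obtain l l' where "k (proj1 u) l" "k (proj1 v) l'" "s \<prec> proj1 u \<otimes> two_pow l" "(proj1 v \<oplus> \<one>) \<otimes> two_pow l' \<preceq> s'"
      and "R (proj1 u) (proj2 u)" "R (proj1 v) (proj2 v)"
      unfolding low_def high_def by blast
    then show False using disj[of u v l l'] that unfolding suc_le[symmetric] 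
      by (meson ord.less_le_not_le ord.order_trans suc_le)
  qed
  have Dk: "Fun f \<Longrightarrow> Fun g \<Longrightarrow> Def (\<lambda>z. k (f z) (g z))" for f g
    unfolding k_def subgoal premises prems by (intro Def_intros prems[THEN Fun_comp]) done
  have DR: "Fun f \<Longrightarrow> Fun g \<Longrightarrow> Def (\<lambda>z. R (f z) (g z))" for f g
    using Def_rel[OF R] .
  \<comment> \<open>The dichotomy is known only up to \<open>two_pow (B \<oplus> \<one>)\<close>, so
    larger \<open>s\<close> are made to satisfy the property trivially.\<close>
  let ?Q = "\<lambda>s. \<exists>u. s \<preceq> two_pow (B \<oplus> \<one>) \<longrightarrow> low s u"
  have Def: "Def ?Q"
  proof (rule Def_ex_delta1)
    show "Def (\<lambda>z. proj1 z \<preceq> two_pow (B \<oplus> \<one>) \<longrightarrow> low (proj1 z) (proj2 z))"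
      unfolding low_def by (intro Def_intros DR Dk)
    show "Def (\<lambda>z. proj1 z \<preceq> two_pow (B \<oplus> \<one>) \<longrightarrow> \<not> high (proj1 z) (proj2 z))"
      unfolding high_def by (intro Def_intros DR Dk)
    show "?Q s \<longleftrightarrow> (\<forall>u. s \<preceq> two_pow (B \<oplus> \<one>) \<longrightarrow> \<not> high s u)" for s
      using tot[of s] excl[of s s] le_add1 by blast
  qed
  have "?Q (two_pow (B \<oplus> \<one>))"
  proof (rule Def_induct[OF Def])
    have "\<not> high \<zero> u" for u
    proof -
      have "\<zero> \<prec> (proj1 u \<oplus> \<one>) \<otimes> two_pow l" for l
        by (metis lt_suc ord.mult_pos_pos two_pow_pos zero_le)
      then show ?thesis unfolding high_def by (metis ord.not_le)
    qed
    then show "?Q \<zero>" using tot[of \<zero>] by blast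
    fix s assume Q: "?Q s"
    show "?Q (s \<oplus> \<one>)"
    proof (rule ccontr)
      assume *: "\<not> ?Q (s \<oplus> \<one>)"
      then have le: "s \<oplus> \<one> \<preceq> two_pow (B \<oplus> \<one>)" by blast
      then obtain v where "high (s \<oplus> \<one>) v" using tot[OF le] * by blast
      moreover have "s \<preceq> two_pow (B \<oplus> \<one>)" using le le_add1[of s \<one>] by order
      ultimately show False using Q excl[of "s \<oplus> \<one>" s] by blast
    qed
  qed
  then obtain u where "low (two_pow (B \<oplus> \<one>)) u" by blast
  then obtain l n where l: "two_pow (B \<oplus> \<one>) \<prec> proj1 u \<otimes> two_pow l" "len (proj1 u) n" "n \<oplus> l = B"
    unfolding low_def k_def by blast
  have "proj1 u \<otimes> two_pow l \<preceq> two_pow (n \<oplus> \<one>) \<otimes> two_pow l"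
    using len_bound[OF l(2)] by (intro ord.mult_right_mono) (simp_all only: le_def zero_le[unfolded le_def] simp_thms)
  also have "\<dots> = two_pow (B \<oplus> \<one>)" unfolding l(3)[symmetric] by (simp add: two_pow_add algebra_simps)
  finally show False using l(1) by order
qed

end

section \<open>Truth in the finite structures below a level\<close>

lemma (in pa_minus) proj1_le: "proj1 z \<preceq> z" and proj2_le: "proj2 z \<preceq> z"
  using pair_ge1 pair_ge2 proj1_junk proj2_junk proj1_pair proj2_pair zero_le by metis+

text \<open>\<open>L i x\<close> means that \<open>x\<close> lies below the \<open>i\<close>-th level. Only those \<open>i\<close> whose level is bounded
  in \<open>M\<close> index a level; they form a \<open>\<Sigma>\<^sup>0\<^sub>1\<close> cut.\<close>

locale levels = rca M X for M :: "'m arith" (structure) and X +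
  fixes L :: "'m \<Rightarrow> 'm \<Rightarrow> bool"
  assumes L_Def: "Def (\<lambda>z. L (proj1 z) (proj2 z))"
    and L_mono: "i \<preceq> j \<Longrightarrow> L i x \<Longrightarrow> L j x"
    and L_down: "x \<preceq> y \<Longrightarrow> L i y \<Longrightarrow> L i x"
begin

lemmas Def_L [Def_intros] = Def_rel[of L, OF L_Def]

text \<open>Elements of \<open>M\<close> serve as formulas about a set \<open>Z\<close> whose columns are the sets chosen so far.
  The first component is a tag. Tags \<open>1\<close>, \<open>2\<close>, \<open>3\<close> are the atomic formulas, which speak about
  non-inclusion, sums and products of columns. With tag \<open>0\<close> the formula \<open>(m, c, s)\<close> holds at level \<open>k\<close>
  if column \<open>m\<close> can be changed so that \<open>s\<close> becomes the truth table, at all levels up to \<open>k\<close>, of the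
  formulas below \<open>c\<close>; the bit for \<open>\<psi>\<close> at level \<open>i\<close> is at place \<open>i c + \<psi>\<close>.\<close>

definition atomic :: "'m \<Rightarrow> 'm \<Rightarrow> ('m \<Rightarrow> bool) \<Rightarrow> bool" where
  "atomic \<phi> k Q \<longleftrightarrow>
    (proj1 \<phi> = \<one> \<and> (\<exists>x. (L k (pair (proj1 (proj2 \<phi>)) x) \<and> Q (pair (proj1 (proj2 \<phi>)) x)) \<and>
        (L k (pair (proj2 (proj2 \<phi>)) x) \<and> \<not> Q (pair (proj2 (proj2 \<phi>)) x)))) \<or>
    (proj1 \<phi> = \<one> \<oplus> \<one> \<and> (\<exists>x y. (L k (pair (proj1 (proj2 \<phi>)) x) \<and> Q (pair (proj1 (proj2 \<phi>)) x)) \<and>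
        (L k (pair (proj1 (proj2 (proj2 \<phi>))) y) \<and> Q (pair (proj1 (proj2 (proj2 \<phi>))) y)) \<and>
        (L k (pair (proj2 (proj2 (proj2 \<phi>))) (x \<oplus> y)) \<and> Q (pair (proj2 (proj2 (proj2 \<phi>))) (x \<oplus> y))))) \<or>
    (proj1 \<phi> = \<one> \<oplus> \<one> \<oplus> \<one> \<and> (\<exists>x y. (L k (pair (proj1 (proj2 \<phi>)) x) \<and> Q (pair (proj1 (proj2 \<phi>)) x)) \<and>
        (L k (pair (proj1 (proj2 (proj2 \<phi>))) y) \<and> Q (pair (proj1 (proj2 (proj2 \<phi>))) y)) \<and>
        (L k (pair (proj2 (proj2 (proj2 \<phi>))) (x \<otimes> y)) \<and> Q (pair (proj2 (proj2 (proj2 \<phi>))) (x \<otimes> y)))))"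

text \<open>Each query to the set is guarded by \<open>L k\<close>, also at the results of sums and
  products.\<close>

lemma atomic_cong:
  assumes "\<And>x. L k x \<Longrightarrow> Q x \<longleftrightarrow> Q' x"
  shows "atomic \<phi> k Q \<longleftrightarrow> atomic \<phi> k Q'"
proof -
  have 1: "(L k x \<and> Q x) = (L k x \<and> Q' x)" "(L k x \<and> \<not> Q x) = (L k x \<and> \<not> Q' x)" for x
    using assms by auto
  show ?thesis unfolding atomic_def 1 ..
qed

lemma Def_atomic [Def_intros]: 
  assumes "Fun f" "Fun g" "Fun h" shows "Def (\<lambda>x. atomic (f x) (g x) (sbit (h x)))"
proof -
  \<comment> \<open>A position holding a \<open>1\<close> is below the string, so the witnesses
    \<open>x\<close> and \<open>y\<close> are bounded by \<open>z\<close>.\<close>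
  have b: "sbit z (pair i x) \<longleftrightarrow> x \<prec> z \<and> sbit z (pair i x)" for z i x
    using bit_less_self pair_ge2 ord.le_less_trans by metis
  have x: "(\<exists>x. (L k (pair i x) \<and> sbit z (pair i x)) \<and> R x) \<longleftrightarrow>
      (\<exists>x. x \<prec> z \<and> (L k (pair i x) \<and> sbit z (pair i x)) \<and> R x)" for k i z R
    using b by blast
  have y: "(\<exists>x y. (L k (pair i x) \<and> sbit z (pair i x)) \<and> (L k (pair j y) \<and> sbit z (pair j y)) \<and> R x y) \<longleftrightarrow>
      (\<exists>x. x \<prec> z \<and> (\<exists>y. y \<prec> z \<and> (L k (pair i x) \<and> sbit z (pair i x)) \<and> (L k (pair j y) \<and> sbit z (pair j y)) \<and> R x y))" for k i j z R
    using b by blast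
  show ?thesis unfolding atomic_def y unfolding x by (intro Def_intros assms[THEN Fun_comp])
qed

section \<open>Tarski clauses and truth tables\<close>

definition in_column :: "'m \<Rightarrow> 'm \<Rightarrow> bool" where
  "in_column m x \<longleftrightarrow> (\<exists>y. x = pair m y)"

lemma Def_in_column [Def_intros]: assumes "Fun f" "Fun g" shows "Def (\<lambda>x. in_column (f x) (g x))"
proof -
  have *: "in_column m x \<longleftrightarrow> (\<exists>y. y \<preceq> x \<and> x = pair m y)" for m x
    unfolding in_column_def using pair_ge2 by blast
  show ?thesis unfolding * by (intro Def_intros assms[THEN Fun_comp])
qed

text \<open>One Tarski clause, with \<open>T\<close> supplying the truth values of smaller formulas
  and \<open>Q\<close> the current set. The element \<open>U\<close> is meant to bound level
  \<open>k\<close>: then the changed set \<open>w\<close> matters only below \<open>U\<close> and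
  ranges over strings below \<open>two_pow (U \<oplus> \<one>)\<close>, a bounded
  quantifier.\<close>

definition clause :: "'m \<Rightarrow> ('m \<Rightarrow> 'm \<Rightarrow> 'm \<Rightarrow> bool) \<Rightarrow> 'm \<Rightarrow> 'm \<Rightarrow> ('m \<Rightarrow> bool) \<Rightarrow> bool" where
  "clause U T \<phi> k Q \<longleftrightarrow> atomic \<phi> k Q \<or>
    proj1 \<phi> = \<zero> \<and> (\<exists>w. w \<prec> two_pow (U \<oplus> \<one>) \<and>
      (\<forall>x. x \<prec> U \<longrightarrow> L k x \<longrightarrow> \<not> in_column (proj1 (proj2 \<phi>)) x \<longrightarrow> (sbit w x \<longleftrightarrow> Q x)) \<and>
      (\<forall>i. i \<preceq> k \<longrightarrow> (\<forall>\<psi>. \<psi> \<prec> proj1 (proj2 (proj2 \<phi>)) \<longrightarrow>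
        (sbit (proj2 (proj2 (proj2 \<phi>))) (i \<otimes> proj1 (proj2 (proj2 \<phi>)) \<oplus> \<psi>) \<longleftrightarrow> T \<psi> i w))))"

definition truth_table :: "'m \<Rightarrow> 'm \<Rightarrow> 'm \<Rightarrow> 'm \<Rightarrow> bool" where
  "truth_table \<tau> U n K \<longleftrightarrow> (\<forall>\<phi>. \<phi> \<prec> n \<longrightarrow> (\<forall>k. k \<preceq> K \<longrightarrow> (\<forall>z. z \<prec> two_pow (U \<oplus> \<one>) \<longrightarrow>
    (sbit \<tau> (pair \<phi> (pair k z)) \<longleftrightarrow> clause U (\<lambda>\<psi> i w. sbit \<tau> (pair \<psi> (pair i w))) \<phi> k (sbit z)))))"

text \<open>Tables exist and agree wherever both are defined, so the choice of \<open>\<tau>\<close>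
  is immaterial.\<close>

definition true_code :: "'m \<Rightarrow> 'm \<Rightarrow> 'm \<Rightarrow> 'm \<Rightarrow> bool" where
  "true_code U \<phi> k z \<longleftrightarrow> (\<exists>\<tau>. z \<prec> two_pow (U \<oplus> \<one>) \<and> truth_table \<tau> U (\<phi> \<oplus> \<one>) k \<and> sbit \<tau> (pair \<phi> (pair k z)))"

lemma clause_cong:
  assumes "\<And>\<psi> i w. \<psi> \<prec> \<phi> \<Longrightarrow> i \<preceq> k \<Longrightarrow> w \<prec> two_pow (U \<oplus> \<one>) \<Longrightarrow> T \<psi> i w \<longleftrightarrow> T' \<psi> i w"
  shows "clause U T \<phi> k Q \<longleftrightarrow> clause U T' \<phi> k Q"
proof -
  \<comment> \<open>The bound on the listed formulas is a component of \<open>\<phi>\<close>, so a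
    clause refers only to smaller formulas and the recursion is well-founded.\<close>
  have "proj1 (proj2 (proj2 \<phi>)) \<preceq> \<phi>" using proj1_le proj2_le ord.order_trans by metis
  then have "T \<psi> i w \<longleftrightarrow> T' \<psi> i w" if "\<psi> \<prec> proj1 (proj2 (proj2 \<phi>))" "i \<preceq> k" "w \<prec> two_pow (U \<oplus> \<one>)" for \<psi> i w
    using that assms ord.less_le_trans by blast
  then show ?thesis unfolding clause_def by blast
qed

lemma Def_clause: 
  assumes "Fun U" "Fun \<tau>" "Fun \<phi>" "Fun k" "Fun z"
  shows "Def (\<lambda>x. clause (U x) (\<lambda>\<psi> i w. sbit (\<tau> x) (pair \<psi> (pair i w))) (\<phi> x) (k x) (sbit (z x)))"
  unfolding clause_def by (intro Def_intros assms assms[THEN Fun_comp])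

lemma Def_truth_table: 
  assumes "Fun \<tau>" "Fun U" "Fun n" "Fun K"
  shows "Def (\<lambda>x. truth_table (\<tau> x) (U x) (n x) (K x))"
  unfolding truth_table_def by (intro Def_intros Def_clause assms assms[THEN Fun_comp])

lemma truth_table_ex: "\<exists>\<tau>. truth_table \<tau> U N K"
proof -
  \<comment> \<open>\<open>B\<close> exceeds the position of every triple of a formula up to
    \<open>N\<close>, a level up to \<open>K\<close> and a string below
    \<open>two_pow (U \<oplus> \<one>)\<close>, so strings of length \<open>B\<close> can hold all
    the tables.\<close>
  define B where "B = pair N (pair K (two_pow (U \<oplus> \<one>))) \<oplus> \<one>"
  have B: "pair \<phi> (pair k z) \<prec> B" if "\<phi> \<preceq> N" "k \<preceq> K" "z \<prec> two_pow (U \<oplus> \<one>)" for \<phi> k z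
    unfolding B_def lt_suc using that by (intro pair_mono) (auto simp: le_def)
  let ?P = "\<lambda>n. n \<preceq> N \<longrightarrow> (\<exists>\<tau>. \<tau> \<prec> two_pow (B \<oplus> \<one>) \<and> truth_table \<tau> U n K)"
  have "?P N"
  proof (rule Def_induct[where P = ?P])
    show "Def ?P" by (intro Def_intros Def_truth_table)
    show "?P \<zero>" by (intro impI exI[of _ \<zero>]) (simp add: truth_table_def not_lt_zero ord.add_pos_pos)
    fix n assume IH: "?P n"
    show "?P (n \<oplus> \<one>)"
    proof
      assume "n \<oplus> \<one> \<preceq> N"
      then have n: "n \<prec> N" by (simp add: suc_le)
      then obtain \<tau> where \<tau>: "truth_table \<tau> U n K" using IH ord.less_imp_le by blast
      let ?T = "\<lambda>\<psi> i w. sbit \<tau> (pair \<psi> (pair i w))"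
      \<comment> \<open>Rows below \<open>n\<close> are copied and row \<open>n\<close> is computed
        from them by its clause; \<open>proj1 x\<close> is the formula that position
        \<open>x\<close> belongs to.\<close>
      define P where "P x \<longleftrightarrow> (proj1 x \<prec> n \<and> sbit \<tau> x) \<or>
        (proj1 x = n \<and> clause U ?T n (proj1 (proj2 x)) (sbit (proj2 (proj2 x))))" for x
      have "Def P" unfolding P_def by (intro Def_intros Def_clause)
      from code_ex[OF this, of B] obtain \<sigma> where \<sigma>: "len \<sigma> B" "\<And>x. x \<prec> B \<Longrightarrow> sbit \<sigma> x \<longleftrightarrow> P x"
        by blast
      let ?S = "\<lambda>\<psi> i w. sbit \<sigma> (pair \<psi> (pair i w))"
      have same: "?S \<psi> i w \<longleftrightarrow> ?T \<psi> i w" if "\<psi> \<prec> n" "i \<preceq> K" "w \<prec> two_pow (U \<oplus> \<one>)" for \<psi> i w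
        using B[of \<psi> i w] \<sigma>(2) that n by (auto simp: P_def)
      have "truth_table \<sigma> U (n \<oplus> \<one>) K"
        unfolding truth_table_def lt_suc
      proof (intro allI impI)
        fix \<phi> k z assume a: "\<phi> \<preceq> n" "k \<preceq> K" "z \<prec> two_pow (U \<oplus> \<one>)"
        have r: "clause U ?S \<phi> k (sbit z) \<longleftrightarrow> clause U ?T \<phi> k (sbit z)"
          using a same by (intro clause_cong) (meson ord.order_trans ord.less_le_trans)
        show "?S \<phi> k z \<longleftrightarrow> clause U ?S \<phi> k (sbit z)"
        proof (cases "\<phi> = n")
          case True
          then show ?thesis using r \<sigma>(2)[OF B[of \<phi> k z]] a n by (simp add: P_def)
        next
          case False
          then have "\<phi> \<prec> n" using a by (simp add: le_def)
          then show ?thesis using r same \<tau> a unfolding truth_table_def by blast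
        qed
      qed
      then show "\<exists>\<tau>. \<tau> \<prec> two_pow (B \<oplus> \<one>) \<and> truth_table \<tau> U (n \<oplus> \<one>) K" using len_bound[OF \<sigma>(1)] by blast
    qed
  qed
  then show ?thesis by auto
qed

lemma truth_table_unique:
  assumes "truth_table \<tau> U n K" "truth_table \<tau>' U n' K'"
    and "\<phi> \<prec> n" "\<phi> \<prec> n'" "k \<preceq> K" "k \<preceq> K'" "z \<prec> two_pow (U \<oplus> \<one>)"
  shows "sbit \<tau> (pair \<phi> (pair k z)) \<longleftrightarrow> sbit \<tau>' (pair \<phi> (pair k z))"
proof -
  let ?P = "\<lambda>\<phi>. \<phi> \<prec> n \<longrightarrow> \<phi> \<prec> n' \<longrightarrow> (\<forall>k. k \<preceq> K \<longrightarrow> k \<preceq> K' \<longrightarrow> (\<forall>z. z \<prec> two_pow (U \<oplus> \<one>) \<longrightarrow>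
    (sbit \<tau> (pair \<phi> (pair k z)) \<longleftrightarrow> sbit \<tau>' (pair \<phi> (pair k z)))))"
  have "?P \<phi>"
  proof (rule Def_less_induct[where P = ?P])
    show "Def ?P" by (intro Def_intros)
    fix \<phi> assume IH: "\<And>\<psi>. \<psi> \<prec> \<phi> \<Longrightarrow> ?P \<psi>"
    show "?P \<phi>"
    proof (intro allI impI)
      fix k z assume a: "\<phi> \<prec> n" "\<phi> \<prec> n'" "k \<preceq> K" "k \<preceq> K'" "z \<prec> two_pow (U \<oplus> \<one>)"
      have "clause U (\<lambda>\<psi> i w. sbit \<tau> (pair \<psi> (pair i w))) \<phi> k (sbit z) \<longleftrightarrow>
          clause U (\<lambda>\<psi> i w. sbit \<tau>' (pair \<psi> (pair i w))) \<phi> k (sbit z)"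
        by (rule clause_cong) (use IH a ord.order_trans ord.less_trans in blast)
      then show "sbit \<tau> (pair \<phi> (pair k z)) \<longleftrightarrow> sbit \<tau>' (pair \<phi> (pair k z))"
        using assms(1,2) a unfolding truth_table_def by blast
    qed
  qed
  then show ?thesis using assms by blast
qed

lemma true_code_iff:
  assumes "truth_table \<tau> U n K" "\<phi> \<prec> n" "k \<preceq> K" "z \<prec> two_pow (U \<oplus> \<one>)"
  shows "true_code U \<phi> k z \<longleftrightarrow> sbit \<tau> (pair \<phi> (pair k z))"
proof -
  obtain \<sigma> where "truth_table \<sigma> U (\<phi> \<oplus> \<one>) k" using truth_table_ex by blast
  moreover have "sbit \<sigma>' (pair \<phi> (pair k z)) \<longleftrightarrow> sbit \<tau> (pair \<phi> (pair k z))" if "truth_table \<sigma>' U (\<phi> \<oplus> \<one>) k" for \<sigma>'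
    using truth_table_unique[OF that assms(1)] assms by (simp add: lt_suc)
  ultimately show ?thesis unfolding true_code_def using assms(4) by blast
qed

lemma true_code_rec:
  assumes "z \<prec> two_pow (U \<oplus> \<one>)"
  shows "true_code U \<phi> k z \<longleftrightarrow> clause U (true_code U) \<phi> k (sbit z)"
proof -
  obtain \<tau> where \<tau>: "truth_table \<tau> U (\<phi> \<oplus> \<one>) k" using truth_table_ex by blast
  have "clause U (\<lambda>\<psi> i w. sbit \<tau> (pair \<psi> (pair i w))) \<phi> k (sbit z) \<longleftrightarrow> clause U (true_code U) \<phi> k (sbit z)"
    by (rule clause_cong) (use true_code_iff[OF \<tau>] in \<open>auto simp: lt_suc le_def\<close>)
  then show ?thesis using true_code_iff[OF \<tau>] \<tau> assms unfolding truth_table_def by (simp add: lt_suc)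
qed

text \<open>Any table decides the formula, so truth can be expressed by asking for some table or for
  all tables.\<close>

lemma Def_true_code [Def_intros]: 
  assumes "Fun U" "Fun \<phi>" "Fun k" "Fun z"
  shows "Def (\<lambda>x. true_code (U x) (\<phi> x) (k x) (z x))"
  unfolding true_code_def
proof (rule Def_ex_delta1)
  show "Def (\<lambda>x. z (proj1 x) \<prec> two_pow (U (proj1 x) \<oplus> \<one>) \<and> truth_table (proj2 x) (U (proj1 x)) (\<phi> (proj1 x) \<oplus> \<one>) (k (proj1 x)) \<and> 
      sbit (proj2 x) (pair (\<phi> (proj1 x)) (pair (k (proj1 x)) (z (proj1 x)))))"
    by (intro Def_intros Def_truth_table assms[THEN Fun_comp])
  show "Def (\<lambda>x. z (proj1 x) \<prec> two_pow (U (proj1 x) \<oplus> \<one>) \<and> (truth_table (proj2 x) (U (proj1 x)) (\<phi> (proj1 x) \<oplus> \<one>) (k (proj1 x)) \<longrightarrow>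
      sbit (proj2 x) (pair (\<phi> (proj1 x)) (pair (k (proj1 x)) (z (proj1 x))))))"
    by (intro Def_intros Def_truth_table assms[THEN Fun_comp])
  fix x 
  obtain \<tau> where \<tau>: "truth_table \<tau> (U x) (\<phi> x \<oplus> \<one>) (k x)" using truth_table_ex by blast
  show "(\<exists>y. z x \<prec> two_pow (U x \<oplus> \<one>) \<and> truth_table y (U x) (\<phi> x \<oplus> \<one>) (k x) \<and> sbit y (pair (\<phi> x) (pair (k x) (z x)))) \<longleftrightarrow>
    (\<forall>y. z x \<prec> two_pow (U x \<oplus> \<one>) \<and> (truth_table y (U x) (\<phi> x \<oplus> \<one>) (k x) \<longrightarrow> sbit y (pair (\<phi> x) (pair (k x) (z x)))))"
    using truth_table_unique[of _ "U x" "\<phi> x \<oplus> \<one>" "k x" _ "\<phi> x \<oplus> \<one>" "k x" "\<phi> x" "k x" "z x"] \<tau> 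
    unfolding lt_suc by (metis ord.order_refl)
qed

text \<open>Only the part of a string below the level matters. A string \<open>w\<close> demanded by
  a quantifier clause can be truncated to length \<open>U\<close> or padded to length
  \<open>U'\<close>, since positions from \<open>U\<close> on lie outside the level.\<close>

lemma true_code_inv:
  assumes "U \<preceq> U'" "\<not> L K U" "k \<preceq> K" "z \<prec> two_pow (U \<oplus> \<one>)" "z' \<prec> two_pow (U' \<oplus> \<one>)"
    and "\<And>x. L k x \<Longrightarrow> sbit z x \<longleftrightarrow> sbit z' x"
  shows "true_code U \<phi> k z \<longleftrightarrow> true_code U' \<phi> k z'"
proof -
  \<comment> \<open>A quantifier clause changes the level and both strings, so the induction
    quantifies over all three.\<close>
  let ?P = "\<lambda>\<phi>. \<forall>k. k \<preceq> K \<longrightarrow> (\<forall>z. z \<prec> two_pow (U \<oplus> \<one>) \<longrightarrow> (\<forall>z'. z' \<prec> two_pow (U' \<oplus> \<one>) \<longrightarrow> 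
    (\<forall>x. x \<prec> U \<longrightarrow> L k x \<longrightarrow> (sbit z x \<longleftrightarrow> sbit z' x)) \<longrightarrow> (true_code U \<phi> k z \<longleftrightarrow> true_code U' \<phi> k z')))"
  have LU: "x \<prec> U" if "L k x" "k \<preceq> K" for k x
    using that L_mono L_down assms(2) by (metis ord.not_le)
  have "?P \<phi>"
  proof (rule Def_less_induct[where P = ?P])
    show "Def ?P" by (intro Def_intros)
    fix \<phi> assume IH: "\<And>\<psi>. \<psi> \<prec> \<phi> \<Longrightarrow> ?P \<psi>"
    show "?P \<phi>"
    proof (intro allI impI)
      fix k z z' assume k: "k \<preceq> K" and z: "z \<prec> two_pow (U \<oplus> \<one>)" and z': "z' \<prec> two_pow (U' \<oplus> \<one>)"
        and eq: "\<forall>x. x \<prec> U \<longrightarrow> L k x \<longrightarrow> (sbit z x \<longleftrightarrow> sbit z' x)"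
      have at: "atomic \<phi> k (sbit z) \<longleftrightarrow> atomic \<phi> k (sbit z')"
        using LU eq k by (intro atomic_cong) blast
      define m c S where mcS: "m = proj1 (proj2 \<phi>)" "c = proj1 (proj2 (proj2 \<phi>))" "S = proj2 (proj2 (proj2 \<phi>))"
      have c: "c \<preceq> \<phi>" unfolding mcS using proj1_le proj2_le ord.order_trans by metis
      have step: "(\<forall>i. i \<preceq> k \<longrightarrow> (\<forall>\<psi>. \<psi> \<prec> c \<longrightarrow> (sbit S (i \<otimes> c \<oplus> \<psi>) \<longleftrightarrow> true_code U \<psi> i w))) \<longleftrightarrow>
         (\<forall>i. i \<preceq> k \<longrightarrow> (\<forall>\<psi>. \<psi> \<prec> c \<longrightarrow> (sbit S (i \<otimes> c \<oplus> \<psi>) \<longleftrightarrow> true_code U' \<psi> i w')))"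
        if w: "w \<prec> two_pow (U \<oplus> \<one>)" "w' \<prec> two_pow (U' \<oplus> \<one>)" "\<And>x. x \<prec> U \<Longrightarrow> sbit w x \<longleftrightarrow> sbit w' x" for w w'
      proof -
        have "true_code U \<psi> i w \<longleftrightarrow> true_code U' \<psi> i w'" if "i \<preceq> k" "\<psi> \<prec> c" for i \<psi>
        proof -
          have "\<psi> \<prec> \<phi>" "i \<preceq> K" using that c k by order+
          then show ?thesis using IH w by blast
        qed
        then show ?thesis by blast
      qed
      define G where "G U z w \<longleftrightarrow> (\<forall>x. x \<prec> U \<longrightarrow> L k x \<longrightarrow> \<not> in_column m x \<longrightarrow> (sbit w x \<longleftrightarrow> sbit z x))" for U z w
      have G: "G U z w \<longleftrightarrow> G U' z' w'" if "\<And>x. x \<prec> U \<Longrightarrow> sbit w x \<longleftrightarrow> sbit w' x" for w w'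
        unfolding G_def using that eq LU k assms(1) ord.less_le_trans by metis
      have ex: "\<exists>w'. w' \<prec> two_pow (V' \<oplus> \<one>) \<and> (\<forall>x. x \<prec> U \<longrightarrow> (sbit w x \<longleftrightarrow> sbit w' x))" if "U \<preceq> V'" for w V'
      proof -
        have "Def (\<lambda>x. sbit w x)" by (intro Def_intros)
        from code_ex[OF this, of V'] show ?thesis using len_bound that ord.less_le_trans by metis
      qed
      have "(\<exists>w. w \<prec> two_pow (U \<oplus> \<one>) \<and> G U z w \<and> (\<forall>i. i \<preceq> k \<longrightarrow> (\<forall>\<psi>. \<psi> \<prec> c \<longrightarrow> (sbit S (i \<otimes> c \<oplus> \<psi>) \<longleftrightarrow> true_code U \<psi> i w)))) \<longleftrightarrow>
         (\<exists>w. w \<prec> two_pow (U' \<oplus> \<one>) \<and> G U' z' w \<and> (\<forall>i. i \<preceq> k \<longrightarrow> (\<forall>\<psi>. \<psi> \<prec> c \<longrightarrow> (sbit S (i \<otimes> c \<oplus> \<psi>) \<longleftrightarrow> true_code U' \<psi> i w))))"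
        (is "(\<exists>w. ?A w) \<longleftrightarrow> (\<exists>w. ?B w)")
      proof
        assume "\<exists>w. ?A w"
        then obtain w where w: "?A w" by blast
        obtain w' where w': "w' \<prec> two_pow (U' \<oplus> \<one>)" "\<And>x. x \<prec> U \<Longrightarrow> sbit w x \<longleftrightarrow> sbit w' x"
          using ex[OF assms(1), of w] by blast
        have "?B w'" using w w' step[OF _ w'] G[OF w'(2)] by blast
        then show "\<exists>w. ?B w" ..
      next
        assume "\<exists>w. ?B w"
        then obtain w' where w': "?B w'" by blast
        obtain w where w: "w \<prec> two_pow (U \<oplus> \<one>)" "\<And>x. x \<prec> U \<Longrightarrow> sbit w x \<longleftrightarrow> sbit w' x"
          using ex[of U w'] by blast
        have "?A w" using w w' step[OF w(1) _ w(2)] G[OF w(2)] by blast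
        then show "\<exists>w. ?A w" ..
      qed
      then show "true_code U \<phi> k z \<longleftrightarrow> true_code U' \<phi> k z'"
        unfolding true_code_rec[OF z] true_code_rec[OF z'] clause_def at mcS[symmetric] G_def by blast
    qed
  qed
  then show ?thesis using assms(3-) by blast
qed

text \<open>At a bounded level the choice of \<open>U\<close> and \<open>z\<close> does not matter,
  by \<open>true_at_iff\<close>; at an unbounded level nothing is true.\<close>

definition true_at :: "'m set \<Rightarrow> 'm \<Rightarrow> 'm \<Rightarrow> bool" where
  "true_at Z \<phi> k \<longleftrightarrow> (\<exists>U z. \<not> L k U \<and> z \<prec> two_pow (U \<oplus> \<one>) \<and> (\<forall>x. L k x \<longrightarrow> (sbit z x \<longleftrightarrow> x \<in> Z)) \<and> true_code U \<phi> k z)"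

lemma true_at_iff:
  assumes "\<not> L k U" "z \<prec> two_pow (U \<oplus> \<one>)" "\<And>x. L k x \<Longrightarrow> sbit z x \<longleftrightarrow> x \<in> Z"
  shows "true_at Z \<phi> k \<longleftrightarrow> true_code U \<phi> k z"
proof
  assume "true_at Z \<phi> k"
  then obtain V v where v: "\<not> L k V" "v \<prec> two_pow (V \<oplus> \<one>)" "\<And>x. L k x \<Longrightarrow> sbit v x \<longleftrightarrow> x \<in> Z" "true_code V \<phi> k v"
    unfolding true_at_def by blast
  show "true_code U \<phi> k z"
  proof (cases "U \<preceq> V")
    case True
    then show ?thesis using true_code_inv[OF True assms(1) ord.order_refl assms(2) v(2)] assms(3) v(3,4) by simp
  next
    case False
    then have "V \<preceq> U" by simp
    then show ?thesis using true_code_inv[OF _ v(1) ord.order_refl v(2) assms(2)] assms(3) v(3,4) by simp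
  qed
qed (use assms true_at_def in blast)

end

section \<open>Types are coded and realised\<close>

context pa_minus
begin

lemma cell_less: 
  assumes "i \<prec> n" "\<psi> \<prec> c" shows "i \<otimes> c \<oplus> \<psi> \<prec> n \<otimes> c"
proof -
  have "i \<otimes> c \<oplus> \<psi> \<prec> i \<otimes> c \<oplus> c" using assms(2) by simp
  also have "\<dots> = (i \<oplus> \<one>) \<otimes> c" by (simp add: algebra_simps)
  also have "\<dots> \<preceq> n \<otimes> c" using assms(1) by (simp add: ord.mult_right_mono suc_le)
  finally show ?thesis .
qed

end

context levels
begin

definition index :: "'m \<Rightarrow> bool" where
  "index i \<longleftrightarrow> (\<exists>u. \<not> L i u)"

lemma index_less: "index i \<Longrightarrow> \<forall>x. L c x \<Longrightarrow> i \<prec> c"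
  unfolding index_def using L_mono by (metis ord.not_le)

lemma cell_ex:
  assumes "y \<prec> n \<otimes> c" shows "\<exists>i \<psi>. y = i \<otimes> c \<oplus> \<psi> \<and> i \<prec> n \<and> \<psi> \<prec> c"
proof -
  have "\<zero> \<prec> c" using assms not_lt_zero[of y] pos_iff mul_zero by metis
  then obtain i where i: "i \<otimes> c \<preceq> y" "y \<prec> (i \<oplus> \<one>) \<otimes> c" using division by blast
  then obtain \<psi> where \<psi>: "y = i \<otimes> c \<oplus> \<psi>" using le_iff_add by blast
  have "(i \<oplus> \<one>) \<otimes> c = i \<otimes> c \<oplus> c" by (simp add: algebra_simps)
  then have "\<psi> \<prec> c" using i(2) \<psi> by simp
  moreover have "i \<prec> n"
  proof (rule ccontr)
    assume "\<not> i \<prec> n"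
    then have "n \<otimes> c \<preceq> i \<otimes> c" by (simp add: ord.mult_right_mono ord.not_less)
    then show False using i(1) assms by order
  qed
  ultimately show ?thesis using \<psi> by blast
qed

lemma code_set:
  assumes "Z \<in> X" shows "\<exists>z. len z U \<and> (\<forall>x. x \<prec> U \<longrightarrow> (sbit z x \<longleftrightarrow> x \<in> Z))"
  using code_ex[of "\<lambda>x. x \<in> Z" U] Def_set[OF assms] by blast

lemma L_less: "\<not> L k U \<Longrightarrow> L k x \<Longrightarrow> x \<prec> U"
  using L_down by (metis ord.not_le)

text \<open>The tables of the first \<open>n\<close> levels are strings of length
  \<open>n \<otimes> c\<close> forming a chain, one for each \<open>n\<close> whose levels are
  bounded. These \<open>n\<close> may have no maximum, so there may be no longest table, and
  \<open>chain_bound\<close> supplies an \<open>s\<close> extending all of them.\<close>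

lemma type_code:
  assumes Z: "Z \<in> X" and c: "\<forall>x. L c x"
  shows "\<exists>s. s \<preceq> two_pow (c \<otimes> c \<oplus> \<one>) \<and> 
    (\<forall>i \<psi>. index i \<longrightarrow> \<psi> \<prec> c \<longrightarrow> (sbit s (i \<otimes> c \<oplus> \<psi>) \<longleftrightarrow> true_at Z \<psi> i))"
proof -
  \<comment> \<open>\<open>t\<close> is the table of the first \<open>n\<close> levels, computed
    from the string \<open>z\<close> of \<open>Z\<close> up to a common bound \<open>u\<close> of
    these levels. The data \<open>u\<close>, \<open>n\<close>, \<open>z\<close> are packed into the
    witness argument of \<open>chain_bound\<close>.\<close>
  define R' where "R' t u n z \<longleftrightarrow> len z u \<and> (\<forall>y. y \<prec> u \<longrightarrow> (sbit z y \<longleftrightarrow> y \<in> Z)) \<and> n \<preceq> c \<and>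
    (\<forall>i. i \<prec> n \<longrightarrow> \<not> L i u) \<and> len t (n \<otimes> c) \<and>
    (\<forall>i. i \<prec> n \<longrightarrow> (\<forall>\<psi>. \<psi> \<prec> c \<longrightarrow> (sbit t (i \<otimes> c \<oplus> \<psi>) \<longleftrightarrow> true_code u \<psi> i z)))" for t u n z
  define R where "R t x \<longleftrightarrow> R' t (proj1 x) (proj1 (proj2 x)) (proj2 (proj2 x))" for t x
  have true_at: "true_code u \<psi> i z \<longleftrightarrow> true_at Z \<psi> i" if "R' t u n z" "i \<prec> n" for t u n z i \<psi>
  proof (rule true_at_iff[symmetric])
    show l: "\<not> L i u" using that unfolding R'_def by blast
    show "z \<prec> two_pow (u \<oplus> \<one>)" using that len_bound unfolding R'_def by blast
    show "L i x \<Longrightarrow> sbit z x \<longleftrightarrow> x \<in> Z" for x using that L_less[OF l] unfolding R'_def by blast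
  qed
  have ch: "pre t t'" if r: "R' t u n z" "R' t' u' n' z'" "n \<preceq> n'" for t u n z t' u' n' z'
  proof -
    have l: "len t (n \<otimes> c)" "len t' (n' \<otimes> c)" using r unfolding R'_def by blast+
    have "n \<otimes> c \<preceq> n' \<otimes> c" using r(3) by (simp add: ord.mult_right_mono)
    then obtain p where p: "pre p t'" "len p (n \<otimes> c)" using pre_ex[OF l(2)] by blast
    have "t = p"
    proof (rule bit_ext[OF l(1) p(2)])
      fix y assume y: "y \<prec> n \<otimes> c"
      then obtain i \<psi> where i: "y = i \<otimes> c \<oplus> \<psi>" "i \<prec> n" "\<psi> \<prec> c" using cell_ex by blast
      have i': "i \<prec> n'" using i(2) r(3) by order
      have "sbit p y \<longleftrightarrow> sbit t' y" using bit_pre[OF p y] .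
      also have "\<dots> \<longleftrightarrow> true_at Z \<psi> i" using r(2) i i' true_at[OF r(2) i'] unfolding R'_def by blast
      also have "\<dots> \<longleftrightarrow> sbit t y" using r(1) i true_at[OF r(1) i(2)] unfolding R'_def by blast
      finally show "sbit t y \<longleftrightarrow> sbit p y" by blast
    qed
    then show ?thesis using p(1) by simp
  qed
  have "\<exists>s. s \<preceq> two_pow (c \<otimes> c \<oplus> \<one>) \<and> (\<forall>t x. R t x \<longrightarrow> pre t s)"
  proof (rule chain_bound)
    show "Def (\<lambda>z. R (proj1 z) (proj2 z))" unfolding R_def R'_def by (intro Def_intros Def_subst[OF Def_set[OF Z]])
    show "\<exists>n. len t n \<and> n \<preceq> c \<otimes> c" if "R t x" for t x
      using that unfolding R_def R'_def by (meson ord.mult_right_mono zero_le)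
    show "pre t t' \<or> pre t' t" if "R t x" "R t' x'" for t t' x x'
      using that ch unfolding R_def by (meson ord.linear)
  qed
  then obtain s where s: "s \<preceq> two_pow (c \<otimes> c \<oplus> \<one>)" "\<And>t x. R t x \<Longrightarrow> pre t s" by blast
  have "sbit s (i \<otimes> c \<oplus> \<psi>) \<longleftrightarrow> true_at Z \<psi> i" if i: "index i" "\<psi> \<prec> c" for i \<psi>
  proof -
    \<comment> \<open>Row \<open>i\<close> first appears in the table of
      \<open>i \<oplus> \<one>\<close> levels, so that many levels must still fit within
      \<open>c\<close>.\<close>
    have ic: "i \<oplus> \<one> \<preceq> c" using index_less[OF i(1) c] by (simp add: suc_le)
    obtain u where u: "\<not> L i u" using i(1) index_def by blast
    obtain z where z: "len z u" "\<forall>x. x \<prec> u \<longrightarrow> (sbit z x \<longleftrightarrow> x \<in> Z)" using code_set[OF Z] by blast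
    have "Def (\<lambda>y. \<exists>i'. i' \<prec> i \<oplus> \<one> \<and> (\<exists>\<psi>. \<psi> \<prec> c \<and> y = i' \<otimes> c \<oplus> \<psi> \<and> true_code u \<psi> i' z))"
      by (intro Def_intros)
    from code_ex[OF this, of "(i \<oplus> \<one>) \<otimes> c"] obtain t where t: "len t ((i \<oplus> \<one>) \<otimes> c)"
      "\<And>y. y \<prec> (i \<oplus> \<one>) \<otimes> c \<Longrightarrow> sbit t y \<longleftrightarrow> (\<exists>i'. i' \<prec> i \<oplus> \<one> \<and> (\<exists>\<psi>. \<psi> \<prec> c \<and> y = i' \<otimes> c \<oplus> \<psi> \<and> true_code u \<psi> i' z))"
      by blast
    have tb: "sbit t (i' \<otimes> c \<oplus> \<psi>) \<longleftrightarrow> true_code u \<psi> i' z" if "i' \<prec> i \<oplus> \<one>" "\<psi> \<prec> c" for i' \<psi>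
      using t(2)[OF cell_less[OF that]] remainder_unique that by metis
    have "\<not> L i' u" if "i' \<prec> i \<oplus> \<one>" for i' using that u L_mono lt_suc by blast
    then have r: "R' t u (i \<oplus> \<one>) z" unfolding R'_def using z t(1) ic tb by blast
    then have "R t (pair u (pair (i \<oplus> \<one>) z))" by (simp add: R_def)
    then have "pre t s" using s by blast
    have ii: "i \<prec> i \<oplus> \<one>" by simp
    have "sbit s (i \<otimes> c \<oplus> \<psi>) \<longleftrightarrow> sbit t (i \<otimes> c \<oplus> \<psi>)"
      using bit_pre[OF \<open>pre t s\<close> t(1) cell_less[OF ii i(2)]] by simp
    also have "\<dots> \<longleftrightarrow> true_at Z \<psi> i" using tb[OF ii i(2)] true_at[OF r ii] by simp
    finally show ?thesis .
  qed
  then show ?thesis using s(1) by blast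
qed

section \<open>Agreement of sets on formulas and realisation of types\<close>

definition agree_below :: "'m \<Rightarrow> 'm set \<Rightarrow> 'm set \<Rightarrow> bool" where
  "agree_below b Z W \<longleftrightarrow> (\<forall>k. index k \<longrightarrow> (\<forall>\<phi>. \<phi> \<prec> b \<longrightarrow> (true_at Z \<phi> k \<longleftrightarrow> true_at W \<phi> k)))"

lemma agree_below_sym: "agree_below b Z W \<Longrightarrow> agree_below b W Z"
  unfolding agree_below_def by blast

lemma agree_below_refl: "agree_below b Z Z"
  unfolding agree_below_def by blast

lemma true_at_quant:
  "true_at Z (pair \<zero> (pair m (pair c s))) j \<longleftrightarrow> (\<exists>U z. \<not> L j U \<and> z \<prec> two_pow (U \<oplus> \<one>) \<and> 
    (\<forall>x. L j x \<longrightarrow> (sbit z x \<longleftrightarrow> x \<in> Z)) \<and> (\<exists>w. w \<prec> two_pow (U \<oplus> \<one>) \<and>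
      (\<forall>x. x \<prec> U \<longrightarrow> L j x \<longrightarrow> \<not> in_column m x \<longrightarrow> (sbit w x \<longleftrightarrow> sbit z x)) \<and>
      (\<forall>i. i \<preceq> j \<longrightarrow> (\<forall>\<psi>. \<psi> \<prec> c \<longrightarrow> (sbit s (i \<otimes> c \<oplus> \<psi>) \<longleftrightarrow> true_code U \<psi> i w)))))"
proof -
  have "\<zero> \<noteq> \<one>" "\<zero> \<noteq> \<one> \<oplus> \<one>" "\<zero> \<noteq> \<one> \<oplus> \<one> \<oplus> \<one>"
    using zero_lt_one le_add1 by (metis lt_irrefl ord.less_le_trans)+
  then have "\<not> atomic (pair \<zero> (pair m (pair c s))) j Q" for Q unfolding atomic_def by simp
  then have "true_code U (pair \<zero> (pair m (pair c s))) j z \<longleftrightarrow> (\<exists>w. w \<prec> two_pow (U \<oplus> \<one>) \<and>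
      (\<forall>x. x \<prec> U \<longrightarrow> L j x \<longrightarrow> \<not> in_column m x \<longrightarrow> (sbit w x \<longleftrightarrow> sbit z x)) \<and>
      (\<forall>i. i \<preceq> j \<longrightarrow> (\<forall>\<psi>. \<psi> \<prec> c \<longrightarrow> (sbit s (i \<otimes> c \<oplus> \<psi>) \<longleftrightarrow> true_code U \<psi> i w))))"
    if "z \<prec> two_pow (U \<oplus> \<one>)" for z U
    unfolding true_code_rec[OF that] clause_def by simp
  then show ?thesis unfolding true_at_def by (intro ex_cong1 conj_cong refl)
qed

text \<open>The tree consists of the strings that agree with \<open>W\<close> off column
  \<open>m\<close> and have the truth values prescribed by \<open>s\<close> at the levels they
  already cover. The hypothesis \<open>st\<close> provides such strings of every length. A path is
  the wanted set, and its truth values at a level are read off an initial segment covering that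
  level.\<close>

lemma realise_path:
  assumes WKL: "WKL M X" and cof: "\<And>x. \<exists>i. index i \<and> L i x" and W: "W \<in> X" and c: "\<forall>x. L c x"
    and st: "\<And>j. index j \<Longrightarrow> true_at W (pair \<zero> (pair m (pair c s))) j"
  shows "\<exists>W'\<in>X. (\<forall>x. \<not> in_column m x \<longrightarrow> (x \<in> W' \<longleftrightarrow> x \<in> W)) \<and>
    (\<forall>i \<psi>. index i \<longrightarrow> \<psi> \<prec> c \<longrightarrow> (sbit s (i \<otimes> c \<oplus> \<psi>) \<longleftrightarrow> true_at W' \<psi> i))"
proof -
  \<comment> \<open>The guard \<open>\<not> L i n\<close> restricts to levels bounded by
    \<open>n\<close>, where truth depends only on the first \<open>n\<close> bits; this is what
    closes the tree under initial segments.\<close>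
  define N where "N t n \<longleftrightarrow> len t n \<and> (\<forall>x. x \<prec> n \<longrightarrow> \<not> in_column m x \<longrightarrow> (sbit t x \<longleftrightarrow> x \<in> W)) \<and>
    (\<forall>i. i \<prec> c \<longrightarrow> (\<forall>\<psi>. \<psi> \<prec> c \<longrightarrow> \<not> L i n \<longrightarrow> (true_code n \<psi> i t \<longleftrightarrow> sbit s (i \<otimes> c \<oplus> \<psi>))))" for t n
  define T where "T = {t. \<exists>n. n \<prec> t \<and> N t n}"
  have "Def (\<lambda>t. \<exists>n. n \<prec> t \<and> N t n)" unfolding N_def by (intro Def_intros Def_subst[OF Def_set[OF W]])
  then have "T \<in> X" by (simp add: T_def Def_def)
  have T_iff: "t \<in> T \<longleftrightarrow> (\<exists>n. N t n)" for t unfolding T_def N_def using len_less by blast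
  have "tree01 M T"
    unfolding tree01_def
  proof (intro conjI ballI allI impI)
    fix t assume "t \<in> T"
    then show "\<zero> \<prec> t" unfolding T_iff N_def using len_pos by blast
  next
    fix t r assume "t \<in> T" and rt: "pre r t"
    then obtain n where n: "N t n" unfolding T_iff by blast
    obtain n' where n': "len r n'" using len_ex pre_pos(1) rt by blast
    have le: "n' \<preceq> n" using pre_len_le[OF rt n'] n unfolding N_def by blast
    have b: "sbit r x \<longleftrightarrow> sbit t x" if "x \<prec> n'" for x using bit_pre[OF rt n' that] .
    have "true_code n' \<psi> i r \<longleftrightarrow> sbit s (i \<otimes> c \<oplus> \<psi>)" if i: "i \<prec> c" "\<psi> \<prec> c" "\<not> L i n'" for i \<psi>
    proof -
      have "\<not> L i n" using i(3) le L_down by blast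
      then have "true_code n \<psi> i t \<longleftrightarrow> sbit s (i \<otimes> c \<oplus> \<psi>)" using n i unfolding N_def by blast
      moreover have "true_code n' \<psi> i r \<longleftrightarrow> true_code n \<psi> i t"
        using true_code_inv[OF le i(3) ord.order_refl] len_bound n' n b L_less[OF i(3)] unfolding N_def by blast
      ultimately show ?thesis by simp
    qed
    moreover have "sbit r x \<longleftrightarrow> x \<in> W" if x: "x \<prec> n'" "\<not> in_column m x" for x
      using b[OF x(1)] n x ord.less_le_trans[OF x(1) le] unfolding N_def by blast
    ultimately have "N r n'" unfolding N_def using n' by blast
    then show "r \<in> T" unfolding T_iff by blast
  qed
  moreover have "unbounded M T"
    unfolding unbounded_def
  proof
    fix n
    \<comment> \<open>Level \<open>j\<close> contains \<open>n\<close>, so every level bounded by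
      \<open>n\<close> comes no later than \<open>j\<close> and is covered by the formula assumed at
      \<open>j\<close>.\<close>
    obtain j where j: "index j" "L j n" using cof by blast
    from st[OF j(1)] obtain U z w where U: "\<not> L j U" "z \<prec> two_pow (U \<oplus> \<one>)" 
        "\<forall>x. L j x \<longrightarrow> (sbit z x \<longleftrightarrow> x \<in> W)" "w \<prec> two_pow (U \<oplus> \<one>)" 
        "\<forall>x. x \<prec> U \<longrightarrow> L j x \<longrightarrow> \<not> in_column m x \<longrightarrow> (sbit w x \<longleftrightarrow> sbit z x)"
        "\<forall>i. i \<preceq> j \<longrightarrow> (\<forall>\<psi>. \<psi> \<prec> c \<longrightarrow> (sbit s (i \<otimes> c \<oplus> \<psi>) \<longleftrightarrow> true_code U \<psi> i w))"
      unfolding true_at_quant by blast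
    have nU: "n \<prec> U" using L_less[OF U(1) j(2)] .
    have "Def (\<lambda>x. sbit w x)" by (intro Def_intros)
    from code_ex[OF this, of n] obtain t where t: "len t n" "\<And>x. x \<prec> n \<Longrightarrow> sbit t x \<longleftrightarrow> sbit w x" by blast
    have "N t n"
      unfolding N_def
    proof (intro conjI t(1) allI impI)
      fix x assume x: "x \<prec> n" "\<not> in_column m x"
      then have "x \<prec> U" "L j x" using nU j(2) L_down ord.less_imp_le ord.less_trans by blast+
      then show "sbit t x \<longleftrightarrow> x \<in> W" using x t(2) U(3,5) by blast
    next
      fix i \<psi> assume i: "i \<prec> c" "\<psi> \<prec> c" "\<not> L i n"
      have "i \<preceq> j" using i(3) j(2) L_mono ord.linear by blast
      then have "sbit s (i \<otimes> c \<oplus> \<psi>) \<longleftrightarrow> true_code U \<psi> i w" using U(6) i(2) by blast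
      moreover have "true_code n \<psi> i t \<longleftrightarrow> true_code U \<psi> i w"
        using true_code_inv[OF ord.less_imp_le[OF nU] i(3) ord.order_refl len_bound[OF t(1)] U(4)] t(2) L_less[OF i(3)] by blast
      ultimately show "true_code n \<psi> i t \<longleftrightarrow> sbit s (i \<otimes> c \<oplus> \<psi>)" by simp
    qed
    then show "\<exists>a\<in>T. n \<prec> a" using T_iff len_less[OF t(1)] by blast
  qed
  ultimately obtain P where P: "P \<in> X" "infinite_path M T P" using WKL \<open>T \<in> X\<close> unfolding WKL_def by blast
  have path: "\<exists>t. N t n \<and> (\<forall>i. i \<prec> n \<longrightarrow> (sbit t i \<longleftrightarrow> i \<in> P))" for n
  proof -
    obtain t where t: "t \<in> T" "len t n" "\<forall>i. i \<prec> n \<longrightarrow> (sbit t i \<longleftrightarrow> i \<in> P)"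
      using P(2) unfolding infinite_path_def by blast
    then obtain n' where "N t n'" using T_iff by blast
    then have "N t n" using t(2) len_unique unfolding N_def by metis
    then show ?thesis using t by blast
  qed
  have "x \<in> P \<longleftrightarrow> x \<in> W" if "\<not> in_column m x" for x
    using path[of "x \<oplus> \<one>"] that ord.less_add_one unfolding N_def by blast
  moreover have "sbit s (i \<otimes> c \<oplus> \<psi>) \<longleftrightarrow> true_at P \<psi> i" if i: "index i" "\<psi> \<prec> c" for i \<psi>
  proof -
    obtain U where U: "\<not> L i U" using i(1) unfolding index_def by blast
    obtain t where t: "N t U" "\<forall>x. x \<prec> U \<longrightarrow> (sbit t x \<longleftrightarrow> x \<in> P)" using path by blast
    have "len t U" using t(1) unfolding N_def by blast
    from true_at_iff[OF U len_bound[OF this]] have "true_at P \<psi> i \<longleftrightarrow> true_code U \<psi> i t"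
      using t(2) L_less[OF U] by simp
    also have "\<dots> \<longleftrightarrow> sbit s (i \<otimes> c \<oplus> \<psi>)"
      using t(1) U i(2) index_less[OF i(1) c] unfolding N_def by blast
    finally show ?thesis by blast
  qed
  ultimately show ?thesis using P(1) by blast
qed

end

locale two_models = X: levels M X L + Y: levels M Y L for M :: "'m arith" (structure) and X Y and L +
  assumes WKL_Y: "WKL M Y" and cofinal: "\<exists>i. X.index i \<and> L i x"
begin

text \<open>The set \<open>Z'\<close> itself shows that the formula for its code \<open>s\<close> is
  true of \<open>Z\<close> at every bounded level. The last hypothesis puts that formula below
  \<open>b\<close>, so it is true of \<open>W\<close> too, and \<open>realise_path\<close> applies
  in \<open>(M, Y)\<close>.\<close>

lemma extend:
  assumes Z: "Z \<in> X" and W: "W \<in> Y" and eq: "X.agree_below b Z W" and Z': "Z' \<in> X"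
    and in_column: "\<And>x. \<not> X.in_column m x \<Longrightarrow> x \<in> Z' \<longleftrightarrow> x \<in> Z" and c: "\<forall>x. L c x"
    and b: "X.pair \<zero> (X.pair m (X.pair c (X.two_pow (c \<otimes> c \<oplus> \<one>)))) \<prec> b"
  shows "\<exists>W'\<in>Y. X.agree_below c Z' W' \<and> (\<forall>x. \<not> X.in_column m x \<longrightarrow> (x \<in> W' \<longleftrightarrow> x \<in> W))"
proof -
  obtain s where s: "s \<preceq> X.two_pow (c \<otimes> c \<oplus> \<one>)"
    "\<And>i \<psi>. X.index i \<Longrightarrow> \<psi> \<prec> c \<Longrightarrow> string_bit M s (i \<otimes> c \<oplus> \<psi>) \<longleftrightarrow> X.true_at Z' \<psi> i"
    using X.type_code[OF Z' c] by blast
  let ?\<phi> = "X.pair \<zero> (X.pair m (X.pair c s))"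
  have "?\<phi> \<preceq> X.pair \<zero> (X.pair m (X.pair c (X.two_pow (c \<otimes> c \<oplus> \<one>))))"
    by (intro X.pair_mono X.ord.order_refl s)
  then have \<phi>: "?\<phi> \<prec> b" using b by (rule X.ord.le_less_trans)
  have "X.true_at W ?\<phi> j" if j: "X.index j" for j
  proof -
    obtain U where U: "\<not> L j U" using j unfolding X.index_def by blast
    obtain z where z: "string_length M z U" "\<forall>x. x \<prec> U \<longrightarrow> (string_bit M z x \<longleftrightarrow> x \<in> Z)"
      using X.code_set[OF Z] by blast
    obtain w where w: "string_length M w U" "\<forall>x. x \<prec> U \<longrightarrow> (string_bit M w x \<longleftrightarrow> x \<in> Z')"
      using X.code_set[OF Z'] by blast
    have LU: "L j x \<Longrightarrow> x \<prec> U" for x by (rule X.L_less[OF U])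
    have "string_bit M s (i \<otimes> c \<oplus> \<psi>) \<longleftrightarrow> X.true_code U \<psi> i w" if i: "i \<preceq> j" "\<psi> \<prec> c" for i \<psi>
    proof -
      have "\<not> L i U" using U i(1) X.L_mono by blast
      then have "X.index i" "X.true_at Z' \<psi> i \<longleftrightarrow> X.true_code U \<psi> i w"
        using X.true_at_iff[of i U w Z' \<psi>] X.len_bound[OF w(1)] w(2) X.L_less[of i U] unfolding X.index_def by blast+
      then show ?thesis using s(2) i(2) by blast
    qed
    then have "X.true_at Z ?\<phi> j"
      unfolding X.true_at_quant using U X.len_bound[OF w(1)] X.len_bound[OF z(1)] w(2) z(2) LU in_column by blast
    then show ?thesis using eq \<phi> j unfolding X.agree_below_def by blast
  qed
  \<comment> \<open>Truth, indices and columns are defined from \<open>M\<close> and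
    \<open>L\<close> alone, so the facts obtained in \<open>(M, X)\<close> can be used in
    \<open>(M, Y)\<close> as they stand.\<close>
  from Y.realise_path[OF WKL_Y cofinal W c this] obtain W' where
    "W' \<in> Y" "\<forall>x. \<not> X.in_column m x \<longrightarrow> (x \<in> W' \<longleftrightarrow> x \<in> W)"
    "\<forall>i \<psi>. X.index i \<longrightarrow> \<psi> \<prec> c \<longrightarrow> (string_bit M s (i \<otimes> c \<oplus> \<psi>) \<longleftrightarrow> X.true_at W' \<psi> i)"
    by blast
  then show ?thesis using s(2) unfolding X.agree_below_def by blast
qed

end

section \<open>A cofinal sequence of levels indexed by a proper cut\<close>

context pa_minus
begin

text \<open>At levels below \<open>x\<close>, the truth table of the formulas below \<open>x\<close> has at most \<open>x\<^sup>2\<close> entries.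
  The pairs around it bound the formula with tag \<open>0\<close> that contains this table.\<close>

definition growth :: "'m \<Rightarrow> 'm" where
  "growth x = pair x (pair x (pair x (two_pow (x \<otimes> x \<oplus> \<one>)))) \<oplus> \<one>"

lemma less_growth: "x \<prec> growth x"
  unfolding growth_def lt_suc by (rule pair_ge1)

abbreviation num :: "nat \<Rightarrow> 'm" where
  "num n \<equiv> ord.of_nat n"

lemma num_less: "v \<prec> num n \<Longrightarrow> \<exists>m<n. v = num m"
proof (induction n)
  case 0
  then show ?case using not_lt_zero by simp
next
  case (Suc n)
  then have "v \<prec> num n \<or> v = num n" by (simp add: lt_suc add_comm[of \<one>] le_def)
  then show ?case using Suc.IH less_Suc_eq by auto
qed

text \<open>\<open>\<tau>\<close> contains the graph of \<open>j \<mapsto> growth\<^sup>j c\<close> for \<open>j \<le> i\<close>, all of it bounded by \<open>x\<close>.\<close>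

definition iter_below :: "'m \<Rightarrow> 'm \<Rightarrow> 'm \<Rightarrow> bool" where
  "iter_below c i x \<longleftrightarrow> c \<preceq> x \<and> (\<exists>\<tau>. \<tau> \<prec> two_pow (pair i x \<oplus> \<one> \<oplus> \<one>) \<and> string_bit M \<tau> (pair \<zero> c) \<and>
    (\<forall>j. j \<prec> i \<longrightarrow> (\<forall>y. y \<preceq> x \<longrightarrow> string_bit M \<tau> (pair j y) \<longrightarrow>
      growth y \<preceq> x \<and> string_bit M \<tau> (pair (j \<oplus> \<one>) (growth y)))))"

end

section \<open>Iterates of \<open>growth\<close> along standard and nonstandard counts\<close>

context rca
begin

lemma Fun_growth [Def_intros]: "Fun f \<Longrightarrow> Fun (\<lambda>x. growth (f x))"
  unfolding growth_def by (intro Def_intros)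

lemma Def_iter_below: "Def (\<lambda>z. iter_below c (proj1 z) (proj2 z))"
  unfolding iter_below_def by (intro Def_intros)

lemma growth_mono: "x \<preceq> y \<Longrightarrow> growth x \<preceq> growth y"
  unfolding growth_def by (intro ord.add_right_mono pair_mono two_pow_mono ord.mult_mono) auto

lemma two_pow_num: "two_pow (num n) = num (2 ^ n)"
  by (induction n) (simp_all add: add_comm[of \<one>] ord.mult_2)

lemma pair_num: "\<exists>k. pair (num m) (num n) = num k"
  unfolding pair_def by (metis ord.of_nat_add ord.of_nat_mult)

lemma growth_num: "\<exists>k. growth (num n) = num k"
proof -
  have "\<exists>k. two_pow (num n \<otimes> num n \<oplus> \<one>) = num k"
    by (metis two_pow_num ord.of_nat_add ord.of_nat_mult ord.of_nat_1)
  then show ?thesis unfolding growth_def using pair_num by (metis ord.of_nat_add ord.of_nat_1)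
qed

text \<open>External induction on the steps up to \<open>n\<close> suffices, while \<open>i\<close>
  may be nonstandard: a table of nonstandard length bounds every standard iterate.\<close>

lemma iter_below_le: 
  assumes "iter_below c i x" "num n \<preceq> i" shows "(growth ^^ n) c \<preceq> x"
proof -
  obtain \<tau> where \<tau>: "c \<preceq> x" "sbit \<tau> (pair \<zero> c)"
    "\<And>j y. j \<prec> i \<Longrightarrow> y \<preceq> x \<Longrightarrow> sbit \<tau> (pair j y) \<Longrightarrow> growth y \<preceq> x \<and> sbit \<tau> (pair (j \<oplus> \<one>) (growth y))"
    using assms(1) unfolding iter_below_def by blast
  have "m \<le> n \<Longrightarrow> (growth ^^ m) c \<preceq> x \<and> sbit \<tau> (pair (num m) ((growth ^^ m) c))" for m
  proof (induction m)
    case (Suc m)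
    then have "num m \<prec> num n" by (simp only: ord.of_nat_less_iff Suc_le_eq)
    then have "num m \<prec> i" using assms(2) by order
    then show ?case using \<tau>(3)[of "num m" "(growth ^^ m) c"] Suc by (simp add: add_comm[of \<one>])
  qed (use \<tau> in simp)
  then show ?thesis by blast
qed

lemma iter_below_num: "iter_below c (num n) x \<longleftrightarrow> (growth ^^ n) c \<preceq> x"
proof
  show "iter_below c (num n) x \<Longrightarrow> (growth ^^ n) c \<preceq> x" using iter_below_le by simp
next
  assume x: "(growth ^^ n) c \<preceq> x"
  have inc: "(growth ^^ m) c \<preceq> (growth ^^ (m + k)) c" for m k
    by (induction k) (auto intro: ord.order_trans ord.less_imp_le[OF less_growth])
  have le: "(growth ^^ m) c \<preceq> x" if "m \<le> n" for m
    using inc[of m "n - m"] x that ord.order_trans by simp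
  \<comment> \<open>A finite disjunction over an actual natural number, hence definable by external
    induction; no recursion inside \<open>M\<close> is needed.\<close>
  let ?P = "\<lambda>n z. \<exists>m\<le>n. z = pair (num m) ((growth ^^ m) c)"
  have "Def (?P n)" for n
  proof (induction n)
    case 0
    then show ?case by simp (intro Def_intros)
  next
    case (Suc n)
    have "Def (\<lambda>z. ?P n z \<or> z = pair (num (Suc n)) ((growth ^^ (Suc n)) c))" using Suc by (intro Def_intros)
    then show ?case by (rule Def_cong) (auto simp only: le_Suc_eq)
  qed
  from code_ex[OF this, of "pair (num n) x \<oplus> \<one>" n] obtain \<tau> where \<tau>: "len \<tau> (pair (num n) x \<oplus> \<one>)"
    "\<And>z. z \<prec> pair (num n) x \<oplus> \<one> \<Longrightarrow> sbit \<tau> z \<longleftrightarrow> ?P n z" by blast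
  have b: "sbit \<tau> (pair (num m) ((growth ^^ m) c))" if "m \<le> n" for m
  proof -
    have "pair (num m) ((growth ^^ m) c) \<preceq> pair (num n) x" using le[OF that] that by (intro pair_mono) simp_all
    then show ?thesis using \<tau>(2) that unfolding lt_suc by blast
  qed
  show "iter_below c (num n) x"
    unfolding iter_below_def
  proof (intro conjI exI[of _ \<tau>] allI impI)
    show "c \<preceq> x" using le[of 0] by simp
    show "\<tau> \<prec> two_pow (pair (num n) x \<oplus> \<one> \<oplus> \<one>)" using len_bound[OF \<tau>(1)] .
    show "sbit \<tau> (pair \<zero> c)" using b[of 0] by simp
    fix j y assume a: "j \<prec> num n" "y \<preceq> x" "sbit \<tau> (pair j y)"
    obtain k where k: "k < n" "j = num k" using num_less[OF a(1)] by blast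
    have "?P n (pair j y)" using \<tau>(2) a(3) bit_less[OF a(3) \<tau>(1)] by blast
    then have y: "y = (growth ^^ k) c" using k by auto
    show "growth y \<preceq> x" using le[of "Suc k"] k y by simp
    show "sbit \<tau> (pair (j \<oplus> \<one>) (growth y))" using b[of "Suc k"] k y by (simp add: add_comm[of \<one>])
  qed
qed

text \<open>A table for a nonstandard number of steps would bound all standard iterates by
  \<open>x\<close>, against their cofinality.\<close>

lemma iter_below_standard:
  assumes "iter_below c i x" "\<And>b. \<exists>n. b \<prec> (growth ^^ n) c" shows "\<exists>n. i = num n"
proof -
  obtain n where n: "x \<prec> (growth ^^ n) c" using assms(2) by blast
  have "\<not> num n \<preceq> i" using iter_below_le[OF assms(1)] n ord.not_le by blast
  then have "i \<prec> num n" by simp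
  then show ?thesis using num_less by blast
qed

text \<open>Variables are interpreted by definable functions of \<open>x\<close> rather than by
  elements. Under a quantifier the assignment then becomes one on the pair of \<open>x\<close> and
  the quantified element, and the induction on formulas goes through.\<close>

lemma Def_sat_delta00:
  assumes "delta00 \<phi>" "range E \<subseteq> X" "\<And>n. Fun (e n)"
  shows "Def (\<lambda>x. sat M (\<lambda>n. e n x) E \<phi>)"
proof -
  have t: "Fun (\<lambda>x. tm_val M (\<lambda>n. e n x) t)" if "\<And>n. Fun (e n)" for t and e :: "nat \<Rightarrow> 'm \<Rightarrow> 'm"
    by (induction t) (simp_all add: that Fun_add Fun_mul Fun_const)
  have u: "(\<lambda>n. e n x)(v := y) = (\<lambda>n. ((\<lambda>n. e n \<circ> proj1)(v := proj2)) n (pair x y))" for e :: "nat \<Rightarrow> 'm \<Rightarrow> 'm" and v x y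
    by auto
  have q: "Def (\<lambda>z. sat M ((\<lambda>n. e n (proj1 z))(v := proj2 z)) E \<phi>)"
    if IH: "\<And>e :: nat \<Rightarrow> 'm \<Rightarrow> 'm. (\<And>n. Fun (e n)) \<Longrightarrow> Def (\<lambda>x. sat M (\<lambda>n. e n x) E \<phi>)" and e: "\<And>n. Fun (e n)"
    for e :: "nat \<Rightarrow> 'm \<Rightarrow> 'm" and v \<phi>
  proof -
    have *: "(\<lambda>n. e n (proj1 z))(v := proj2 z) = (\<lambda>n. (if n = v then proj2 z else e n (proj1 z)))" for z
      by auto
    have "Fun (\<lambda>z. if n = v then proj2 z else e n (proj1 z))" for n
      using Fun_comp[OF e Fun_proj1'] Fun_proj2' by (cases "n = v") simp_all
    from IH[OF this] show ?thesis unfolding * .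
  qed
  have tv: "tm_val M (e(v := a)) t = tm_val M e t" if "v \<notin> tm_vars t" for e v a t
    using that by (induction t) auto
  show ?thesis using assms(1,3)
  proof (induction arbitrary: e)
    case (3 t n)
    have "E n \<in> X" using assms(2) by blast
    from Def_subst[OF Def_set[OF this] t[OF 3]] show ?case by simp
  next
    case (8 \<phi> v t)
    show ?case using Def_bex[of "\<lambda>x y. sat M ((\<lambda>n. e n x)(v := y)) E \<phi>" "\<lambda>x. tm_val M (\<lambda>n. e n x) t", OF q[of \<phi> e v, OF "8.IH" "8.prems"] t[OF "8.prems"]] "8.hyps" by (simp add: tv)
  next
    case (9 \<phi> v t)
    show ?case using Def_ball[of "\<lambda>x y. sat M ((\<lambda>n. e n x)(v := y)) E \<phi>" "\<lambda>x. tm_val M (\<lambda>n. e n x) t", OF q[of \<phi> e v, OF "9.IH" "9.prems"] t[OF "9.prems"]] "9.hyps" by (simp add: tv)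
  qed (auto intro!: Def_intros t)
qed

end

locale two_rca = X: rca M X + Y: rca M Y for M :: "'m arith" (structure) and X Y
begin

text \<open>Leading existential quantifiers are merged into one by pairing. Parameters in the
  intersection make the same matrix \<open>\<theta>\<close> definable in both models, and this gives
  both of them the same levels.\<close>

lemma sigma01_matrix:
  assumes "sigma01 \<phi>" "range E \<subseteq> X \<inter> Y" "\<And>n. X.Fun (e n) \<and> Y.Fun (e n)"
  shows "\<exists>\<theta>. X.Def (\<lambda>z. \<theta> (X.proj1 z) (X.proj2 z)) \<and> Y.Def (\<lambda>z. \<theta> (X.proj1 z) (X.proj2 z)) \<and>
    (\<forall>x. sat M (\<lambda>n. e n x) E \<phi> \<longleftrightarrow> (\<exists>y. \<theta> x y))"
  using assms(1,3)
proof (induction arbitrary: e)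
  case (1 \<phi>)
  have "X.Def (\<lambda>z. sat M (\<lambda>n. e n z) E \<phi>)" "Y.Def (\<lambda>z. sat M (\<lambda>n. e n z) E \<phi>)"
    using 1 assms(2) by (auto intro!: X.Def_sat_delta00 Y.Def_sat_delta00)
  then have "X.Def (\<lambda>z. sat M (\<lambda>n. e n (X.proj1 z)) E \<phi>)" "Y.Def (\<lambda>z. sat M (\<lambda>n. e n (X.proj1 z)) E \<phi>)"
    using X.Def_subst[OF _ X.Fun_proj1'] Y.Def_subst[OF _ Y.Fun_proj1'] by blast+
  then show ?case by (intro exI[of _ "\<lambda>x y. sat M (\<lambda>n. e n x) E \<phi>"]) simp
next
  case (2 \<phi> v)
  have *: "(\<lambda>n. e n x)(v := a) = (\<lambda>n. (if n = v then X.proj2 (X.pair x a) else e n (X.proj1 (X.pair x a))))" for x a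
    by auto
  have "X.Fun (\<lambda>z. if n = v then X.proj2 z else e n (X.proj1 z)) \<and> Y.Fun (\<lambda>z. if n = v then X.proj2 z else e n (X.proj1 z))" for n
    using 2(3)[of n] X.Fun_comp[OF _ X.Fun_proj1', of "e n"] Y.Fun_comp[OF _ Y.Fun_proj1', of "e n"] X.Fun_proj2' Y.Fun_proj2' by (cases "n = v") simp_all
  from "2.IH"[of "\<lambda>n z. if n = v then X.proj2 z else e n (X.proj1 z)", OF this] obtain \<theta> where \<theta>: "X.Def (\<lambda>z. \<theta> (X.proj1 z) (X.proj2 z))" "Y.Def (\<lambda>z. \<theta> (X.proj1 z) (X.proj2 z))"
    "\<And>x. sat M (\<lambda>n. if n = v then X.proj2 x else e n (X.proj1 x)) E \<phi> \<longleftrightarrow> (\<exists>y. \<theta> x y)" by blast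
  let ?\<eta> = "\<lambda>x u. \<theta> (X.pair x (X.proj1 u)) (X.proj2 u)"
  have "X.Def (\<lambda>z. ?\<eta> (X.proj1 z) (X.proj2 z))" by (intro X.Def_rel[OF \<theta>(1)] X.Def_intros)
  moreover have "Y.Def (\<lambda>z. ?\<eta> (X.proj1 z) (X.proj2 z))" by (intro Y.Def_rel[OF \<theta>(2)] Y.Def_intros)
  moreover have "sat M (\<lambda>n. e n x) E (Ex v \<phi>) \<longleftrightarrow> (\<exists>u. ?\<eta> x u)" for x
    unfolding sat.simps * \<theta>(3) by (metis X.proj1_pair X.proj2_pair)
  ultimately show ?case by (intro exI[of _ ?\<eta>]) simp
qed

text \<open>Let \<open>c\<close> be a counterexample to some instance of \<open>\<Sigma>\<^sup>0\<^sub>1\<close> induction. If the iterates of \<open>growth\<close>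
  at \<open>c\<close> are bounded, they generate \<open>I\<close>, and the levels are the least bounds for the witnesses of the
  failing formula. Otherwise these iterates are themselves cofinal levels, indexed by \<open>I = \<omega>\<close>.\<close>

lemma levels_exist:
  assumes "\<not> sigma01_induction M (X \<inter> Y)"
  obtains L I where "X.Def (\<lambda>z. L (X.proj1 z) (X.proj2 z))" "Y.Def (\<lambda>z. L (X.proj1 z) (X.proj2 z))"
    "\<And>i j x. i \<preceq> j \<Longrightarrow> L i x \<Longrightarrow> L j x" "\<And>i x y. x \<preceq> y \<Longrightarrow> L i y \<Longrightarrow> L i x"
    "\<And>x. \<exists>i u. \<not> L i u \<and> L i x" "\<And>i u. \<not> L i u \<Longrightarrow> I i"
    "I \<zero>" "\<And>v. I v \<Longrightarrow> I (X.growth v)" "\<And>v w. v \<preceq> w \<Longrightarrow> I w \<Longrightarrow> I v" "\<exists>b. \<not> I b"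
proof -
  obtain \<phi> v e E where \<phi>: "sigma01 \<phi>" "range E \<subseteq> X \<inter> Y" 
    and ni: "\<not> induction_holds M (\<lambda>a. sat M (e(v := a)) E \<phi>)"
    using assms unfolding sigma01_induction_def by blast
  have *: "(e(v := a)) = (\<lambda>n. if n = v then a else e n)" for a by auto
  have "X.Fun (\<lambda>a. if n = v then a else e n) \<and> Y.Fun (\<lambda>a. if n = v then a else e n)" for n
    using X.Fun_id X.Fun_const Y.Fun_id Y.Fun_const by (cases "n = v") simp_all
  from sigma01_matrix[where e = "\<lambda>n a. if n = v then a else e n", OF \<phi> this] obtain \<theta> where t: "X.Def (\<lambda>z. \<theta> (X.proj1 z) (X.proj2 z)) \<and>
    Y.Def (\<lambda>z. \<theta> (X.proj1 z) (X.proj2 z)) \<and> (\<forall>a. sat M (\<lambda>n. if n = v then a else e n) E \<phi> \<longleftrightarrow> (\<exists>y. \<theta> a y))"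
    by (elim exE)
  then have \<theta>: "X.Def (\<lambda>z. \<theta> (X.proj1 z) (X.proj2 z))" "Y.Def (\<lambda>z. \<theta> (X.proj1 z) (X.proj2 z))"
    "\<And>a. sat M (e(v := a)) E \<phi> \<longleftrightarrow> (\<exists>y. \<theta> a y)" by (simp_all add: *)
  define P where "P a \<longleftrightarrow> (\<exists>y. \<theta> a y)" for a
  obtain c where P: "P \<zero>" "\<And>a. P a \<Longrightarrow> P (a \<oplus> \<one>)" "\<not> P c"
    using ni unfolding induction_holds_def \<theta>(3) P_def by blast
  show ?thesis
  proof (cases "\<exists>b. \<forall>n. (X.growth ^^ n) c \<preceq> b")
    case True
    \<comment> \<open>\<open>x\<close> bounds witnesses of \<open>P k\<close> for every
      \<open>k \<preceq> i\<close>; the points below level \<open>i\<close> will be those for which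
      this fails.\<close>
    define T where "T i x \<longleftrightarrow> (\<forall>k. k \<preceq> i \<longrightarrow> (\<exists>y. y \<preceq> x \<and> \<theta> k y))" for i x
    define I where "I v \<longleftrightarrow> (\<exists>n. v \<preceq> (X.growth ^^ n) c)" for v
    have T_mono: "T j x \<Longrightarrow> i \<preceq> j \<Longrightarrow> T i x" "T i x \<Longrightarrow> x \<preceq> y \<Longrightarrow> T i y" for i j x y
      unfolding T_def by (meson X.ord.order_trans)+
    have DX: "X.Def (\<lambda>z. T (X.proj1 z) (X.proj2 z))" unfolding T_def by (intro X.Def_intros X.Def_rel[OF \<theta>(1)])
    have DY: "Y.Def (\<lambda>z. T (X.proj1 z) (X.proj2 z))" unfolding T_def by (intro Y.Def_intros Y.Def_rel[OF \<theta>(2)])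
    have TP: "T i x \<Longrightarrow> P i" for i x unfolding T_def P_def by blast
    have T0: "\<exists>x. T \<zero> x"
    proof -
      obtain y where "\<theta> \<zero> y" using P(1) P_def by blast
      then have "T \<zero> y" unfolding T_def using X.not_lt_zero unfolding le_def by blast
      then show ?thesis ..
    qed
    have TS: "\<exists>x. T (i \<oplus> \<one>) x" if t: "T i x" for i x
    proof -
      obtain y where y: "\<theta> (i \<oplus> \<one>) y" using P(2)[OF TP[OF t]] P_def by blast
      have "T i (x \<oplus> y)" using T_mono(2)[OF t] X.le_add1 by blast
      moreover have "k \<preceq> i \<or> k = i \<oplus> \<one>" if "k \<preceq> i \<oplus> \<one>" for k
        using that X.lt_suc unfolding le_def by blast
      ultimately have "T (i \<oplus> \<one>) (x \<oplus> y)" unfolding T_def using y X.le_add2 by blast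
      then show ?thesis ..
    qed
    \<comment> \<open>If no level exceeded \<open>x\<close>, every bounded level would be bounded by
      \<open>x\<close> already, so \<open>T i x\<close> would be inductive in \<open>i\<close> and
      reach \<open>c\<close>, where \<open>P\<close> fails.\<close>
    have cof: "\<exists>i u. T i u \<and> \<not> T i x" for x
    proof (rule ccontr)
      assume no: "\<not> ?thesis"
      have "T c x"
      proof (rule X.Def_induct[where P = "\<lambda>i. T i x"])
        show "X.Def (\<lambda>i. T i x)" by (intro X.Def_rel[OF DX] X.Def_intros)
      qed (use no T0 TS in blast)+
      then show False using TP P(3) by blast
    qed
    have TI: "I i" if "T i u" for i u
    proof -
      have "i \<prec> c" using T_mono(1)[OF that, of c] TP P(3) X.ord.not_le by blast
      then show ?thesis unfolding I_def by (intro exI[of _ 0]) (simp add: le_def)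
    qed
    have IG: "I (X.growth v)" if v: "I v" for v
    proof -
      obtain n where "v \<preceq> (X.growth ^^ n) c" using v unfolding I_def by blast
      then have "X.growth v \<preceq> (X.growth ^^ Suc n) c" unfolding funpow.simps comp_apply by (rule X.growth_mono)
      then show ?thesis unfolding I_def by (rule exI)
    qed
    have Ib: "\<exists>b. \<not> I b"
    proof -
      obtain b where b: "\<And>n. (X.growth ^^ n) c \<preceq> b" using True by blast
      have "\<not> b \<oplus> \<one> \<preceq> (X.growth ^^ n) c" for n using b[of n] unfolding X.suc_le by simp
      then have "\<not> I (b \<oplus> \<one>)" unfolding I_def by blast
      then show ?thesis ..
    qed
    show ?thesis
    proof (rule that[of "\<lambda>i x. \<not> T i x" I])
      show "X.Def (\<lambda>z. \<not> T (X.proj1 z) (X.proj2 z))" using DX by (rule X.Def_not)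
      show "Y.Def (\<lambda>z. \<not> T (X.proj1 z) (X.proj2 z))" using DY by (rule Y.Def_not)
      show "I \<zero>" unfolding I_def by simp
      show "v \<preceq> w \<Longrightarrow> I w \<Longrightarrow> I v" for v w unfolding I_def using X.ord.order_trans by blast
      show "\<exists>i u. \<not> \<not> T i u \<and> \<not> T i x" for x using cof by blast
      show "i \<preceq> j \<Longrightarrow> \<not> T i x \<Longrightarrow> \<not> T j x" for i j x using T_mono(1) by blast
      show "x \<preceq> y \<Longrightarrow> \<not> T i y \<Longrightarrow> \<not> T i x" for i x y using T_mono(2) by blast
      show "\<not> \<not> T i u \<Longrightarrow> I i" for i u using TI by blast
      show "I v \<Longrightarrow> I (X.growth v)" for v using IG by blast
      show "\<exists>b. \<not> I b" by (rule Ib)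
    qed
  next
    case False
    then have unb: "\<exists>n. b \<prec> (X.growth ^^ n) c" for b using X.ord.not_le by blast
    define I where "I v \<longleftrightarrow> (\<exists>n. v = X.num n)" for v
    let ?T = "X.iter_below c"
    have std: "?T i x \<longleftrightarrow> (\<exists>n. i = X.num n \<and> (X.growth ^^ n) c \<preceq> x)" for i x
      using X.iter_below_standard[of c i x] unb X.iter_below_num by blast
    have I_down: "I v" if "v \<preceq> w" "I w" for v w
      using that X.num_less unfolding I_def le_def by blast
    have T_mono: "?T i x" if T: "?T j x" and ij: "i \<preceq> j" for i j x
    proof -
      have "I j" using T unfolding std I_def by blast
      then obtain m where m: "i = X.num m" using I_down[OF ij] unfolding I_def by blast
      then show ?thesis using X.iter_below_le[OF T, of m] ij X.iter_below_num by simp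
    qed
    have Pn: "P (X.num n)" for n
      by (induction n) (use P in \<open>simp_all add: X.add_comm[of \<one>]\<close>)
    have IG: "I (X.growth v)" if "I v" for v using that X.growth_num unfolding I_def by blast
    show ?thesis
    proof (rule that[of "\<lambda>i x. \<not> ?T i x" I])
      show "X.Def (\<lambda>z. \<not> ?T (X.proj1 z) (X.proj2 z))" by (intro X.Def_not X.Def_iter_below)
      show "Y.Def (\<lambda>z. \<not> ?T (X.proj1 z) (X.proj2 z))" by (intro Y.Def_not Y.Def_iter_below)
      show "I \<zero>" unfolding I_def by (intro exI[of _ 0]) simp
      show "v \<preceq> w \<Longrightarrow> I w \<Longrightarrow> I v" for v w using I_down by blast
      show "I v \<Longrightarrow> I (X.growth v)" for v using IG by blast
      \<comment> \<open>All standard numbers satisfy \<open>P\<close> while \<open>c\<close> does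
        not, so \<open>c\<close> is nonstandard.\<close>
      show "\<exists>b. \<not> I b" using Pn P(3) unfolding I_def by metis
      show "\<not> \<not> ?T i u \<Longrightarrow> I i" for i u using std unfolding I_def by blast
      show "i \<preceq> j \<Longrightarrow> \<not> ?T i x \<Longrightarrow> \<not> ?T j x" for i j x using T_mono by blast
      show "x \<preceq> y \<Longrightarrow> \<not> ?T i y \<Longrightarrow> \<not> ?T i x" for i x y unfolding std using X.ord.order_trans by blast
      show "\<exists>i u. \<not> \<not> ?T i u \<and> \<not> ?T i x" for x
      proof -
        obtain n where "x \<prec> (X.growth ^^ n) c" using unb by blast
        then show "\<exists>i u. \<not> \<not> ?T i u \<and> \<not> ?T i x"
          by (intro exI[of _ "X.num n"] exI[of _ "(X.growth ^^ n) c"]) (simp add: X.iter_below_num)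
      qed
    qed
  qed
qed

end

section \<open>Back and forth\<close>

context pa_minus
begin

definition column :: "'m \<Rightarrow> 'm set \<Rightarrow> 'm set" where
  "column m Z = {y. pair m y \<in> Z}"

definition set_column :: "'m \<Rightarrow> 'm set \<Rightarrow> 'm set \<Rightarrow> 'm set" where
  "set_column m Z A = {x. (\<exists>y. x = pair m y) \<and> proj2 x \<in> A \<or> \<not> (\<exists>y. x = pair m y) \<and> x \<in> Z}"

lemma column_set_column: "column i (set_column m Z A) = (if i = m then A else column i Z)"
  unfolding column_def set_column_def by auto

end

context rca
begin

lemma singleton_in: "{c} \<in> X"
proof -
  have "Def (\<lambda>x. x = c)" by (intro Def_intros)
  then show ?thesis by (simp add: Def_def)
qed

lemma empty_in: "{} \<in> X"
  using Def_const[of False] by (simp add: Def_def)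

lemma set_column_in:
  assumes "Z \<in> X" "A \<in> X" shows "set_column m Z A \<in> X"
proof -
  have *: "(\<exists>y. x = pair m y) \<longleftrightarrow> (\<exists>y. y \<preceq> x \<and> x = pair m y)" for x using pair_ge2 by blast
  have "Def (\<lambda>x. (\<exists>y. x = pair m y) \<and> proj2 x \<in> A \<or> \<not> (\<exists>y. x = pair m y) \<and> x \<in> Z)"
    unfolding * by (intro Def_intros Def_subst[OF Def_set[OF assms(2)]] Def_set[OF assms(1)])
  then show ?thesis unfolding Def_def set_column_def .
qed

lemma column_in:
  assumes "Z \<in> X" shows "column m Z \<in> X"
proof -
  have "Def (\<lambda>y. pair m y \<in> Z)" by (intro Def_intros Def_subst[OF Def_set[OF assms]])
  then show ?thesis unfolding Def_def column_def .
qed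

end

context levels
begin

lemma true_at_atomic:
  assumes "Z \<in> X" "index k" "proj1 \<phi> \<noteq> \<zero>" shows "true_at Z \<phi> k \<longleftrightarrow> atomic \<phi> k (\<lambda>x. x \<in> Z)"
proof -
  obtain U where U: "\<not> L k U" using assms(2) unfolding index_def by blast
  obtain z where z: "len z U" "\<And>x. x \<prec> U \<Longrightarrow> sbit z x \<longleftrightarrow> x \<in> Z"
    using code_set[OF assms(1)] by blast
  have eq: "sbit z x \<longleftrightarrow> x \<in> Z" if "L k x" for x using z(2) L_less[OF U that] by blast
  have "true_at Z \<phi> k \<longleftrightarrow> true_code U \<phi> k z" using true_at_iff[OF U len_bound[OF z(1)] eq] .
  also have "\<dots> \<longleftrightarrow> atomic \<phi> k (sbit z)" unfolding true_code_rec[OF len_bound[OF z(1)]] clause_def using assms(3) by simp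
  also have "\<dots> \<longleftrightarrow> atomic \<phi> k (\<lambda>x. x \<in> Z)" by (rule atomic_cong) (rule eq)
  finally show ?thesis .
qed

lemma one_two_three: "\<one> \<noteq> \<zero>" "\<one> \<oplus> \<one> \<noteq> \<zero>" "\<one> \<oplus> \<one> \<oplus> \<one> \<noteq> \<zero>" "\<one> \<oplus> \<one> \<noteq> \<one>" "\<one> \<oplus> \<one> \<oplus> \<one> \<noteq> \<one>"
  "\<one> \<oplus> \<one> \<oplus> \<one> \<noteq> \<one> \<oplus> \<one>"
proof -
  have "\<zero> \<prec> \<one>" "\<one> \<prec> \<one> \<oplus> \<one>" "\<one> \<oplus> \<one> \<prec> \<one> \<oplus> \<one> \<oplus> \<one>" by (simp_all only: lt_suc ord.order_refl zero_lt_one)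
  then show "\<one> \<noteq> \<zero>" "\<one> \<oplus> \<one> \<noteq> \<zero>" "\<one> \<oplus> \<one> \<oplus> \<one> \<noteq> \<zero>" "\<one> \<oplus> \<one> \<noteq> \<one>" "\<one> \<oplus> \<one> \<oplus> \<one> \<noteq> \<one>"
  "\<one> \<oplus> \<one> \<oplus> \<one> \<noteq> \<one> \<oplus> \<one>" by order+
qed

text \<open>The levels are cofinal and closed downwards, so the finitely many points of a witness
  lie together below some bounded level.\<close>

lemma ex_atomic:
  assumes cof: "\<And>x. \<exists>i. index i \<and> L i x"
  shows "(\<exists>k. index k \<and> atomic (pair \<one> (pair i j)) k (\<lambda>x. x \<in> Z)) \<longleftrightarrow> \<not> column i Z \<subseteq> column j Z"
    and "(\<exists>k. index k \<and> atomic (pair (\<one> \<oplus> \<one>) (pair i (pair j l))) k (\<lambda>x. x \<in> Z)) \<longleftrightarrow>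
      (\<exists>x y. x \<in> column i Z \<and> y \<in> column j Z \<and> x \<oplus> y \<in> column l Z)"
    and "(\<exists>k. index k \<and> atomic (pair (\<one> \<oplus> \<one> \<oplus> \<one>) (pair i (pair j l))) k (\<lambda>x. x \<in> Z)) \<longleftrightarrow>
      (\<exists>x y. x \<in> column i Z \<and> y \<in> column j Z \<and> x \<otimes> y \<in> column l Z)"
proof -
  have big: "\<exists>k. index k \<and> L k a \<and> L k b \<and> L k c" for a b c
  proof -
    obtain k where "index k" "L k (a \<oplus> b \<oplus> c)" using cof by blast
    moreover have "a \<preceq> a \<oplus> b \<oplus> c" "b \<preceq> a \<oplus> b \<oplus> c" "c \<preceq> a \<oplus> b \<oplus> c"
      using le_add1 le_add2 ord.order_trans by metis+
    ultimately show ?thesis using L_down by blast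
  qed
  note s = atomic_def proj1_pair proj2_pair one_two_three one_two_three[symmetric] simp_thms column_def mem_Collect_eq subset_eq
  show "(\<exists>k. index k \<and> atomic (pair \<one> (pair i j)) k (\<lambda>x. x \<in> Z)) \<longleftrightarrow> \<not> column i Z \<subseteq> column j Z"
    by (simp only: s) (use big in blast)
  show "(\<exists>k. index k \<and> atomic (pair (\<one> \<oplus> \<one>) (pair i (pair j l))) k (\<lambda>x. x \<in> Z)) \<longleftrightarrow>
      (\<exists>x y. x \<in> column i Z \<and> y \<in> column j Z \<and> x \<oplus> y \<in> column l Z)"
    by (simp only: s) (use big in blast)
  show "(\<exists>k. index k \<and> atomic (pair (\<one> \<oplus> \<one> \<oplus> \<one>) (pair i (pair j l))) k (\<lambda>x. x \<in> Z)) \<longleftrightarrow>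
      (\<exists>x y. x \<in> column i Z \<and> y \<in> column j Z \<and> x \<otimes> y \<in> column l Z)"
    by (simp only: s) (use big in blast)
qed

end

text \<open>\<open>I\<close> contains all indices, so a number outside it exceeds the whole index
  cut; closure under \<open>growth\<close> is the room needed to shrink bounds again and again. Both
  orders of the two models are assumed, since sets have to be extended from either side.\<close>

locale back_forth = XY: two_models M X Y L + YX: two_models M Y X L
  for M :: "'m arith" (structure) and X Y L +
  fixes I :: "'m \<Rightarrow> bool"
  assumes index_I: "\<not> L i u \<Longrightarrow> I i"
    and I_zero: "I \<zero>"
    and I_growth: "I v \<Longrightarrow> I (XY.X.growth v)"
    and I_down: "v \<preceq> w \<Longrightarrow> I w \<Longrightarrow> I v"
    and I_proper: "\<exists>b. \<not> I b"
begin

definition Sim :: "'m set \<Rightarrow> 'm set \<Rightarrow> bool" where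
  "Sim Z W \<longleftrightarrow> (\<exists>b. \<not> I b \<and> XY.X.agree_below b Z W)"

lemma Sim_sym: "Sim Z W \<Longrightarrow> Sim W Z"
  unfolding Sim_def using XY.X.agree_below_sym by blast

lemma Sim_refl: "Sim Z Z"
  unfolding Sim_def using XY.X.agree_below_refl I_proper by blast

lemma I_pair: assumes "I x" "I y" shows "I (XY.X.pair x y)"
proof -
  have *: "I (XY.X.pair x y)" if "I v" "x \<preceq> v" "y \<preceq> v" for v x y
  proof -
    have "XY.X.pair x y \<preceq> XY.X.pair v v" using that by (intro XY.X.pair_mono)
    also have "\<dots> \<preceq> XY.X.pair v (XY.X.pair v (XY.X.pair v (XY.X.two_pow (v \<otimes> v \<oplus> \<one>))))"
      by (intro XY.X.pair_mono XY.X.ord.order_refl XY.X.pair_ge1)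
    also have "\<dots> \<preceq> XY.X.growth v" unfolding XY.X.growth_def by (rule XY.X.le_add1)
    finally show ?thesis using I_down I_growth that(1) by blast
  qed
  show ?thesis
    using *[OF assms(1), of x y] *[OF assms(2), of x y] XY.X.ord.linear[of x y] by auto
qed

lemma I_suc: "I v \<Longrightarrow> I (v \<oplus> \<one>)"
  using I_growth I_down XY.X.less_growth XY.X.suc_le by blast

lemma I_num: "I (XY.X.num n)"
  by (induction n) (simp_all add: I_zero I_suc XY.X.add_comm[of \<one>])

text \<open>The least \<open>c'\<close> with \<open>b \<preceq> growth c'\<close> is outside
  \<open>I\<close> because \<open>b\<close> is. So is its predecessor \<open>c\<close>, and
  \<open>growth c\<close> is below \<open>b\<close> by minimality. Since \<open>m\<close> is in
  \<open>I\<close>, it is at most \<open>c\<close>, and putting it for a component \<open>c\<close>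
  only lowers the pair.\<close>

lemma shrink:
  assumes "\<not> I b" "I m"
  shows "\<exists>c. \<not> I c \<and> XY.X.pair \<zero> (XY.X.pair m (XY.X.pair c (XY.X.two_pow (c \<otimes> c \<oplus> \<one>)))) \<prec> b"
proof -
  let ?P = "\<lambda>c. b \<preceq> XY.X.growth c"
  have "XY.X.Def ?P" by (intro XY.X.Def_intros)
  moreover have "?P b" using XY.X.less_growth by (rule XY.X.ord.less_imp_le)
  ultimately obtain c' where c': "?P c'" "\<And>c. c \<prec> c' \<Longrightarrow> \<not> ?P c" using XY.X.Def_least by blast
  have c'I: "\<not> I c'" using c'(1) I_growth I_down assms(1) by blast
  then have "c' \<noteq> \<zero>" using I_zero by blast
  then obtain c where c: "c' = c \<oplus> \<one>" using XY.X.nonzero_suc by blast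
  have cI: "\<not> I c" using c'I c I_suc by blast
  have "m \<preceq> c" using cI assms(2) I_down XY.X.ord.linear by blast
  then have "XY.X.pair \<zero> (XY.X.pair m (XY.X.pair c (XY.X.two_pow (c \<otimes> c \<oplus> \<one>)))) \<preceq>
      XY.X.pair c (XY.X.pair c (XY.X.pair c (XY.X.two_pow (c \<otimes> c \<oplus> \<one>))))"
    by (intro XY.X.pair_mono XY.X.ord.order_refl XY.X.zero_le)
  also have "\<dots> \<prec> XY.X.growth c" unfolding XY.X.growth_def by simp
  also have "\<dots> \<prec> b" using c'(2)[of c] c by simp
  finally show ?thesis using cI by blast
qed

lemma L_top: "\<not> I c \<Longrightarrow> \<forall>x. L c x"
  using index_I by blast

lemma in_column_set_column: "\<not> XY.X.in_column m x \<Longrightarrow> x \<in> XY.X.set_column m Z A \<longleftrightarrow> x \<in> Z"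
  unfolding XY.X.in_column_def XY.X.set_column_def by blast

lemma column_eq:
  assumes "\<forall>x. \<not> XY.X.in_column m x \<longrightarrow> (x \<in> W' \<longleftrightarrow> x \<in> W)" "i \<noteq> m" shows "XY.X.column i W' = XY.X.column i W"
  using assms unfolding XY.X.column_def XY.X.in_column_def by auto

lemma extend_left:
  assumes "Z \<in> X" "W \<in> Y" "Sim Z W" "I m" "A \<in> X"
  shows "\<exists>W'\<in>Y. Sim (XY.X.set_column m Z A) W' \<and> (\<forall>i. i \<noteq> m \<longrightarrow> XY.X.column i W' = XY.X.column i W)"
proof -
  obtain b where b: "\<not> I b" "XY.X.agree_below b Z W" using assms(3) Sim_def by blast
  obtain c where c: "\<not> I c" "XY.X.pair \<zero> (XY.X.pair m (XY.X.pair c (XY.X.two_pow (c \<otimes> c \<oplus> \<one>)))) \<prec> b"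
    using shrink[OF b(1) assms(4)] by blast
  obtain W' where "W' \<in> Y" "XY.X.agree_below c (XY.X.set_column m Z A) W'" "\<forall>x. \<not> XY.X.in_column m x \<longrightarrow> (x \<in> W' \<longleftrightarrow> x \<in> W)"
    using XY.extend[OF assms(1,2) b(2) XY.X.set_column_in[OF assms(1,5)] in_column_set_column L_top[OF c(1)] c(2)] by blast
  then show ?thesis using c(1) column_eq unfolding Sim_def by blast
qed

lemma extend_right:
  assumes "Z \<in> X" "W \<in> Y" "Sim Z W" "I m" "A \<in> Y"
  shows "\<exists>Z'\<in>X. Sim Z' (XY.X.set_column m W A) \<and> (\<forall>i. i \<noteq> m \<longrightarrow> XY.X.column i Z' = XY.X.column i Z)"
proof -
  obtain b where b: "\<not> I b" "XY.X.agree_below b W Z" using Sim_sym[OF assms(3)] Sim_def by blast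
  obtain c where c: "\<not> I c" "XY.X.pair \<zero> (XY.X.pair m (XY.X.pair c (XY.X.two_pow (c \<otimes> c \<oplus> \<one>)))) \<prec> b"
    using shrink[OF b(1) assms(4)] by blast
  have "\<exists>Z'\<in>X. XY.X.agree_below c (XY.X.set_column m W A) Z' \<and> (\<forall>x. \<not> XY.X.in_column m x \<longrightarrow> (x \<in> Z' \<longleftrightarrow> x \<in> Z))"
    by (rule YX.extend[OF assms(2,1) b(2) XY.Y.set_column_in[OF assms(2,5)] in_column_set_column L_top[OF c(1)] c(2)])
  then obtain Z' where Z': "Z' \<in> X" "XY.X.agree_below c (XY.X.set_column m W A) Z'" "\<forall>x. \<not> XY.X.in_column m x \<longrightarrow> (x \<in> Z' \<longleftrightarrow> x \<in> Z)"
    by blast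
  have "Sim Z' (XY.X.set_column m W A)" unfolding Sim_def using c(1) XY.X.agree_below_sym[OF Z'(2)] by blast
  then show ?thesis using Z'(1) column_eq[OF Z'(3)] by blast
qed

text \<open>A code in \<open>I\<close> is below any bound that witnesses \<open>Sim\<close>, and
  atomic truth at a bounded level speaks of the sets themselves.\<close>

lemma Sim_atomic:
  assumes "Z \<in> X" "W \<in> Y" "Sim Z W" "I \<phi>" "XY.X.proj1 \<phi> \<noteq> \<zero>"
  shows "(\<exists>k. XY.X.index k \<and> XY.X.atomic \<phi> k (\<lambda>x. x \<in> Z)) \<longleftrightarrow> (\<exists>k. XY.X.index k \<and> XY.X.atomic \<phi> k (\<lambda>x. x \<in> W))"
proof -
  obtain b where b: "\<not> I b" "XY.X.agree_below b Z W" using assms(3) Sim_def by blast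
  have "\<phi> \<prec> b" using b(1) assms(4) I_down XY.X.ord.not_le by blast
  then show ?thesis
    using b(2) XY.X.true_at_atomic[OF assms(1) _ assms(5)] XY.Y.true_at_atomic[OF assms(2) _ assms(5)]
    unfolding XY.X.agree_below_def by blast
qed

lemma Sim_column:
  assumes "Z \<in> X" "W \<in> Y" "Sim Z W" "I i" "I j" "I l"
  shows "XY.X.column i Z \<subseteq> XY.X.column j Z \<longleftrightarrow> XY.X.column i W \<subseteq> XY.X.column j W"
    and "(\<exists>x y. x \<in> XY.X.column i Z \<and> y \<in> XY.X.column j Z \<and> x \<oplus> y \<in> XY.X.column l Z) \<longleftrightarrow> 
      (\<exists>x y. x \<in> XY.X.column i W \<and> y \<in> XY.X.column j W \<and> x \<oplus> y \<in> XY.X.column l W)"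
    and "(\<exists>x y. x \<in> XY.X.column i Z \<and> y \<in> XY.X.column j Z \<and> x \<otimes> y \<in> XY.X.column l Z) \<longleftrightarrow> 
      (\<exists>x y. x \<in> XY.X.column i W \<and> y \<in> XY.X.column j W \<and> x \<otimes> y \<in> XY.X.column l W)"
proof -
  have o: "I \<one>" "I (\<one> \<oplus> \<one>)" "I (\<one> \<oplus> \<one> \<oplus> \<one>)"
    using I_suc[OF I_zero] I_suc by simp_all
  have p: "XY.X.proj1 (XY.X.pair \<one> x) \<noteq> \<zero>" "XY.X.proj1 (XY.X.pair (\<one> \<oplus> \<one>) x) \<noteq> \<zero>" "XY.X.proj1 (XY.X.pair (\<one> \<oplus> \<one> \<oplus> \<one>) x) \<noteq> \<zero>" for x
    unfolding XY.X.proj1_pair by (rule XY.X.one_two_three)+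
  note S = Sim_atomic[OF assms(1-3)]
  show "XY.X.column i Z \<subseteq> XY.X.column j Z \<longleftrightarrow> XY.X.column i W \<subseteq> XY.X.column j W"
    using S[OF I_pair[OF o(1) I_pair[OF assms(4,5)]] p(1)] unfolding XY.X.ex_atomic[OF XY.cofinal] by blast
  show "(\<exists>x y. x \<in> XY.X.column i Z \<and> y \<in> XY.X.column j Z \<and> x \<oplus> y \<in> XY.X.column l Z) \<longleftrightarrow> 
      (\<exists>x y. x \<in> XY.X.column i W \<and> y \<in> XY.X.column j W \<and> x \<oplus> y \<in> XY.X.column l W)"
    using S[OF I_pair[OF o(2) I_pair[OF assms(4) I_pair[OF assms(5,6)]]] p(2)] unfolding XY.X.ex_atomic[OF XY.cofinal] .
  show "(\<exists>x y. x \<in> XY.X.column i Z \<and> y \<in> XY.X.column j Z \<and> x \<otimes> y \<in> XY.X.column l Z) \<longleftrightarrow> 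
      (\<exists>x y. x \<in> XY.X.column i W \<and> y \<in> XY.X.column j W \<and> x \<otimes> y \<in> XY.X.column l W)"
    using S[OF I_pair[OF o(3) I_pair[OF assms(4) I_pair[OF assms(5,6)]]] p(3)] unfolding XY.X.ex_atomic[OF XY.cofinal] .
qed

section \<open>Starting pair and enumeration of both universes\<close>

lemma start_ex:
  assumes "set As \<subseteq> X \<inter> Y"
  shows "\<exists>Z\<in>X \<inter> Y. \<forall>i<length As. XY.X.column (XY.X.num i) Z = As ! i"
  using assms
proof (induction As rule: rev_induct)
  case Nil
  then show ?case using XY.X.empty_in XY.Y.empty_in by auto
next
  case (snoc A As)
  then obtain Z where Z: "Z \<in> X \<inter> Y" "\<forall>i<length As. XY.X.column (XY.X.num i) Z = As ! i" by auto
  let ?Z = "XY.X.set_column (XY.X.num (length As)) Z A"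
  have "?Z \<in> X \<inter> Y" using XY.X.set_column_in XY.Y.set_column_in Z(1) snoc.prems by simp
  moreover have "\<forall>i<length (As @ [A]). XY.X.column (XY.X.num i) ?Z = (As @ [A]) ! i"
    using Z(2) by (auto simp: XY.X.column_set_column nth_append less_Suc_eq)
  ultimately show ?case by blast
qed

text \<open>Step \<open>n\<close> writes column \<open>l + n\<close> on both sides and leaves the
  other columns alone, so every column is eventually constant. \<open>E\<close> and \<open>F\<close>
  list the limit columns: the parameters first, then members of \<open>X\<close> and members of
  \<open>Y\<close> alternately, each with its partner.\<close>

lemma sequence:
  assumes As: "set As \<subseteq> X \<inter> Y" and cX: "countable X" and cY: "countable Y"
  shows "\<exists>E F. range E = X \<and> range F = Y \<and> (\<forall>i<length As. E i = As ! i \<and> F i = As ! i) \<and>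
    (\<forall>i j. E i \<subseteq> E j \<longleftrightarrow> F i \<subseteq> F j) \<and>
    (\<forall>i j l. (\<exists>x y. x \<in> E i \<and> y \<in> E j \<and> x \<oplus> y \<in> E l) \<longleftrightarrow> (\<exists>x y. x \<in> F i \<and> y \<in> F j \<and> x \<oplus> y \<in> F l)) \<and>
    (\<forall>i j l. (\<exists>x y. x \<in> E i \<and> y \<in> E j \<and> x \<otimes> y \<in> E l) \<longleftrightarrow> (\<exists>x y. x \<in> F i \<and> y \<in> F j \<and> x \<otimes> y \<in> F l))"
proof -
  define l where "l = length As"
  obtain Z0 where Z0: "Z0 \<in> X" "Z0 \<in> Y" "\<And>i. i < l \<Longrightarrow> XY.X.column (XY.X.num i) Z0 = As ! i"
    using start_ex[OF As] unfolding l_def by blast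
  let ?c = "\<lambda>n. XY.X.column (XY.X.num n)"
  \<comment> \<open>The clause for \<open>n = 0\<close> starts from the same set on both sides,
    whose first \<open>l\<close> columns are the parameters.\<close>
  define P where "P n ZW \<longleftrightarrow> fst ZW \<in> X \<and> snd ZW \<in> Y \<and> Sim (fst ZW) (snd ZW) \<and> (n = 0 \<longrightarrow> ZW = (Z0, Z0))" for n :: nat and ZW
  define Q where "Q n ZW ZW' \<longleftrightarrow> (\<forall>m. m \<noteq> l + n \<longrightarrow> ?c m (fst ZW') = ?c m (fst ZW) \<and> ?c m (snd ZW') = ?c m (snd ZW)) \<and>
    (even n \<longrightarrow> ?c (l + n) (fst ZW') = from_nat_into X (n div 2)) \<and>
    (odd n \<longrightarrow> ?c (l + n) (snd ZW') = from_nat_into Y (n div 2))" for n ZW ZW'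
  have "\<exists>f. \<forall>n. P n (f n) \<and> Q n (f n) (f (Suc n))"
  proof (rule dependent_nat_choice)
    show "\<exists>x. P 0 x" unfolding P_def using Z0 Sim_refl by auto
    fix ZW n assume p: "P n ZW"
    obtain Z W where ZW: "ZW = (Z, W)" by fastforce
    have p': "Z \<in> X" "W \<in> Y" "Sim Z W" using p unfolding P_def ZW by auto
    show "\<exists>ZW'. P (Suc n) ZW' \<and> Q n ZW ZW'"
    proof (cases "even n")
      case True
      have A: "from_nat_into X (n div 2) \<in> X" using from_nat_into[OF XY.X.X_ne] .
      obtain W' where W': "W' \<in> Y" "Sim (XY.X.set_column (XY.X.num (l + n)) Z (from_nat_into X (n div 2))) W'"
        "\<And>i. i \<noteq> XY.X.num (l + n) \<Longrightarrow> XY.X.column i W' = XY.X.column i W"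
        using extend_left[OF p' I_num A] by blast
      show ?thesis
        by (rule exI[of _ "(XY.X.set_column (XY.X.num (l + n)) Z (from_nat_into X (n div 2)), W')"])
          (use W' True XY.X.set_column_in[OF p'(1) A] in \<open>simp add: P_def Q_def ZW XY.X.column_set_column del: XY.X.ord.of_nat_add\<close>)
    next
      case False
      have A: "from_nat_into Y (n div 2) \<in> Y" using from_nat_into[OF XY.Y.X_ne] .
      obtain Z' where Z': "Z' \<in> X" "Sim Z' (XY.X.set_column (XY.X.num (l + n)) W (from_nat_into Y (n div 2)))"
        "\<And>i. i \<noteq> XY.X.num (l + n) \<Longrightarrow> XY.X.column i Z' = XY.X.column i Z"
        using extend_right[OF p' I_num A] by blast
      show ?thesis
        by (rule exI[of _ "(Z', XY.X.set_column (XY.X.num (l + n)) W (from_nat_into Y (n div 2)))"])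
          (use Z' False XY.Y.set_column_in[OF p'(2) A] in \<open>simp add: P_def Q_def ZW XY.X.column_set_column del: XY.X.ord.of_nat_add\<close>)
    qed
  qed
  then obtain f where f: "\<And>n. P n (f n)" "\<And>n. Q n (f n) (f (Suc n))" by blast
  have f0: "f 0 = (Z0, Z0)" using f(1)[of 0] unfolding P_def by simp
  have stable: "?c n (fst (f (N + k))) = ?c n (fst (f N)) \<and> ?c n (snd (f (N + k))) = ?c n (snd (f N))" 
    if "n < l + N" for n N k
  proof (induction k)
    case (Suc k)
    have "n \<noteq> l + (N + k)" using that by simp
    then show ?case using f(2)[of "N + k"] Suc unfolding Q_def by simp
  qed simp
  \<comment> \<open>Column \<open>n\<close> is written no later than step \<open>n\<close>, so its
    value after that step is final.\<close>
  define E where "E n = ?c n (fst (f (Suc n)))" for n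
  define F where "F n = ?c n (snd (f (Suc n)))" for n
  have EF: "?c n (fst (f N)) = E n \<and> ?c n (snd (f N)) = F n" if "n < l + N" for n N
  proof (cases "N \<le> Suc n")
    case True
    then show ?thesis using stable[OF that, of "Suc n - N"] unfolding E_def F_def by simp
  next
    case False
    then show ?thesis using stable[of n "Suc n" "N - Suc n"] unfolding E_def F_def by simp
  qed
  have PX: "fst (f N) \<in> X" "snd (f N) \<in> Y" "Sim (fst (f N)) (snd (f N))" for N using f(1)[of N] unfolding P_def by auto
  have inX: "E n \<in> X" "F n \<in> Y" for n
    unfolding E_def F_def using XY.X.column_in XY.Y.column_in PX by blast+
  have "A \<in> range E" if A: "A \<in> X" for A
  proof -
    obtain k where k: "A = from_nat_into X k" using from_nat_into_surj[OF cX A] by metis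
    have "E (l + 2 * k) = from_nat_into X k"
      using EF[of "l + 2 * k" "Suc (2 * k)"] f(2)[of "2 * k"] unfolding Q_def by simp
    then show ?thesis using k by (metis rangeI)
  qed
  then have rE: "range E = X" using inX by blast
  have "A \<in> range F" if A: "A \<in> Y" for A
  proof -
    obtain k where k: "A = from_nat_into Y k" using from_nat_into_surj[OF cY A] by metis
    have "F (l + (2 * k + 1)) = from_nat_into Y k"
      using EF[of "l + (2 * k + 1)" "Suc (2 * k + 1)"] f(2)[of "2 * k + 1"] unfolding Q_def by simp
    then show ?thesis using k by (metis rangeI)
  qed
  then have rF: "range F = Y" using inX by blast
  have start: "E i = As ! i \<and> F i = As ! i" if "i < length As" for i
  proof -
    have "i < l + 0" using that l_def by simp
    from EF[OF this] have "?c i Z0 = E i \<and> ?c i Z0 = F i" unfolding f0 fst_conv snd_conv .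
    then show ?thesis using Z0(3)[of i] that unfolding l_def by metis
  qed
  have "E i \<subseteq> E j \<longleftrightarrow> F i \<subseteq> F j"
    "(\<exists>x y. x \<in> E i \<and> y \<in> E j \<and> x \<oplus> y \<in> E k) \<longleftrightarrow> (\<exists>x y. x \<in> F i \<and> y \<in> F j \<and> x \<oplus> y \<in> F k)"
    "(\<exists>x y. x \<in> E i \<and> y \<in> E j \<and> x \<otimes> y \<in> E k) \<longleftrightarrow> (\<exists>x y. x \<in> F i \<and> y \<in> F j \<and> x \<otimes> y \<in> F k)" for i j k
  proof -
    \<comment> \<open>A stage at which all three columns are final, so that one instance of
      \<open>Sim\<close> covers them.\<close>
    define N where "N = Suc (i + j + k)"
    have "i < l + N" "j < l + N" "k < l + N" unfolding N_def by simp_all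
    note e = this[THEN EF, THEN conjunct1, symmetric] this[THEN EF, THEN conjunct2, symmetric]
    note S = Sim_column[OF PX[of N] I_num[of i] I_num[of j] I_num[of k]]
    show "E i \<subseteq> E j \<longleftrightarrow> F i \<subseteq> F j"
      "(\<exists>x y. x \<in> E i \<and> y \<in> E j \<and> x \<oplus> y \<in> E k) \<longleftrightarrow> (\<exists>x y. x \<in> F i \<and> y \<in> F j \<and> x \<oplus> y \<in> F k)"
      "(\<exists>x y. x \<in> E i \<and> y \<in> E j \<and> x \<otimes> y \<in> E k) \<longleftrightarrow> (\<exists>x y. x \<in> F i \<and> y \<in> F j \<and> x \<otimes> y \<in> F k)"
      unfolding e by (rule S)+
  qed
  then show ?thesis using rE rF start by (intro exI[of _ E] exI[of _ F]) simp
qed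

end

section \<open>From isomorphic inclusion orders to a permutation of points\<close>

lemma order_iso_singleton:
  assumes "{} \<in> range E" "{} \<in> range F" "\<And>y. {y} \<in> range F"
    and iso: "\<And>i j. E i \<subseteq> E j \<longleftrightarrow> F i \<subseteq> F j" and n: "E n = {x}"
  shows "\<exists>y. F n = {y}"
proof -
  have empty: "E i = {} \<longleftrightarrow> F i = {}" for i
  proof -
    obtain j k where "E j = {}" "F k = {}" using assms(1,2) by (metis imageE)
    then show ?thesis using iso[of i j] iso[of i k] iso[of j k] by blast
  qed
  then obtain y where y: "y \<in> F n" using n by blast
  obtain m where m: "F m = {y}" using assms(3)[of y] by (metis imageE)
  \<comment> \<open>Singletons are the minimal nonempty sets: \<open>{y}\<close> is nonempty and
    inside \<open>F n\<close>, so its partner \<open>E m\<close> is a nonempty subset of the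
    singleton \<open>E n\<close>.\<close>
  then have "E m \<subseteq> E n" "E m \<noteq> {}" using iso[of m n] y empty by auto
  then have "E n \<subseteq> E m" unfolding n by auto
  then show ?thesis using iso[of n m] m y by blast
qed

text \<open>Membership is inclusion of a singleton, so the inclusion order determines the
  permutation. Repetitions in \<open>E\<close> and \<open>F\<close> do no harm, as equality is a
  pair of inclusions.\<close>

lemma order_iso_induced:
  assumes "{} \<in> range E" "{} \<in> range F" and sE: "\<And>y. {y} \<in> range E" and sF: "\<And>y. {y} \<in> range F"
    and iso: "\<And>i j. E i \<subseteq> E j \<longleftrightarrow> F i \<subseteq> F j"
  shows "\<exists>h. bij h \<and> (\<forall>i x. E i = {x} \<longrightarrow> F i = {h x}) \<and> (\<forall>i. h ` E i = F i)"
proof -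
  have eq: "E i = E j \<longleftrightarrow> F i = F j" for i j using iso[of i j] iso[of j i] by blast
  have "\<exists>y. \<forall>i. E i = {x} \<longrightarrow> F i = {y}" for x
  proof -
    obtain n where n: "E n = {x}" using sE[of x] by (metis imageE)
    obtain y where "F n = {y}" using order_iso_singleton[OF assms(1,2) sF iso n] by blast
    then show ?thesis using n eq by metis
  qed
  then obtain h where h: "\<And>x i. E i = {x} \<Longrightarrow> F i = {h x}" by metis
  have mem: "h x \<in> F i \<longleftrightarrow> x \<in> E i" for x i
  proof -
    obtain n where n: "E n = {x}" using sE[of x] by (metis imageE)
    then show ?thesis using h[OF n] iso[of n i] by simp
  qed
  have surj: "\<exists>x. y = h x" for y
  proof -
    obtain n where n: "F n = {y}" using sF[of y] by (metis imageE)
    obtain x where "E n = {x}" using order_iso_singleton[OF assms(2,1) sE iso[symmetric] n] by blast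
    then have "F n = {h x}" by (rule h)
    then show ?thesis using n by auto
  qed
  have "inj h"
  proof
    fix x y assume e: "h x = h y"
    obtain n where n: "E n = {x}" using sE[of x] by (metis imageE)
    then have "h x \<in> F n" unfolding mem by blast
    then have "y \<in> E n" unfolding e mem .
    then show "x = y" using n by simp
  qed
  then have "bij h" using surj by (metis bij_def surj_def)
  moreover have "h ` E i = F i" for i using mem surj by (auto simp: image_iff) metis
  ultimately show ?thesis using h by blast
qed

text \<open>The remaining structure is determined by the operations: \<open>\<zero>\<close> is found
  by cancellation, \<open>\<one>\<close> is the only nonzero idempotent, and
  \<open>x \<prec> y\<close> says that \<open>y\<close> is \<open>x\<close> plus a nonzero
  element.\<close>

lemma (in pa_minus) automorphism_of_semiring:
  assumes "bij h" "\<And>x y. h (x \<oplus> y) = h x \<oplus> h y" "\<And>x y. h (x \<otimes> y) = h x \<otimes> h y"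
  shows "automorphism M h"
proof -
  have inj: "h x = h y \<longleftrightarrow> x = y" for x y using assms(1) by (meson bij_is_inj inj_eq)
  have "h \<zero> \<oplus> h \<zero> = \<zero> \<oplus> h \<zero>" using assms(2)[of \<zero> \<zero>] by simp
  then have h0: "h \<zero> = \<zero>" by (rule add_cancel)
  have "h \<one> \<noteq> \<zero>" using inj[of \<one> \<zero>] h0 by simp
  then have "\<zero> \<prec> h \<one>" by (simp add: pos_iff)
  moreover have "h \<one> \<otimes> h \<one> = h \<one>" using assms(3)[of \<one> \<one>] by simp
  ultimately have h1: "h \<one> = \<one>"
    using mul_mono[of "h \<one>" "h \<one>" \<one>] mul_mono[of "h \<one>" \<one> "h \<one>"] lt_linear[of "h \<one>" \<one>] lt_irrefl by auto
  have lt: "h x \<prec> h y" if xy: "x \<prec> y" for x y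
  proof -
    obtain z where z: "x \<oplus> z = y" using lt_diff[OF xy] by blast
    then have "z \<noteq> \<zero>" using xy lt_irrefl add_zero by metis
    then have "\<zero> \<prec> h z" using inj[of z \<zero>] h0 pos_iff by simp
    then have "h x \<prec> h x \<oplus> h z" by simp
    then show ?thesis using assms(2) z by metis
  qed
  have "h x \<prec> h y \<longleftrightarrow> x \<prec> y" for x y
    using lt[of x y] lt[of y x] lt_linear[of x y] lt_irrefl lt_trans by metis
  then show ?thesis unfolding automorphism_def using assms h0 h1 by blast
qed

theorem theorem2p1:
  fixes M :: "'m arith"
    and \<X> \<Y> :: "'m set set"
    and cs :: "'m list"
    and Cs :: "'m set list"
  assumes "countable_structure M \<X>" and "model_WKL0_star M \<X>"
    and "countable_structure M \<Y>" and "model_WKL0_star M \<Y>"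
    and "\<not> sigma01_induction M (\<X> \<inter> \<Y>)"
    and "set Cs \<subseteq> \<X> \<inter> \<Y>"
  shows "\<exists>h. isomorphism M \<X> \<Y> h \<and> map h cs = cs \<and> map (\<lambda>C. h ` C) Cs = Cs"
proof -
  have rX: "rca M \<X>" and rY: "rca M \<Y>" and wX: "WKL M \<X>" and wY: "WKL M \<Y>"
    using assms(2,4) unfolding model_WKL0_star_def model_RCA0_star_def rca_def rca_axioms_def by auto
  interpret R: two_rca M \<X> \<Y> using rX rY by (rule two_rca.intro)
  obtain L I where L: "R.X.Def (\<lambda>z. L (R.X.proj1 z) (R.X.proj2 z))" "R.Y.Def (\<lambda>z. L (R.X.proj1 z) (R.X.proj2 z))"
    "\<And>i j x. i \<preceq>\<^bsub>M\<^esub> j \<Longrightarrow> L i x \<Longrightarrow> L j x" "\<And>i x y. x \<preceq>\<^bsub>M\<^esub> y \<Longrightarrow> L i y \<Longrightarrow> L i x"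
    "\<And>x. \<exists>i u. \<not> L i u \<and> L i x"
    and I: "\<And>i u. \<not> L i u \<Longrightarrow> I i" "I \<zero>\<^bsub>M\<^esub>" "\<And>v. I v \<Longrightarrow> I (R.X.growth v)"
      "\<And>v w. v \<preceq>\<^bsub>M\<^esub> w \<Longrightarrow> I w \<Longrightarrow> I v" "\<exists>b. \<not> I b"
    apply (rule R.levels_exist[OF assms(5)])
    subgoal premises p for L I using p(2-) by (rule p(1))
    done
  have lX: "levels M \<X> L" and lY: "levels M \<Y> L"
    using rX rY L(1-4) by (auto intro!: levels.intro levels_axioms.intro)
  have cof: "\<exists>i. levels.index L i \<and> L i x" for x
    using L(5) unfolding levels.index_def[OF lX] by blast
  have "two_models M \<X> \<Y> L" "two_models M \<Y> \<X> L"
    using lX lY wX wY cof by (auto intro!: two_models.intro two_models_axioms.intro)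
  then interpret B: back_forth M \<X> \<Y> L I
    using I by (auto intro!: back_forth.intro back_forth_axioms.intro)
  \<comment> \<open>The elements of the tuple enter as singletons, which lie in both universes and
    are fixed like the other set parameters.\<close>
  let ?As = "Cs @ map (\<lambda>c. {c}) cs"
  have sub: "set ?As \<subseteq> \<X> \<inter> \<Y>" using assms(6) R.X.singleton_in R.Y.singleton_in by auto
  have c: "countable \<X>" "countable \<Y>" using assms(1,3) unfolding countable_structure_def by auto
  obtain E F where rE: "range E = \<X>" and rF: "range F = \<Y>"
    and As: "\<forall>i<length ?As. E i = ?As ! i \<and> F i = ?As ! i"
    and iso: "\<forall>i j. E i \<subseteq> E j \<longleftrightarrow> F i \<subseteq> F j"
    and add: "\<forall>i j l. (\<exists>x y. x \<in> E i \<and> y \<in> E j \<and> x \<oplus>\<^bsub>M\<^esub> y \<in> E l) \<longleftrightarrow> (\<exists>x y. x \<in> F i \<and> y \<in> F j \<and> x \<oplus>\<^bsub>M\<^esub> y \<in> F l)"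
    and mul: "\<forall>i j l. (\<exists>x y. x \<in> E i \<and> y \<in> E j \<and> x \<otimes>\<^bsub>M\<^esub> y \<in> E l) \<longleftrightarrow> (\<exists>x y. x \<in> F i \<and> y \<in> F j \<and> x \<otimes>\<^bsub>M\<^esub> y \<in> F l)"
    using B.sequence[OF sub c]
    apply (elim exE conjE)
    subgoal premises p using p(2-) by (rule p(1))
    done
  have s: "\<And>y. {y} \<in> range E" "\<And>y. {y} \<in> range F" "{} \<in> range E" "{} \<in> range F"
    unfolding rE rF using R.X.singleton_in R.Y.singleton_in R.X.empty_in R.Y.empty_in by auto
  obtain h where h: "bij h" "\<And>i x. E i = {x} \<Longrightarrow> F i = {h x}" "\<And>i. h ` E i = F i"
    using order_iso_induced[OF s(3,4,1,2) iso[rule_format]] by blast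
  have single: "\<exists>i. E i = {x} \<and> F i = {h x}" for x
    using s(1)[of x] h(2) by (metis imageE)
  \<comment> \<open>On singletons \<open>{x}\<close>, \<open>{y}\<close>, \<open>{z}\<close> the
    preserved relation reads \<open>x \<oplus> y = z\<close>, so its preservation is additivity of
    \<open>h\<close>.\<close>
  have "h (x \<oplus>\<^bsub>M\<^esub> y) = h x \<oplus>\<^bsub>M\<^esub> h y" for x y
  proof -
    obtain i j l where "E i = {x}" "F i = {h x}" "E j = {y}" "F j = {h y}"
      "E l = {x \<oplus>\<^bsub>M\<^esub> y}" "F l = {h (x \<oplus>\<^bsub>M\<^esub> y)}" using single by meson
    then show ?thesis using add[rule_format, of i j l] by simp
  qed
  moreover have "h (x \<otimes>\<^bsub>M\<^esub> y) = h x \<otimes>\<^bsub>M\<^esub> h y" for x y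
  proof -
    obtain i j l where "E i = {x}" "F i = {h x}" "E j = {y}" "F j = {h y}"
      "E l = {x \<otimes>\<^bsub>M\<^esub> y}" "F l = {h (x \<otimes>\<^bsub>M\<^esub> y)}" using single by meson
    then show ?thesis using mul[rule_format, of i j l] by simp
  qed
  ultimately have "automorphism M h" using R.X.automorphism_of_semiring h(1) by blast
  moreover have "(\<lambda>A. h ` A) ` \<X> = \<Y>" unfolding rE[symmetric] rF[symmetric] image_image h(3) ..
  moreover have fixed: "h ` A = A" if A: "A \<in> set ?As" for A
  proof -
    obtain i where "i < length ?As" "?As ! i = A" using A by (metis in_set_conv_nth)
    then show ?thesis using As h(3)[of i] by metis
  qed
  have "map (\<lambda>C. h ` C) Cs = Cs" using fixed by (simp add: map_idI)
  moreover have "h c = c" if "c \<in> set cs" for c using fixed[of "{c}"] that by simp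
  then have "map h cs = cs" by (simp add: map_idI)
  ultimately show ?thesis unfolding isomorphism_def by blast
qed

end
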